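(* Let $(X,d,\mu)$ be a complete metric measure space equipped with a Borel regular doubling measure $\mu$ supporting a $1$-Poincaré inequality. Suppose that $u\in L^1(X)$. Then $u\in \mathrm{BV}(X)$ if, and only if, \[ \liminf_{\varepsilon\to 0^+} \frac{1}{\varepsilon}\int_{\Delta^\varepsilon} \frac{|u(x)-u(y)|}{\sqrt{\mu(B_\varepsilon(x))}\,\sqrt{\mu(B_\varepsilon(y))}}\, d(\mu\otimes\mu)(x,y)<\infty, \] where $\Delta^\varepsilon=\{(x,y)\in X\times X: d(x,y)<\varepsilon\}$.
   Context: Notation: $B_r(x)=\{y\in X: d(x,y)<r\}$; $u_{B}=\frac{1}{\mu(B)}\int_B u\,d\mu$. Doubling: there is $c_D\ge 1$ with $0<\mu(B_{2r}(x))\le c_D\,\mu(B_r(x))<\infty$ for all $x\in X$, $r>0$. $1$-Poincaré inequality: there are constants $c_P>0$, $\lambda\ge 1$ such that for every Lipschitz $u:X\to\mathbb{R}$ and every ball $B_r(x)$, \[ \int_{B_r(x)}|u-u_{B_r(x)}|\,d\mu\le c_P\, r\int_{B_{\lambda r}(x)}\mathrm{lip}(u)\,d\mu,\qquad \mathrm{lip}(u)(y)=\liminf_{\varrho\to0^+}\sup_{z\in B_\varrho(y)\setminus\{y\}}\frac{|u(y)-u(z)|}{d(y,z)}. \] Upper gradients: a Borel function $g:X\to[0,\infty]$ is an upper gradient of $u$ if $|u(\gamma(0))-u(\gamma(l_\gamma))|\le\int_\gamma g\,ds$ for every nonconstant compact rectifiable curve $\gamma:[0,l_\gamma]\to X$;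 it is a $p$-weak upper gradient if this holds for $p$-almost every curve (i.e. outside a family of curves of zero $p$-modulus). The minimal $p$-weak upper gradient of $u$ is denoted $g_u$. BV: for $u\in L^1(X)$, \[ \|Du\|(X)=\inf\Big\{\liminf_{j\to\infty}\int_X g_{u_j}\,d\mu:\ u_j\in \mathrm{Lip}_{\mathrm{loc}}(X),\ u_j\to u\text{ in }L^1_{\mathrm{loc}}(X)\Big\}, \] where $g_{u_j}$ is the minimal $1$-weak upper gradient of $u_j$. One says $u\in\mathrm{BV}(X)$ if $u\in L^1(X)$ and $\|Du\|(X)<\infty$. *)

theory Defs
  imports "HOL-Analysis.Analysis"
begin

section \<open>Metric measure spaces\<close>

text \<open>
  The metric space is a type of class \<^class>\<open>metric_space\<close>. The measure \<open>M\<close> may live on any sigma-algebra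
  between the Borel sets and the Caratheodory-measurable sets of the associated outer measure;
  the last conjunct then extends to every set \<open>A\<close>, with the outer measure of \<open>A\<close> on the right.
\<close>

definition borel_regular_measure :: "'a::metric_space measure \<Rightarrow> bool" where
  "borel_regular_measure M \<longleftrightarrow>
     space M = UNIV \<and> sets borel \<subseteq> sets M \<and>
     (\<forall>A\<in>sets M. \<exists>B\<in>sets borel. A \<subseteq> B \<and> emeasure M B = emeasure M A)"

definition doubling_measure :: "'a::metric_space measure \<Rightarrow> bool" where
  "doubling_measure M \<longleftrightarrow>
     (\<exists>c\<ge>1::real. \<forall>x. \<forall>r>0.
        0 < emeasure M (ball x (2 * r)) \<and>
        emeasure M (ball x (2 * r)) \<le> ennreal c * emeasure M (ball x r) \<and>
        emeasure M (ball x r) < \<infinity>)"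

definition mean_value :: "'a measure \<Rightarrow> 'a set \<Rightarrow> ('a \<Rightarrow> real) \<Rightarrow> real" where
  "mean_value M B u = (1 / measure M B) * (LINT x:B|M. u x)"

text \<open>At an isolated point the supremum is eventually over the empty set, so the value is \<open>0\<close>.\<close>

definition pointwise_lip :: "('a::metric_space \<Rightarrow> real) \<Rightarrow> 'a \<Rightarrow> ennreal" where
  "pointwise_lip u y =
     Liminf (at_right 0) (\<lambda>\<rho>::real. SUP z\<in>ball y \<rho> - {y}. ennreal (\<bar>u y - u z\<bar> / dist y z))"

definition supports_poincare_1 :: "'a::metric_space measure \<Rightarrow> bool" where
  "supports_poincare_1 M \<longleftrightarrow>
     (\<exists>cP>0::real. \<exists>\<Lambda>\<ge>1::real. \<forall>u L x. \<forall>r>0. L-lipschitz_on UNIV u \<longrightarrow>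
        (\<integral>\<^sup>+y\<in>ball x r. ennreal \<bar>u y - mean_value M (ball x r) u\<bar> \<partial>M)
          \<le> ennreal (cP * r) * (\<integral>\<^sup>+y\<in>ball x (\<Lambda> * r). pointwise_lip u y \<partial>M))"

section \<open>Rectifiable curves and weak upper gradients\<close>

definition curve_length :: "(real \<Rightarrow> 'a::metric_space) \<Rightarrow> real \<Rightarrow> real \<Rightarrow> ennreal" where
  "curve_length \<gamma> a b =
     (SUP ts\<in>{ts. sorted ts \<and> set ts \<subseteq> {a..b}}.
        \<Sum>i<length ts - 1. ennreal (dist (\<gamma> (ts ! i)) (\<gamma> (ts ! Suc i))))"

text \<open>
  The nonconstant compact rectifiable curves, each parametrised by arc length: a pair \<open>(l, \<gamma>)\<close>
  stands for \<open>\<gamma> : [0, l] \<rightarrow> X\<close> with \<open>l > 0\<close> its length. Values of \<open>\<gamma>\<close> outside \<open>[0, l]\<close> are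
  irrelevant. Continuity is implied, since \<open>dist (\<gamma> s) (\<gamma> t) \<le> \<bar>s - t\<bar>\<close>.
\<close>

definition rectifiable_curves :: "(real \<times> (real \<Rightarrow> 'a::metric_space)) set" where
  "rectifiable_curves =
     {(l, \<gamma>). 0 < l \<and> (\<forall>s t. 0 \<le> s \<and> s \<le> t \<and> t \<le> l \<longrightarrow> curve_length \<gamma> s t = ennreal (t - s))}"

definition curve_integral :: "('a \<Rightarrow> ennreal) \<Rightarrow> real \<times> (real \<Rightarrow> 'a) \<Rightarrow> ennreal" where
  "curve_integral g c = (\<integral>\<^sup>+t\<in>{0..fst c}. g (snd c t) \<partial>lborel)"

definition modulus_1 :: "'a::metric_space measure \<Rightarrow> (real \<times> (real \<Rightarrow> 'a)) set \<Rightarrow> ennreal" where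
  "modulus_1 M \<Gamma> =
     (INF \<rho>\<in>{\<rho>. \<rho> \<in> borel_measurable borel \<and> (\<forall>c\<in>\<Gamma>. 1 \<le> curve_integral \<rho> c)}.
        \<integral>\<^sup>+x. \<rho> x \<partial>M)"

definition weak_upper_gradient_1 ::
  "'a::metric_space measure \<Rightarrow> ('a \<Rightarrow> real) \<Rightarrow> ('a \<Rightarrow> ennreal) \<Rightarrow> bool" where
  "weak_upper_gradient_1 M u g \<longleftrightarrow>
     g \<in> borel_measurable borel \<and>
     modulus_1 M {c \<in> rectifiable_curves.
       \<not> ennreal \<bar>u (snd c 0) - u (snd c (fst c))\<bar> \<le> curve_integral g c} = 0"

definition locally_L1 :: "'a::metric_space measure \<Rightarrow> ('a \<Rightarrow> ennreal) \<Rightarrow> bool" where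
  "locally_L1 M g \<longleftrightarrow> (\<forall>x. \<exists>r>0. (\<integral>\<^sup>+y\<in>ball x r. g y \<partial>M) < \<infinity>)"

text \<open>
  As usual, minimality is among the locally integrable 1-weak upper gradients. This restriction is
  essential: a function that is infinite on a dense open set of small measure and zero elsewhere
  can be an upper gradient of \<open>u x = x\<close> on the real line. The minimal one is unique up to null
  sets, and it exists whenever some locally integrable 1-weak upper gradient does.
\<close>

definition is_minimal_weak_upper_gradient_1 ::
  "'a::metric_space measure \<Rightarrow> ('a \<Rightarrow> real) \<Rightarrow> ('a \<Rightarrow> ennreal) \<Rightarrow> bool" where
  "is_minimal_weak_upper_gradient_1 M u g \<longleftrightarrow>
     weak_upper_gradient_1 M u g \<and> locally_L1 M g \<and>
     (\<forall>h. weak_upper_gradient_1 M u h \<and> locally_L1 M h \<longrightarrow> (AE x in M. g x \<le> h x))"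

definition minimal_weak_upper_gradient_1 ::
  "'a::metric_space measure \<Rightarrow> ('a \<Rightarrow> real) \<Rightarrow> 'a \<Rightarrow> ennreal" where
  "minimal_weak_upper_gradient_1 M u = (SOME g. is_minimal_weak_upper_gradient_1 M u g)"

section \<open>Functions of bounded variation\<close>

definition locally_lipschitz :: "('a::metric_space \<Rightarrow> real) \<Rightarrow> bool" where
  "locally_lipschitz u \<longleftrightarrow> (\<forall>x. \<exists>r>0. \<exists>L. L-lipschitz_on (ball x r) u)"

definition tendsto_L1_loc ::
  "'a::metric_space measure \<Rightarrow> (nat \<Rightarrow> 'a \<Rightarrow> real) \<Rightarrow> ('a \<Rightarrow> real) \<Rightarrow> bool" where
  "tendsto_L1_loc M v u \<longleftrightarrow>
     (\<forall>x. \<exists>r>0. (\<lambda>j. \<integral>\<^sup>+y\<in>ball x r. ennreal \<bar>v j y - u y\<bar> \<partial>M) \<longlonglongrightarrow> 0)"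

definition total_variation :: "'a::metric_space measure \<Rightarrow> ('a \<Rightarrow> real) \<Rightarrow> ennreal" where
  "total_variation M u =
     (INF v\<in>{v. (\<forall>j. locally_lipschitz (v j)) \<and> tendsto_L1_loc M v u}.
        liminf (\<lambda>j. \<integral>\<^sup>+x. minimal_weak_upper_gradient_1 M (v j) x \<partial>M))"

definition BV :: "'a::metric_space measure \<Rightarrow> ('a \<Rightarrow> real) set" where
  "BV M = {u. integrable M u \<and> total_variation M u < \<infinity>}"

end

theory Submission
  imports Defs
begin

text \<open>
  Both directions use coverings by balls centred at maximal separated sets; by doubling, these
  overlap boundedly.

  If \<open>u \<in> BV\<close>, the double integral over a ball \<open>B\<close> of \<open>|v(x) - v(y)|\<close> is at most \<open>2 \<mu>(B)\<close> times
  \<open>\<integral>\<^sub>B |v - v\<^sub>B|\<close>, and the Poincare inequality for the approximating locally Lipschitz functions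
  \<open>v\<close>, summed over a covering at scale \<open>\<epsilon>\<close>, bounds the energy by \<open>\<epsilon> \<integral> g\<^sub>v\<close>; Fatou's lemma
  passes to \<open>u\<close>. The hypothesis only gives the Poincare inequality with the pointwise Lipschitz
  constant of a Lipschitz function. To replace it by a weak upper gradient \<open>g\<close>, add to \<open>g\<close> a small
  multiple of a function whose integral along every exceptional curve is infinite, and dominate the
  result by a lower semicontinuous function, the limit of increasing Lipschitz functions \<open>\<phi>\<^sub>n\<close>. The
  infimum of \<open>v(p\<^sub>0) + \<Sum> (\<phi>\<^sub>n(p\<^sub>i) + \<delta>) d(p\<^sub>i, p\<^sub>i\<^sub>+\<^sub>1)\<close> over chains of step at most \<open>1/n\<close> ending at \<open>x\<close>
  is a Lipschitz function of \<open>x\<close> with pointwise Lipschitz constant at most \<open>\<phi>\<^sub>n + \<delta>\<close>. It increases to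
  \<open>v\<close>: since \<open>X\<close> is proper, cheap chains would otherwise accumulate at a rectifiable curve that
  violates the upper gradient inequality.

  Conversely, averaging the means of \<open>u\<close> over balls of radius \<open>\<epsilon>/10\<close> with a Lipschitz partition of
  unity gives a locally Lipschitz function whose \<open>L\<^sup>1\<close> distance to \<open>u\<close> and whose upper gradient are
  controlled by the energy at scale \<open>\<epsilon>\<close>.
\<close>

section \<open>Doubling measures and separated nets\<close>

text \<open>Since \<open>minimal_weak_upper_gradient_1\<close> is a choice, nothing is known about
  it until existence is shown: the locally integrable weak upper gradients of a function are closed
  under \<open>min\<close> and under decreasing limits, which gives a minimal one as soon as any
  exists, and a locally Lipschitz function has one built from its Lipschitz constants on the balls
  of a net. The weight in the energy is the reciprocal of a geometric mean of two ball measures; at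
  distance below \<epsilon>, doubling makes both comparable to the measure of a single ball around a
  net point, so the energy can be compared with sums of normalised double integrals over balls. The
  measure may live on a sigma-algebra larger than the Borel sets; the double integrals are therefore
  taken over products of balls, which are measurable rectangles, and are compared with the strip
  \<open>dist x y < \<epsilon>\<close> only through pointwise inequalities.\<close>

locale metric_doubling =
  fixes M :: "'a::metric_space measure" and c :: real
  assumes space_M: "space M = UNIV"
    and borel_sets_M: "sets borel \<subseteq> sets M"
    and c_ge_1: "1 \<le> c"
    and ball_pos: "\<And>x r. 0 < r \<Longrightarrow> 0 < emeasure M (ball x r)"
    and ball_fin: "\<And>x r. 0 < r \<Longrightarrow> emeasure M (ball x r) < \<infinity>"
    and doubling: "\<And>x r. 0 < r \<Longrightarrow>
          emeasure M (ball x (2 * r)) \<le> ennreal c * emeasure M (ball x r)"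

lemma doubling_measure_imp_locale:
  fixes M :: "'a::metric_space measure"
  assumes "borel_regular_measure M" "doubling_measure M"
  obtains c where "metric_doubling M c"
proof -
  obtain c :: real where c: "c \<ge> 1"
    "\<And>x r. r > 0 \<Longrightarrow> 0 < emeasure M (ball x (2 * r))"
    "\<And>x r. r > 0 \<Longrightarrow> emeasure M (ball x (2 * r)) \<le> ennreal c * emeasure M (ball x r)"
    "\<And>x r. r > 0 \<Longrightarrow> emeasure M (ball x r) < \<infinity>"
    using assms(2) unfolding doubling_measure_def by blast
  \<comment> \<open>The definition states positivity at radius \<open>2 * r\<close>, so it is
    applied with \<open>r / 2\<close>.\<close>
  have "0 < emeasure M (ball x r)" if "r > 0" for x r
    using c(2)[of "r / 2" x] that by simp
  then have "metric_doubling M c"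
    using assms(1) c unfolding metric_doubling_def borel_regular_measure_def by auto
  then show ?thesis by (rule that)
qed

definition separated :: "real \<Rightarrow> 'a::metric_space set \<Rightarrow> bool" where
  "separated r D \<longleftrightarrow> (\<forall>x\<in>D. \<forall>y\<in>D. x \<noteq> y \<longrightarrow> r \<le> dist x y)"

text \<open>Separation and covering use the same radius because a maximal separated set has both;
  strictness in the covering condition lets the open balls of radius \<open>r\<close> cover the
  space.\<close>

definition net :: "real \<Rightarrow> 'a::metric_space set \<Rightarrow> bool" where
  "net r D \<longleftrightarrow> separated r D \<and> (\<forall>x. \<exists>i\<in>D. dist i x < r)"

text \<open>Zorn's lemma gives a maximal separated set; an uncovered point could be added to
  it.\<close>

lemma net_exists:
  fixes r :: real
  assumes "r > 0"
  obtains D :: "'a::metric_space set" where "net r D"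
proof -
  have "\<exists>D\<in>{D::'a set. separated r D}. \<forall>E\<in>{D. separated r D}. D \<subseteq> E \<longrightarrow> E = D"
  proof (rule subset_Zorn')
    fix \<C> assume ch: "subset.chain {D::'a set. separated r D} \<C>"
    have "r \<le> dist x y" if "x \<in> A" "A \<in> \<C>" "y \<in> B" "B \<in> \<C>" "x \<noteq> y" for x y A B
    proof -
      have "A \<subseteq> B \<or> B \<subseteq> A" using ch that unfolding subset.chain_def by blast
      then show ?thesis using that ch unfolding subset.chain_def separated_def by blast
    qed
    then show "\<Union>\<C> \<in> {D. separated r D}" unfolding separated_def by blast
  qed
  then obtain D :: "'a set" where D: "separated r D" "\<And>E. separated r E \<Longrightarrow> D \<subseteq> E \<Longrightarrow> E = D"
    by blast
  have "\<exists>i\<in>D. dist i x < r" for x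
  proof (rule ccontr)
    assume a: "\<not> (\<exists>i\<in>D. dist i x < r)"
    then have "separated r (insert x D)"
      using D(1) unfolding separated_def by (auto simp: dist_commute not_less)
    then have "x \<in> D" using D(2)[of "insert x D"] by blast
    with a assms show False by force
  qed
  then show ?thesis using D(1) that unfolding net_def by blast
qed

context metric_doubling
begin

lemma borel_in_M: "A \<in> sets borel \<Longrightarrow> A \<in> sets M"
  using borel_sets_M by blast

lemma borel_measurable_M: "f \<in> measurable borel N \<Longrightarrow> f \<in> measurable M N"
  using borel_sets_M space_M unfolding measurable_def by auto

lemma ball_M [simp]: "ball x r \<in> sets M"
  by (simp add: borel_in_M)

lemma emeasure_ball: "emeasure M (ball x r) = ennreal (measure M (ball x r))"
proof (cases "r > 0")
  case True
  then show ?thesis using ball_fin[of r x] by (simp add: emeasure_eq_ennreal_measure)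
next
  case False
  then have "ball x r = {}" by auto
  then show ?thesis by (simp only: emeasure_empty measure_empty ennreal_0)
qed

lemma measure_ball_pos: "0 < r \<Longrightarrow> 0 < measure M (ball x r)"
  using ball_pos[of r x] by (simp add: emeasure_ball)

lemma measure_ball_mono: "ball x r \<subseteq> ball y s \<Longrightarrow> measure M (ball x r) \<le> measure M (ball y s)"
proof -
  assume "ball x r \<subseteq> ball y s"
  then have "emeasure M (ball x r) \<le> emeasure M (ball y s)" by (intro emeasure_mono) auto
  then show ?thesis by (simp add: emeasure_ball)
qed

lemma measure_ball_doubling:
  assumes "0 < r" shows "measure M (ball x (2 * r)) \<le> c * measure M (ball x r)"
proof -
  have "ennreal (measure M (ball x (2 * r))) \<le> ennreal (c * measure M (ball x r))"
    using doubling[OF assms, of x] c_ge_1 by (simp add: emeasure_ball ennreal_mult)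
  then show ?thesis using c_ge_1 by (simp add: ennreal_le_iff)
qed

lemma measure_ball_doubling_pow:
  assumes "0 < r" shows "measure M (ball x (2 ^ k * r)) \<le> c ^ k * measure M (ball x r)"
proof (induction k)
  case (Suc k)
  have "measure M (ball x (2 ^ Suc k * r)) \<le> c * measure M (ball x (2 ^ k * r))"
    using measure_ball_doubling[of "2 ^ k * r" x] assms by (simp add: mult.assoc)
  also have "\<dots> \<le> c * (c ^ k * measure M (ball x r))"
    using Suc c_ge_1 by (intro mult_left_mono) auto
  finally show ?case by (simp add: mult.assoc)
qed simp

text \<open>The form in which doubling is used below: a ball with another centre is enclosed in a
  dyadic enlargement of \<open>ball x r\<close>, so that only the exponent \<open>k\<close> has to
  be counted.\<close>

lemma measure_ball_le_pow:
  assumes "0 < r" "dist x y + s \<le> 2 ^ k * r"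
  shows "measure M (ball y s) \<le> c ^ k * measure M (ball x r)"
proof -
  have "ball y s \<subseteq> ball x (2 ^ k * r)"
  proof
    fix z assume "z \<in> ball y s"
    then have "dist x z < dist x y + s" using dist_triangle[of x z y] by simp
    then show "z \<in> ball x (2 ^ k * r)" using assms(2) by simp
  qed
  then show ?thesis
    using measure_ball_mono measure_ball_doubling_pow[OF assms(1), of x k] order_trans by blast
qed

text \<open>A volume count: the balls of radius \<open>r / 2\<close> around separated points are
  disjoint, lie in one ball of radius \<open>(K + 1) * r\<close>, and each carries a fixed fraction
  of its measure. The bound \<open>N\<close> depends only on \<open>c\<close> and \<open>K\<close>,
  hence serves all scales and all nets.\<close>

lemma separated_card_bound:
  fixes K :: real
  assumes "K > 0"
  obtains N :: nat where "\<And>r D (x::'a). 0 < r \<Longrightarrow> separated r D \<Longrightarrow>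
    finite (D \<inter> ball x (K * r)) \<and> card (D \<inter> ball x (K * r)) \<le> N"
proof -
  \<comment> \<open>\<open>ball x ((K + 1) * r)\<close> lies in the ball around \<open>e\<close> of
    radius \<open>(2 * K + 1) * r\<close>, which is \<open>2 * (2 * K + 1)\<close> times
    \<open>r / 2\<close>.\<close>
  obtain k :: nat where k: "2 * (2 * K + 1) < 2 ^ k"
    using real_arch_pow[of 2 "2 * (2 * K + 1)"] by auto
  obtain N :: nat where N: "c ^ k \<le> real N" using real_arch_simple by blast
  \<comment> \<open>Finite subsets are counted first, since \<open>card\<close> says nothing about
    an infinite set; an infinite intersection would contain \<open>Suc N\<close> points.\<close>
  have *: "card E \<le> N" if r: "0 < r" and sep: "separated r D" and E: "finite E" "E \<subseteq> D \<inter> ball x (K * r)"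
    for r x and D E :: "'a set"
  proof -
    let ?m = "measure M (ball x ((K + 1) * r))"
    have disj: "disjoint_family_on (\<lambda>e. ball e (r / 2)) E"
    proof (unfold disjoint_family_on_def, intro ballI impI)
      fix a b assume ab: "a \<in> E" "b \<in> E" "a \<noteq> b"
      then have d: "r \<le> dist a b" using sep E unfolding separated_def by blast
      show "ball a (r/2) \<inter> ball b (r/2) = {}"
      proof (rule ccontr)
        assume "ball a (r/2) \<inter> ball b (r/2) \<noteq> {}"
        then obtain z where "dist a z < r/2" "dist b z < r/2" by auto
        then show False using d dist_triangle2[of a b z] by simp
      qed
    qed
    have each: "?m \<le> c ^ k * measure M (ball e (r/2))" if "e \<in> E" for e
    proof (rule measure_ball_le_pow)
      have "dist e x < K * r" using E that by (auto simp: dist_commute)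
      then have "dist e x + (K + 1) * r \<le> (2 * (2 * K + 1)) * (r/2)" by (simp add: algebra_simps)
      also have "\<dots> \<le> 2 ^ k * (r/2)" using k r by (intro mult_right_mono) auto
      finally show "dist e x + (K + 1) * r \<le> 2 ^ k * (r/2)" .
    qed (use r in auto)
    have "(\<Sum>e\<in>E. emeasure M (ball e (r/2))) = emeasure M (\<Union>e\<in>E. ball e (r/2))"
      using disj E by (intro sum_emeasure) auto
    also have "\<dots> \<le> emeasure M (ball x ((K + 1) * r))"
    proof (intro emeasure_mono)
      show "(\<Union>e\<in>E. ball e (r/2)) \<subseteq> ball x ((K + 1) * r)"
      proof
        fix z assume "z \<in> (\<Union>e\<in>E. ball e (r/2))"
        then obtain e where e: "e \<in> E" "dist e z < r/2" by auto
        then have "dist x e < K * r" using E by auto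
        then have "dist x z < K * r + r / 2" using e dist_triangle[of x z e] by simp
        then show "z \<in> ball x ((K + 1) * r)" using r by (simp add: algebra_simps)
      qed
    qed auto
    finally have "(\<Sum>e\<in>E. measure M (ball e (r/2))) \<le> ?m"
      by (simp add: emeasure_ball)
    moreover have "(\<Sum>e\<in>E. ?m) \<le> (\<Sum>e\<in>E. c ^ k * measure M (ball e (r/2)))"
      by (rule sum_mono) (rule each)
    moreover have "0 \<le> c ^ k" using c_ge_1 by simp
    ultimately have "real (card E) * ?m \<le> c ^ k * ?m"
      using mult_left_mono by (fastforce simp: sum_distrib_left[symmetric])
    moreover have "?m > 0" using assms r by (intro measure_ball_pos) auto
    ultimately have "real (card E) \<le> c ^ k" by simp
    then show ?thesis using N by linarith
  qed
  show ?thesis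
  proof (rule that)
    fix r :: real and D :: "'a set" and x :: 'a assume a: "0 < r" "separated r D"
    have "finite (D \<inter> ball x (K * r))"
    proof (rule ccontr)
      assume "infinite (D \<inter> ball x (K * r))"
      then obtain E where "finite E" "card E = Suc N" "E \<subseteq> D \<inter> ball x (K * r)"
        using infinite_arbitrarily_large by metis
      then show False using *[OF a] by (metis not_less_eq_eq order_refl)
    qed
    then show "finite (D \<inter> ball x (K * r)) \<and> card (D \<inter> ball x (K * r)) \<le> N"
      using *[OF a] by blast
  qed
qed

lemma separated_finite_ball:
  fixes x :: 'a
  assumes "0 < r" "separated r D"
  shows "finite (D \<inter> ball x R)"
proof -
  define K where "K = (\<bar>R\<bar> + 1) / r"
  have "K > 0" using assms unfolding K_def by simp
  then obtain N where "finite (D \<inter> ball x (K * r))"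
    using separated_card_bound[of K] assms by metis
  moreover have "ball x R \<subseteq> ball x (K * r)" using assms unfolding K_def by auto
  ultimately show ?thesis by (meson Int_mono finite_subset order_refl)
qed

lemma separated_countable:
  fixes D :: "'a set"
  assumes "0 < r" "separated r D"
  shows "countable D"
proof -
  \<comment> \<open>\<open>undefined\<close> serves as an arbitrary base point, here and
    below.\<close>
  have "D = (\<Union>n::nat. D \<inter> ball undefined (real n))"
    by (auto simp: reals_Archimedean2)
  also have "countable \<dots>"
    using separated_finite_ball[OF assms] by (intro countable_UN) (auto intro: countable_finite)
  finally show ?thesis .
qed

lemma sigma_finite_M: "sigma_finite_measure M"
proof
  have "(\<Union>n::nat. ball (undefined::'a) (real n)) = UNIV"
    by (auto simp: reals_Archimedean2)
  then show "\<exists>A. countable A \<and> A \<subseteq> sets M \<and> \<Union> A = space M \<and> (\<forall>a\<in>A. emeasure M a \<noteq> \<infinity>)"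
    by (intro exI[of _ "range (\<lambda>n. ball undefined (real n))"])
       (auto simp: space_M emeasure_ball)
qed

end

sublocale metric_doubling \<subseteq> sigma_finite_measure M
  by (rule sigma_finite_M)

text \<open>Total boundedness comes from the finitely many net points near a ball, compactness then
  from completeness. This properness produces limit curves and finite subcovers later.\<close>

lemma doubling_compact_cball:
  fixes M :: "'a::complete_space measure"
  assumes "metric_doubling M c"
  shows "compact (cball (x::'a) R)"
proof -
  interpret metric_doubling M c by fact
  have "\<exists>k. finite k \<and> cball x R \<subseteq> (\<Union>y\<in>k. ball y e)" if "e > 0" for e
  proof -
    obtain D :: "'a set" where D: "net e D" using net_exists[OF \<open>e > 0\<close>] .
    show ?thesis
    proof (intro exI[of _ "D \<inter> ball x (R + e)"] conjI subsetI)
      show "finite (D \<inter> ball x (R + e))"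
        using D that by (intro separated_finite_ball) (auto simp: net_def)
      fix z assume z: "z \<in> cball x R"
      obtain i where i: "i \<in> D" "dist i z < e" using D unfolding net_def by blast
      then have "dist x i < R + e" using z dist_triangle2[of x i z] by auto
      then show "z \<in> (\<Union>y\<in>D \<inter> ball x (R + e). ball y e)" using i by auto
    qed
  qed
  then show ?thesis
    by (simp add: compact_eq_totally_bounded complete_eq_closed)
qed

section \<open>Approximation from above by lower semicontinuous functions\<close>

lemma suminf_ennreal_half_powers:
  assumes "0 \<le> \<epsilon>" shows "(\<Sum>n. ennreal (\<epsilon> * (1 / 2) ^ Suc n)) = ennreal \<epsilon>"
proof -
  have "(\<lambda>n. \<epsilon> * (1 / 2) ^ Suc n) sums (\<epsilon> * 1)" by (intro sums_mult power_half_series)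
  then show ?thesis using assms by (intro suminf_ennreal_eq) auto
qed

text \<open>Closed sets are countable intersections of open sets, the base case of outer regularity.
  \<open>infdist\<close> to the empty set is 0 by convention, whence
  \<open>S \<noteq> {}\<close>.\<close>

lemma closed_eq_Inter_open:
  fixes S :: "'a::metric_space set"
  assumes "closed S" "S \<noteq> {}"
  shows "S = (\<Inter>n. {x. infdist x S < 1 / real (Suc n)})"
proof (intro equalityI subsetI)
  fix x assume "x \<in> S" then show "x \<in> (\<Inter>n. {x. infdist x S < 1 / real (Suc n)})" by simp
next
  fix x assume x: "x \<in> (\<Inter>n. {x. infdist x S < 1 / real (Suc n)})"
  have "infdist x S \<le> 0"
  proof (rule ccontr)
    assume "\<not> infdist x S \<le> 0"
    then obtain n where "inverse (real (Suc n)) < infdist x S"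
      using reals_Archimedean by (meson not_le)
    moreover have "infdist x S < 1 / real (Suc n)" using x by blast
    ultimately show False by (simp add: field_simps)
  qed
  then show "x \<in> S" using assms infdist_nonneg[of x S] in_closed_iff_infdist_zero[of S x] by auto
qed

text \<open>Induction over the generation of the Borel sets. The restriction to a set
  \<open>W\<close> of finite measure makes continuity from above available; the error is the measure
  of a difference, so that errors can be summed.\<close>

lemma (in metric_doubling) outer_regular_finite_part:
  assumes W: "W \<in> sets M" "emeasure M W < \<infinity>" and A: "A \<in> sets borel" and "\<epsilon> > 0"
  shows "\<exists>U. open U \<and> A \<subseteq> U \<and> emeasure M (W \<inter> (U - A)) \<le> ennreal \<epsilon>"
proof -
  let ?R = "\<lambda>A. \<forall>\<epsilon>>0. \<exists>U. open U \<and> A \<subseteq> U \<and> emeasure M (W \<inter> (U - A)) \<le> ennreal \<epsilon>"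
  have decr: "\<exists>n. emeasure M (W \<inter> F n) \<le> ennreal \<epsilon>"
    if "\<And>n. F n \<in> sets borel" "decseq F" "emeasure M (W \<inter> (\<Inter>n. F n)) < ennreal \<epsilon>"
    for F :: "nat \<Rightarrow> 'a set" and \<epsilon>
  proof -
    have fin: "emeasure M (W \<inter> F n) \<noteq> \<infinity>" for n
    proof -
      have "emeasure M (W \<inter> F n) \<le> emeasure M W" using W by (intro emeasure_mono) auto
      from le_less_trans[OF this W(2)] show ?thesis by simp
    qed
    have "W \<inter> F n \<in> sets M" for n using W that(1) borel_in_M by blast
    moreover have "decseq (\<lambda>n. W \<inter> F n)" using that(2) unfolding decseq_def by blast
    ultimately have "(\<lambda>n. emeasure M (W \<inter> F n)) \<longlonglongrightarrow> emeasure M (\<Inter>n. W \<inter> F n)"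
      using fin by (intro Lim_emeasure_decseq) auto
    then have "(\<lambda>n. emeasure M (W \<inter> F n)) \<longlonglongrightarrow> emeasure M (W \<inter> (\<Inter>n. F n))" by simp
    from order_tendstoD(2)[OF this that(3)]
    obtain n where "emeasure M (W \<inter> F n) < ennreal \<epsilon>"
      by (auto simp: eventually_sequentially)
    then show ?thesis by (intro exI[of _ n]) simp
  qed
  have "A \<in> sigma_sets UNIV {S. open S}" using A by (simp add: borel_def)
  \<comment> \<open>Regularity of \<open>A\<close> and of its complement are carried together, so
    that the complement step is a swap.\<close>
  then have "A \<in> sets borel \<and> ?R A \<and> ?R (- A)"
  proof (induct rule: sigma_sets.induct)
    case (Basic S)
    then have S: "open S" by simp
    have "?R (- S)"
    proof (cases "- S = {}")
      case False
      show ?thesis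
      proof (intro allI impI)
        fix \<epsilon> :: real assume "\<epsilon> > 0"
        let ?V = "\<lambda>n::nat. {x. infdist x (- S) < 1 / real (Suc n)}"
        have V: "open (?V n)" for n
          by (intro open_Collect_less continuous_intros)
        have eq: "- S = (\<Inter>n. ?V n)" using S False by (intro closed_eq_Inter_open) auto
        have "\<exists>n. emeasure M (W \<inter> (?V n - - S)) \<le> ennreal \<epsilon>"
        proof (rule decr)
          show "?V n - - S \<in> sets borel" for n using V S by (intro sets.Diff) auto
          show "decseq (\<lambda>n. ?V n - - S)"
          proof (unfold decseq_def, intro allI impI subsetI)
            fix m n :: nat and x assume "m \<le> n" "x \<in> ?V n - - S"
            moreover from \<open>m \<le> n\<close> have "1 / real (Suc n) \<le> 1 / real (Suc m)"
              by (intro divide_left_mono) auto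
            ultimately show "x \<in> ?V m - - S" by simp
          qed
          have "(\<Inter>n. ?V n - - S) = {}" using eq by blast
          then show "emeasure M (W \<inter> (\<Inter>n. ?V n - - S)) < ennreal \<epsilon>" using \<open>\<epsilon> > 0\<close> by simp
        qed
        then obtain n where n: "emeasure M (W \<inter> (?V n - - S)) \<le> ennreal \<epsilon>" ..
        have "- S \<subseteq> ?V n" using eq by blast
        then show "\<exists>U. open U \<and> - S \<subseteq> U \<and> emeasure M (W \<inter> (U - - S)) \<le> ennreal \<epsilon>"
          using V n by blast
      qed
    qed (auto intro!: exI[of _ "{}"])
    then show ?case using S by (auto intro!: exI[of _ S])
  next
    case Empty
    have "?R {}" by (intro allI impI exI[of _ "{}"]) auto
    moreover have "?R (- {})" by (intro allI impI exI[of _ UNIV]) auto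
    ultimately show ?case by simp
  next
    case (Compl a)
    then show ?case by (auto simp: Compl_eq_Diff_UNIV[symmetric])
  next
    case (Union a)
    have a: "a i \<in> sets borel" for i using Union by blast
    have 1: "?R (\<Union>(range a))"
    proof (intro allI impI)
      fix \<epsilon> :: real assume "\<epsilon> > 0"
      have "\<exists>U. open U \<and> a i \<subseteq> U \<and> emeasure M (W \<inter> (U - a i)) \<le> ennreal (\<epsilon> * (1/2) ^ Suc i)" for i
        using Union(2)[of i] \<open>\<epsilon> > 0\<close> by simp
      then obtain U where U: "\<And>i. open (U i)" "\<And>i. a i \<subseteq> U i"
        "\<And>i. emeasure M (W \<inter> (U i - a i)) \<le> ennreal (\<epsilon> * (1/2) ^ Suc i)" by metis
      have UM: "W \<inter> (U i - a i) \<in> sets M" for i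
        using U a W by (intro sets.Int[OF W(1)] borel_in_M sets.Diff) auto
      have "emeasure M (W \<inter> (\<Union>(range U) - \<Union>(range a))) \<le> emeasure M (\<Union>i. W \<inter> (U i - a i))"
        using UM by (intro emeasure_mono sets.countable_UN) auto
      also have "\<dots> \<le> (\<Sum>i. emeasure M (W \<inter> (U i - a i)))"
        using UM by (intro emeasure_subadditive_countably) auto
      also have "\<dots> \<le> (\<Sum>i. ennreal (\<epsilon> * (1/2) ^ Suc i))"
        by (intro suminf_le U(3)) auto
      also have "\<dots> = ennreal \<epsilon>" using \<open>\<epsilon> > 0\<close> by (intro suminf_ennreal_half_powers) auto
      finally show "\<exists>U. open U \<and> \<Union>(range a) \<subseteq> U \<and> emeasure M (W \<inter> (U - \<Union>(range a))) \<le> ennreal \<epsilon>"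
        using U by (intro exI[of _ "\<Union>(range U)"]) auto
    qed
    have 2: "?R (- \<Union>(range a))"
    proof (intro allI impI)
      fix \<epsilon> :: real assume "\<epsilon> > 0"
      have "\<exists>U. open U \<and> - a i \<subseteq> U \<and> emeasure M (W \<inter> (U - - a i)) \<le> ennreal (\<epsilon>/2 * (1/2) ^ Suc i)" for i
        using Union(2)[of i] \<open>\<epsilon> > 0\<close> by simp
      then obtain V where V: "\<And>i. open (V i)" "\<And>i. - a i \<subseteq> V i"
        "\<And>i. emeasure M (W \<inter> (V i - - a i)) \<le> ennreal (\<epsilon>/2 * (1/2) ^ Suc i)" by metis
      \<comment> \<open>An infinite intersection of open sets need not be open, so finite
        intersections are used and the limit is taken in measure. The errors sum to
        \<open>\<epsilon>/2\<close> because \<open>decr\<close> asks for a strict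
        inequality.\<close>
      let ?F = "\<lambda>n. (\<Inter>i\<in>{..n}. V i) - - \<Union>(range a)"
      have op: "open (\<Inter>i\<in>{..n}. V i)" for n using V(1) by (intro open_INT) auto
      have "\<exists>n. emeasure M (W \<inter> ?F n) \<le> ennreal \<epsilon>"
      proof (rule decr)
        show "?F n \<in> sets borel" for n
          using op a by (intro sets.Diff) (auto intro!: borel_open)
        show "decseq ?F" by (fastforce simp: decseq_def)
        have VM: "W \<inter> (V i - - a i) \<in> sets M" for i
          using V a W by (intro sets.Int[OF W(1)] borel_in_M sets.Diff) auto
        have "emeasure M (W \<inter> (\<Inter>n. ?F n)) \<le> emeasure M (\<Union>i. W \<inter> (V i - - a i))"
        proof (intro emeasure_mono)
          show "W \<inter> (\<Inter>n. ?F n) \<subseteq> (\<Union>i. W \<inter> (V i - - a i))" by blast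
          show "(\<Union>i. W \<inter> (V i - - a i)) \<in> sets M" by (intro sets.countable_UN) (use VM in auto)
        qed
        also have "\<dots> \<le> (\<Sum>i. emeasure M (W \<inter> (V i - - a i)))"
          using VM by (intro emeasure_subadditive_countably) auto
        also have "\<dots> \<le> (\<Sum>i. ennreal (\<epsilon>/2 * (1/2) ^ Suc i))"
          by (intro suminf_le V(3)) auto
        also have "\<dots> = ennreal (\<epsilon>/2)" using \<open>\<epsilon> > 0\<close> by (intro suminf_ennreal_half_powers) auto
        also have "\<dots> < ennreal \<epsilon>" using \<open>\<epsilon> > 0\<close> by (simp add: ennreal_less_iff)
        finally show "emeasure M (W \<inter> (\<Inter>n. ?F n)) < ennreal \<epsilon>" .
      qed
      then obtain n where n: "emeasure M (W \<inter> ?F n) \<le> ennreal \<epsilon>" ..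
      moreover have "- \<Union>(range a) \<subseteq> (\<Inter>i\<in>{..n}. V i)" using V(2) by blast
      ultimately show "\<exists>U. open U \<and> - \<Union>(range a) \<subseteq> U \<and> emeasure M (W \<inter> (U - - \<Union>(range a))) \<le> ennreal \<epsilon>"
        using op[of n] by blast
    qed
    have 3: "\<Union>(range a) \<in> sets borel" using a by auto
    from 1 2 3 show ?case by blast
  qed
  then show ?thesis using \<open>\<epsilon> > 0\<close> by blast
qed

lemma (in metric_doubling) outer_regular:
  assumes A: "A \<in> sets borel" and "\<epsilon> > 0"
  obtains U where "open U" "A \<subseteq> U" "emeasure M (U - A) \<le> ennreal \<epsilon>"
proof -
  let ?B = "\<lambda>n::nat. ball (undefined::'a) (real n)"
  have "\<exists>U. open U \<and> A \<subseteq> U \<and> emeasure M (?B n \<inter> (U - A)) \<le> ennreal (\<epsilon> * (1/2) ^ Suc n)" for n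
    using assms by (intro outer_regular_finite_part) (auto simp: emeasure_ball)
  then obtain U where U: "\<And>n. open (U n)" "\<And>n. A \<subseteq> U n"
    "\<And>n. emeasure M (?B n \<inter> (U n - A)) \<le> ennreal (\<epsilon> * (1/2) ^ Suc n)" by metis
  \<comment> \<open>Each \<open>U n\<close> is controlled only inside \<open>?B n\<close>, so it is
    cut down to that ball before the union is taken.\<close>
  let ?V = "\<Union>n. U n \<inter> ?B n"
  have "emeasure M (?V - A) = emeasure M (\<Union>n. ?B n \<inter> (U n - A))"
    by (intro arg_cong[where f = "emeasure M"]) auto
  also have "\<dots> \<le> (\<Sum>n. emeasure M (?B n \<inter> (U n - A)))"
    using U A by (intro emeasure_subadditive_countably) (auto intro!: borel_in_M)
  also have "\<dots> \<le> (\<Sum>n. ennreal (\<epsilon> * (1/2) ^ Suc n))" by (intro suminf_le U(3)) auto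
  also have "\<dots> = ennreal \<epsilon>" using \<open>\<epsilon> > 0\<close> by (intro suminf_ennreal_half_powers) auto
  finally have 1: "emeasure M (?V - A) \<le> ennreal \<epsilon>" .
  have 2: "open ?V" using U by auto
  have "A \<subseteq> ?V"
  proof
    fix x assume "x \<in> A"
    obtain n where "dist undefined x < real n" using reals_Archimedean2 by blast
    then show "x \<in> ?V" using \<open>x \<in> A\<close> U(2)[of n] by auto
  qed
  with 1 2 show ?thesis by (intro that)
qed

section \<open>Increasing limits of bounded Lipschitz functions\<close>

definition bdd_lip :: "('a::metric_space \<Rightarrow> real) \<Rightarrow> bool" where
  "bdd_lip f \<longleftrightarrow> (\<exists>L. L-lipschitz_on UNIV f) \<and> (\<exists>B. \<forall>x. 0 \<le> f x \<and> f x \<le> B)"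

text \<open>For functions with values in \<open>[0, \<infinity>]\<close> on a metric space this is
  lower semicontinuity; it is encoded by an approximating sequence because the chain construction
  works with that sequence.\<close>

definition lsc_limit :: "(nat \<Rightarrow> 'a::metric_space \<Rightarrow> real) \<Rightarrow> ('a \<Rightarrow> ennreal) \<Rightarrow> bool" where
  "lsc_limit \<phi> h \<longleftrightarrow> (\<forall>n. bdd_lip (\<phi> n)) \<and> (\<forall>x. incseq (\<lambda>n. \<phi> n x)) \<and>
     (\<forall>x. h x = (SUP n. ennreal (\<phi> n x)))"

definition lsc :: "('a::metric_space \<Rightarrow> ennreal) \<Rightarrow> bool" where
  "lsc h \<longleftrightarrow> (\<exists>\<phi>. lsc_limit \<phi> h)"

lemma bdd_lip_const: "0 \<le> a \<Longrightarrow> bdd_lip (\<lambda>x. a)"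
  unfolding bdd_lip_def by (auto intro: lipschitz_intros)

lemma bdd_lip_max:
  assumes "bdd_lip f" "bdd_lip g" shows "bdd_lip (\<lambda>x. max (f x) (g x))"
proof -
  obtain K L where K: "K-lipschitz_on UNIV f" and L: "L-lipschitz_on UNIV g"
    using assms unfolding bdd_lip_def by blast
  have "(max K L)-lipschitz_on UNIV (\<lambda>x. max (f x) (g x))"
  proof (rule lipschitz_onI)
    fix x y :: 'a
    have "\<bar>f x - f y\<bar> \<le> max K L * dist x y" "\<bar>g x - g y\<bar> \<le> max K L * dist x y"
      using lipschitz_onD[OF K, of x y] lipschitz_onD[OF L, of x y]
        mult_right_mono[of K "max K L" "dist x y"] mult_right_mono[of L "max K L" "dist x y"]
      by (auto simp: dist_real_def)
    then show "dist (max (f x) (g x)) (max (f y) (g y)) \<le> max K L * dist x y"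
      unfolding dist_real_def by linarith
  qed (use lipschitz_on_nonneg[OF K] in auto)
  moreover obtain B C where "\<And>x. 0 \<le> f x \<and> f x \<le> B" "\<And>x. 0 \<le> g x \<and> g x \<le> C"
    using assms unfolding bdd_lip_def by metis
  then have "\<forall>x. 0 \<le> max (f x) (g x) \<and> max (f x) (g x) \<le> max B C"
    by (metis max.coboundedI1 max.mono)
  ultimately show ?thesis unfolding bdd_lip_def by blast
qed

lemma bdd_lip_add:
  assumes "bdd_lip f" "bdd_lip g" shows "bdd_lip (\<lambda>x. f x + g x)"
proof -
  obtain K L where "K-lipschitz_on UNIV f" "L-lipschitz_on UNIV g"
    using assms unfolding bdd_lip_def by blast
  then have "(K + L)-lipschitz_on UNIV (\<lambda>x. f x + g x)" by (rule lipschitz_on_add)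
  moreover obtain B C where "\<And>x. 0 \<le> f x \<and> f x \<le> B" "\<And>x. 0 \<le> g x \<and> g x \<le> C"
    using assms unfolding bdd_lip_def by metis
  then have "\<forall>x. 0 \<le> f x + g x \<and> f x + g x \<le> B + C" by (simp add: add_mono)
  ultimately show ?thesis unfolding bdd_lip_def by blast
qed

lemma bdd_lip_cmult:
  assumes "bdd_lip f" "0 \<le> a" shows "bdd_lip (\<lambda>x. a * f x)"
proof -
  obtain K where "K-lipschitz_on UNIV f" using assms unfolding bdd_lip_def by blast
  then have "(\<bar>a\<bar> * K)-lipschitz_on UNIV (\<lambda>x. a * f x)" by (rule lipschitz_on_cmult_real)
  moreover obtain B where "\<And>x. 0 \<le> f x \<and> f x \<le> B"
    using assms unfolding bdd_lip_def by metis
  then have "\<forall>x. 0 \<le> a * f x \<and> a * f x \<le> a * B" using assms by (simp add: mult_left_mono)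
  ultimately show ?thesis unfolding bdd_lip_def by blast
qed

lemma lsc_SUP_bdd_lip:
  fixes \<phi> :: "nat \<Rightarrow> 'a::metric_space \<Rightarrow> real"
  assumes "\<And>n. bdd_lip (\<phi> n)"
  shows "lsc (\<lambda>x. SUP n. ennreal (\<phi> n x))"
proof -
  \<comment> \<open>Running maxima make the sequence increasing without changing its
    supremum.\<close>
  define \<Phi> where "\<Phi> n x = rec_nat (\<phi> 0 x) (\<lambda>k r. max r (\<phi> (Suc k) x)) n" for n x
  have \<Phi>0: "\<Phi> 0 = \<phi> 0" and \<Phi>S: "\<Phi> (Suc n) = (\<lambda>x. max (\<Phi> n x) (\<phi> (Suc n) x))" for n
    by (auto simp: \<Phi>_def)
  have le: "\<phi> n x \<le> \<Phi> n x" for n x by (cases n) (auto simp: \<Phi>0 \<Phi>S)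
  have "bdd_lip (\<Phi> n)" for n
    by (induction n) (auto simp: \<Phi>0 \<Phi>S assms intro: bdd_lip_max)
  moreover have "incseq (\<lambda>n. \<Phi> n x)" for x by (rule incseq_SucI) (simp add: \<Phi>S)
  moreover have "ennreal (\<Phi> n x) \<le> (SUP n. ennreal (\<phi> n x))" for n x
  proof (induction n)
    case (Suc n)
    then show ?case
      by (auto simp: \<Phi>S max_def intro: SUP_upper)
  qed (auto simp: \<Phi>0 intro: SUP_upper)
  then have "(SUP n. ennreal (\<phi> n x)) = (SUP n. ennreal (\<Phi> n x))" for x
    using le by (intro antisym SUP_least) (blast intro: SUP_upper2 ennreal_leI)+
  ultimately show ?thesis unfolding lsc_def lsc_limit_def by blast
qed

lemma lsc_SUP:
  fixes h :: "nat \<Rightarrow> 'a::metric_space \<Rightarrow> ennreal"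
  assumes "\<And>i. lsc (h i)"
  shows "lsc (\<lambda>x. SUP i. h i x)"
proof -
  obtain \<phi> where \<phi>: "\<And>i. lsc_limit (\<phi> i) (h i)" using assms unfolding lsc_def by metis
  \<comment> \<open>The double family is enumerated by \<open>prod_decode\<close>; the running
    maxima inside \<open>lsc_SUP_bdd_lip\<close> restore monotonicity.\<close>
  have "lsc (\<lambda>x. SUP k. ennreal ((\<lambda>(i, n). \<phi> i n) (prod_decode k) x))"
    using \<phi> by (intro lsc_SUP_bdd_lip) (auto simp: lsc_limit_def split: prod.split)
  moreover have "(SUP k. ennreal ((\<lambda>(i, n). \<phi> i n) (prod_decode k) x)) = (SUP i. h i x)" for x
  proof -
    have "(SUP i. h i x) = (SUP i. SUP n. ennreal (\<phi> i n x))"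
      using \<phi> by (simp add: lsc_limit_def)
    also have "\<dots> = (SUP k. ennreal ((\<lambda>(i, n). \<phi> i n) (prod_decode k) x))"
    proof (intro antisym SUP_least)
      fix i n
      show "ennreal (\<phi> i n x) \<le> (SUP k. ennreal ((\<lambda>(i, n). \<phi> i n) (prod_decode k) x))"
        by (rule SUP_upper2[of "prod_encode (i, n)"]) auto
    next
      fix k
      obtain i n where "prod_decode k = (i, n)" by fastforce
      then show "ennreal ((\<lambda>(i, n). \<phi> i n) (prod_decode k) x) \<le> (SUP i. SUP n. ennreal (\<phi> i n x))"
        by (simp, intro SUP_upper2[of i] SUP_upper2[of n]) auto
    qed
    finally show ?thesis ..
  qed
  ultimately show ?thesis by simp
qed

lemma lsc_add:
  assumes "lsc f" "lsc g" shows "lsc (\<lambda>x. f x + g x)"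
proof -
  obtain \<phi> \<psi> where *: "lsc_limit \<phi> f" "lsc_limit \<psi> g" using assms unfolding lsc_def by blast
  have nn: "0 \<le> \<phi> n x" "0 \<le> \<psi> n x" for n x
    using * unfolding lsc_limit_def bdd_lip_def by metis+
  have "lsc_limit (\<lambda>n x. \<phi> n x + \<psi> n x) (\<lambda>x. f x + g x)"
    using * nn unfolding lsc_limit_def
    by (auto intro!: bdd_lip_add incseq_SucI add_mono ennreal_SUP_add[symmetric]
             simp: incseq_SucD ennreal_leI incseq_def)
  then show ?thesis unfolding lsc_def by blast
qed

lemma lsc_cmult:
  assumes "lsc f" "0 \<le> a" shows "lsc (\<lambda>x. ennreal a * f x)"
proof -
  obtain \<phi> where *: "lsc_limit \<phi> f" using assms unfolding lsc_def by blast
  have nn: "0 \<le> \<phi> n x" for n x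
    using * unfolding lsc_limit_def bdd_lip_def by metis
  have "lsc_limit (\<lambda>n x. a * \<phi> n x) (\<lambda>x. ennreal a * f x)"
    using * nn assms unfolding lsc_limit_def
    by (auto intro!: bdd_lip_cmult mult_left_mono
             simp: incseq_def ennreal_mult SUP_mult_left_ennreal)
  then show ?thesis unfolding lsc_def by blast
qed

lemma lsc_indicator_open:
  assumes "open (U::'a::metric_space set)" shows "lsc (indicator U)"
\<comment> \<open>For the whole space the complement is empty and \<open>infdist\<close> to it is 0,
  so the distance approximation below would vanish.\<close>
proof (cases "U = UNIV")
  case True
  have "lsc (\<lambda>x::'a. SUP n::nat. ennreal 1)"
    by (rule lsc_SUP_bdd_lip[of "\<lambda>n x. 1"]) (simp add: bdd_lip_const)
  then show ?thesis using True by (simp add: indicator_def[abs_def])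
next
  case False
  define \<phi> where "\<phi> n x = min 1 (real n * infdist x (- U))" for n :: nat and x
  have "bdd_lip (\<phi> n)" for n
  proof -
    have "(real n)-lipschitz_on UNIV (\<phi> n)"
    proof (rule lipschitz_onI)
      fix x y
      have "\<bar>infdist x (- U) - infdist y (- U)\<bar> \<le> dist x y"
        by (rule infdist_triangle_abs)
      then have "\<bar>real n * infdist x (- U) - real n * infdist y (- U)\<bar> \<le> real n * dist x y"
        by (metis abs_mult abs_of_nat mult_left_mono of_nat_0_le_iff right_diff_distrib)
      then show "dist (\<phi> n x) (\<phi> n y) \<le> real n * dist x y"
        unfolding \<phi>_def dist_real_def by linarith
    qed auto
    moreover have "\<forall>x. 0 \<le> \<phi> n x \<and> \<phi> n x \<le> 1"
      unfolding \<phi>_def by (simp add: infdist_nonneg)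
    ultimately show ?thesis unfolding bdd_lip_def by blast
  qed
  then have "lsc (\<lambda>x. SUP n. ennreal (\<phi> n x))" by (rule lsc_SUP_bdd_lip)
  moreover have "(SUP n. ennreal (\<phi> n x)) = indicator U x" for x
  proof (cases "x \<in> U")
    case True
    then have "infdist x (- U) > 0"
      using False assms infdist_pos_not_in_closed[of "- U" x] by auto
    then obtain n :: nat where "1 < real n * infdist x (- U)"
      using reals_Archimedean3 by blast
    then have "\<phi> n x = 1" unfolding \<phi>_def by simp
    then have "1 \<le> (SUP n. ennreal (\<phi> n x))" by (intro SUP_upper2[of n]) auto
    moreover have "(SUP n. ennreal (\<phi> n x)) \<le> 1"
      by (intro SUP_least) (auto simp: \<phi>_def)
    ultimately show ?thesis using True by simp
  next
    case False
    then show ?thesis by (simp add: \<phi>_def)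
  qed
  ultimately show ?thesis by simp
qed

text \<open>The slack function \<open>e\<close> avoids subtraction in \<^typ>\<open>ennreal\<close>.\<close>

lemma (in metric_doubling) vitali_caratheodory:
  fixes f :: "'a \<Rightarrow> ennreal"
  assumes "f \<in> borel_measurable borel" "\<epsilon> > 0"
  obtains h e where "lsc h" "e \<in> borel_measurable borel" "\<And>x. f x \<le> h x" "\<And>x. h x \<le> f x + e x"
    "(\<integral>\<^sup>+x. e x \<partial>M) \<le> ennreal \<epsilon>"
proof -
  let ?P = "\<lambda>f. \<forall>\<epsilon>>0. \<exists>h e. lsc h \<and> e \<in> borel_measurable borel \<and> (\<forall>x. f x \<le> h x \<and> h x \<le> f x + e x)
      \<and> (\<integral>\<^sup>+x. e x \<partial>M) \<le> ennreal \<epsilon>"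
  have "?P f"
    using assms(1)
  proof (induct rule: borel_measurable_induct)
    case (cong f g)
    then show ?case by simp
  next
    case (set A)
    show ?case
    proof (intro allI impI)
      fix \<epsilon> :: real assume "\<epsilon> > 0"
      obtain U where U: "open U" "A \<subseteq> U" "emeasure M (U - A) \<le> ennreal \<epsilon>"
        using outer_regular[OF set \<open>\<epsilon> > 0\<close>] .
      have "(\<integral>\<^sup>+x. indicator (U - A) x \<partial>M) = emeasure M (U - A)"
        using U set by (intro nn_integral_indicator borel_in_M) auto
      then show "\<exists>h e. lsc h \<and> e \<in> borel_measurable borel \<and> (\<forall>x. indicator A x \<le> h x \<and> h x \<le> indicator A x + e x)
          \<and> (\<integral>\<^sup>+x. e x \<partial>M) \<le> ennreal \<epsilon>"
        using U set by - (rule exI[of _ "indicator U"], rule exI[of _ "indicator (U - A)"], auto simp: lsc_indicator_open intro!: borel_measurable_indicator split: split_indicator)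
    qed
  next
    case (mult u a)
    show ?case
    proof (intro allI impI)
      fix \<epsilon> :: real assume "\<epsilon> > 0"
      obtain b where b: "0 \<le> b" "a = ennreal b" using mult(1) by (cases a) auto
      \<comment> \<open>Dividing by \<open>b + 1\<close> instead of \<open>b\<close> covers
        \<open>b = 0\<close>.\<close>
      have "\<epsilon> / (b + 1) > 0" using \<open>\<epsilon> > 0\<close> b by simp
      then obtain h e where he: "lsc h" "e \<in> borel_measurable borel" "\<forall>x. u x \<le> h x \<and> h x \<le> u x + e x"
        "(\<integral>\<^sup>+x. e x \<partial>M) \<le> ennreal (\<epsilon> / (b + 1))" using mult(4) by blast
      have "(\<integral>\<^sup>+x. ennreal b * e x \<partial>M) = ennreal b * (\<integral>\<^sup>+x. e x \<partial>M)"
        using he by (intro nn_integral_cmult borel_measurable_M) auto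
      also have "\<dots> \<le> ennreal b * ennreal (\<epsilon> / (b + 1))" using he by (intro mult_left_mono) auto
      also have "\<dots> \<le> ennreal \<epsilon>"
        using b \<open>\<epsilon> > 0\<close> by (auto simp: ennreal_mult[symmetric] field_simps intro!: ennreal_leI)
      finally have "(\<integral>\<^sup>+x. ennreal b * e x \<partial>M) \<le> ennreal \<epsilon>" .
      moreover have "a * u x \<le> ennreal b * h x \<and> ennreal b * h x \<le> a * u x + ennreal b * e x" for x
        using spec[OF he(3), of x] b by (auto simp: distrib_left[symmetric] intro: mult_left_mono)
      ultimately show "\<exists>h e. lsc h \<and> e \<in> borel_measurable borel \<and> (\<forall>x. a * u x \<le> h x \<and> h x \<le> a * u x + e x)
          \<and> (\<integral>\<^sup>+x. e x \<partial>M) \<le> ennreal \<epsilon>"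
        using he b by - (rule exI[of _ "\<lambda>x. ennreal b * h x"], rule exI[of _ "\<lambda>x. ennreal b * e x"], auto intro: lsc_cmult)
    qed
  next
    case (add u v)
    show ?case
    proof (intro allI impI)
      fix \<epsilon> :: real assume "\<epsilon> > 0"
      then have "\<epsilon> / 2 > 0" by simp
      then obtain h e where he: "lsc h" "e \<in> borel_measurable borel" "\<forall>x. u x \<le> h x \<and> h x \<le> u x + e x"
        "(\<integral>\<^sup>+x. e x \<partial>M) \<le> ennreal (\<epsilon> / 2)" using add(3) by blast
      obtain k d where kd: "lsc k" "d \<in> borel_measurable borel" "\<forall>x. v x \<le> k x \<and> k x \<le> v x + d x"
        "(\<integral>\<^sup>+x. d x \<partial>M) \<le> ennreal (\<epsilon> / 2)" using add(7) \<open>\<epsilon> / 2 > 0\<close> by blast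
      have "(\<integral>\<^sup>+x. d x + e x \<partial>M) = (\<integral>\<^sup>+x. d x \<partial>M) + (\<integral>\<^sup>+x. e x \<partial>M)"
        using he kd by (intro nn_integral_add borel_measurable_M) auto
      also have "\<dots> \<le> ennreal (\<epsilon> / 2) + ennreal (\<epsilon> / 2)" using he kd by (intro add_mono)
      also have "\<dots> = ennreal \<epsilon>" using \<open>\<epsilon> > 0\<close> by (simp add: ennreal_plus[symmetric] del: ennreal_plus)
      finally have "(\<integral>\<^sup>+x. d x + e x \<partial>M) \<le> ennreal \<epsilon>" .
      moreover have "v x + u x \<le> k x + h x \<and> k x + h x \<le> v x + u x + (d x + e x)" for x
        using spec[OF he(3), of x] spec[OF kd(3), of x] add_mono[of "v x" "k x" "u x" "h x"]
          add_mono[of "k x" "v x + d x" "h x" "u x + e x"] by (simp add: ac_simps)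
      ultimately show "\<exists>h e. lsc h \<and> e \<in> borel_measurable borel \<and> (\<forall>x. v x + u x \<le> h x \<and> h x \<le> v x + u x + e x)
          \<and> (\<integral>\<^sup>+x. e x \<partial>M) \<le> ennreal \<epsilon>"
        using he kd by - (rule exI[of _ "\<lambda>x. k x + h x"], rule exI[of _ "\<lambda>x. d x + e x"], auto intro: lsc_add)
    qed
  next
    case (seq U)
    show ?case
    proof (intro allI impI)
      fix \<epsilon> :: real assume "\<epsilon> > 0"
      \<comment> \<open>The errors are summable and \<open>h i\<close> exceeds the supremum of the
        \<open>U i\<close> by at most \<open>e i\<close>; so the sum of all \<open>e i\<close> is a
        slack for \<open>SUP i. h i\<close>.\<close>
      have "\<exists>h e. lsc h \<and> e \<in> borel_measurable borel \<and> (\<forall>x. U i x \<le> h x \<and> h x \<le> U i x + e x)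
          \<and> (\<integral>\<^sup>+x. e x \<partial>M) \<le> ennreal (\<epsilon> * (1/2) ^ Suc i)" for i
        using seq(3)[of i] \<open>\<epsilon> > 0\<close> by simp
      then obtain h e where he: "\<And>i. lsc (h i)" "\<And>i. e i \<in> borel_measurable borel"
        "\<And>i x. U i x \<le> h i x" "\<And>i x. h i x \<le> U i x + e i x"
        "\<And>i. (\<integral>\<^sup>+x. e i x \<partial>M) \<le> ennreal (\<epsilon> * (1/2) ^ Suc i)" by metis
      have "(\<integral>\<^sup>+x. (\<Sum>i. e i x) \<partial>M) = (\<Sum>i. \<integral>\<^sup>+x. e i x \<partial>M)"
        using he by (intro nn_integral_suminf borel_measurable_M) auto
      also have "\<dots> \<le> (\<Sum>n. ennreal (\<epsilon> * (1/2) ^ Suc n))" by (intro suminf_le he(5)) auto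
      also have "\<dots> = ennreal \<epsilon>" using \<open>\<epsilon> > 0\<close> by (intro suminf_ennreal_half_powers) auto
      finally have "(\<integral>\<^sup>+x. (\<Sum>i. e i x) \<partial>M) \<le> ennreal \<epsilon>" .
      moreover have "(SUP i. U i) x \<le> (SUP i. h i x)" for x
        unfolding SUP_apply by (intro SUP_mono) (use he(3) in blast)
      moreover have "(SUP i. h i x) \<le> (SUP i. U i) x + (\<Sum>i. e i x)" for x
      proof (rule SUP_least)
        fix i
        have "e i x \<le> (\<Sum>i. e i x)" using sum_le_suminf[of "\<lambda>i. e i x" "{i}"] by simp
        then have "U i x + e i x \<le> (SUP i. U i) x + (\<Sum>i. e i x)"
          unfolding SUP_apply by (intro add_mono SUP_upper) auto
        then show "h i x \<le> (SUP i. U i) x + (\<Sum>i. e i x)" using he(4)[of i x] by (rule order_trans[rotated])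
      qed
      ultimately show "\<exists>h e. lsc h \<and> e \<in> borel_measurable borel \<and> (\<forall>x. (SUP i. U i) x \<le> h x \<and> h x \<le> (SUP i. U i) x + e x)
          \<and> (\<integral>\<^sup>+x. e x \<partial>M) \<le> ennreal \<epsilon>"
        using he by - (rule exI[of _ "\<lambda>x. SUP i. h i x"], rule exI[of _ "\<lambda>x. \<Sum>i. e i x"], auto intro: lsc_SUP)
    qed
  qed
  then show ?thesis using that \<open>\<epsilon> > 0\<close> by blast
qed

section \<open>Length and arc-length parametrisation of curves\<close>

text \<open>The polygonal length behind \<open>curve_length\<close>, real-valued and recursive so
  that estimates go by induction on the list.\<close>

fun chain_length :: "(real \<Rightarrow> 'a::metric_space) \<Rightarrow> real list \<Rightarrow> real" where
  "chain_length \<gamma> (x # y # xs) = dist (\<gamma> x) (\<gamma> y) + chain_length \<gamma> (y # xs)"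
| "chain_length \<gamma> _ = 0"

lemma chain_length_nonneg [simp]: "0 \<le> chain_length \<gamma> ts"
  by (induction \<gamma> ts rule: chain_length.induct) auto

lemma chain_length_map: "chain_length \<gamma> (map f ts) = chain_length (\<gamma> \<circ> f) ts"
  by (induction "\<gamma> \<circ> f" ts rule: chain_length.induct) auto

lemma chain_length_cong:
  "(\<And>t. t \<in> set ts \<Longrightarrow> \<gamma> t = \<delta> t) \<Longrightarrow> chain_length \<gamma> ts = chain_length \<delta> ts"
  by (induction \<gamma> ts rule: chain_length.induct) auto

lemma sum_dist_eq_chain_length:
  "(\<Sum>i<length ts - 1. ennreal (dist (\<gamma> (ts ! i)) (\<gamma> (ts ! Suc i)))) = ennreal (chain_length \<gamma> ts)"
proof (induction \<gamma> ts rule: chain_length.induct)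
  case (1 \<gamma> x y xs)
  have "(\<Sum>i<length (x # y # xs) - 1. ennreal (dist (\<gamma> ((x # y # xs) ! i)) (\<gamma> ((x # y # xs) ! Suc i))))
      = (\<Sum>i<Suc (length (y # xs) - 1). ennreal (dist (\<gamma> ((x # y # xs) ! i)) (\<gamma> ((x # y # xs) ! Suc i))))"
    by simp
  also have "\<dots> = ennreal (dist (\<gamma> x) (\<gamma> y)) + ennreal (chain_length \<gamma> (y # xs))"
    unfolding sum.lessThan_Suc_shift using 1 by simp
  finally show ?case by simp
qed auto

lemma curve_length_eq:
  "curve_length \<gamma> a b = (SUP ts\<in>{ts. sorted ts \<and> set ts \<subseteq> {a..b}}. ennreal (chain_length \<gamma> ts))"
  unfolding curve_length_def sum_dist_eq_chain_length ..

lemma chain_length_le_curve_length: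
  "sorted ts \<Longrightarrow> set ts \<subseteq> {a..b} \<Longrightarrow> ennreal (chain_length \<gamma> ts) \<le> curve_length \<gamma> a b"
  unfolding curve_length_eq by (rule SUP_upper) auto

lemma curve_length_leI:
  "(\<And>ts. sorted ts \<Longrightarrow> set ts \<subseteq> {a..b} \<Longrightarrow> ennreal (chain_length \<gamma> ts) \<le> z) \<Longrightarrow> curve_length \<gamma> a b \<le> z"
  unfolding curve_length_eq by (rule SUP_least) auto

lemma dist_le_curve_length: "a \<le> b \<Longrightarrow> ennreal (dist (\<gamma> a) (\<gamma> b)) \<le> curve_length \<gamma> a b"
  using chain_length_le_curve_length[of "[a, b]" a b \<gamma>] by simp

text \<open>Inserting a point can only lengthen a chain, by the triangle inequality; this is the
  upper half of additivity of length.\<close>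

lemma chain_length_append_le:
  "chain_length \<gamma> (xs @ ys) \<le> chain_length \<gamma> (xs @ [b]) + chain_length \<gamma> (b # ys)"
proof (induction xs)
  case Nil
  show ?case by (cases ys) auto
next
  case (Cons x xs)
  show ?case
  proof (cases xs)
    case Nil
    show ?thesis
      using Nil dist_triangle[of "\<gamma> x" _ "\<gamma> b"] by (cases ys) auto
  next
    case (Cons y zs)
    then show ?thesis using Cons.IH by simp
  qed
qed

text \<open>Concatenation contributes an extra connecting link, which is dropped; this is the lower
  half of additivity.\<close>

lemma chain_length_append_ge:
  "chain_length \<gamma> xs + chain_length \<gamma> ys \<le> chain_length \<gamma> (xs @ ys)"
proof (induction \<gamma> xs rule: chain_length.induct)
  case ("2_2" \<gamma> v)
  then show ?case by (cases ys) auto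
qed auto

lemma curve_length_add:
  assumes "a \<le> b" "b \<le> c"
  shows "curve_length \<gamma> a c = curve_length \<gamma> a b + curve_length \<gamma> b c"
proof (rule antisym)
  show "curve_length \<gamma> a c \<le> curve_length \<gamma> a b + curve_length \<gamma> b c"
  proof (rule curve_length_leI)
    fix ts assume ts: "sorted ts" "set ts \<subseteq> {a..c}"
    \<comment> \<open>The partition is cut at \<open>b\<close>, and \<open>b\<close> is added to
      both halves.\<close>
    define xs ys where "xs = takeWhile (\<lambda>t. t \<le> b) ts" and "ys = dropWhile (\<lambda>t. t \<le> b) ts"
    have eq: "ts = xs @ ys" by (simp add: xs_def ys_def)
    have xs: "\<forall>t\<in>set xs. t \<le> b" unfolding xs_def using set_takeWhileD by fast
    have ys: "\<forall>t\<in>set ys. b \<le> t"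
    proof (cases ys)
      case (Cons z zs)
      then have "\<not> z \<le> b" unfolding ys_def using dropWhile_eq_Cons_conv by metis
      moreover have "\<forall>t\<in>set zs. z \<le> t" using ts(1) eq Cons by (auto simp: sorted_append)
      ultimately show ?thesis using Cons by auto
    qed auto
    have so: "sorted xs" "sorted ys" using ts(1) eq sorted_append by blast+
    have 1: "sorted (xs @ [b])" "set (xs @ [b]) \<subseteq> {a..b}"
      using so xs ts assms eq by (auto simp: sorted_append)
    have 2: "sorted (b # ys)" "set (b # ys) \<subseteq> {b..c}"
      using so ys ts assms eq by auto
    have "ennreal (chain_length \<gamma> ts) \<le> ennreal (chain_length \<gamma> (xs @ [b]) + chain_length \<gamma> (b # ys))"
      unfolding eq by (intro ennreal_leI chain_length_append_le)
    also have "\<dots> = ennreal (chain_length \<gamma> (xs @ [b])) + ennreal (chain_length \<gamma> (b # ys))"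
      by simp
    also have "\<dots> \<le> curve_length \<gamma> a b + curve_length \<gamma> b c"
      by (intro add_mono chain_length_le_curve_length 1 2)
    finally show "ennreal (chain_length \<gamma> ts) \<le> curve_length \<gamma> a b + curve_length \<gamma> b c" .
  qed
next
  have ne: "{ts. sorted ts \<and> set ts \<subseteq> {p..q}} \<noteq> {}" for p q :: real
    by (auto intro!: exI[of _ "[]"])
  show "curve_length \<gamma> a b + curve_length \<gamma> b c \<le> curve_length \<gamma> a c"
    unfolding curve_length_eq[of \<gamma> a b] curve_length_eq[of \<gamma> b c]
  proof (subst ennreal_SUP_add_left[OF ne, symmetric], rule SUP_least)
    fix xs assume xs: "xs \<in> {ts. sorted ts \<and> set ts \<subseteq> {a..b}}"
    show "ennreal (chain_length \<gamma> xs) + (SUP ts\<in>{ts. sorted ts \<and> set ts \<subseteq> {b..c}}. ennreal (chain_length \<gamma> ts))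
       \<le> curve_length \<gamma> a c"
    proof (subst ennreal_SUP_add_right[OF ne], rule SUP_least)
      fix ys assume ys: "ys \<in> {ts. sorted ts \<and> set ts \<subseteq> {b..c}}"
      have "sorted (xs @ ys)" "set (xs @ ys) \<subseteq> {a..c}"
        using xs ys assms by (auto simp: sorted_append) (meson atLeastAtMost_iff order_trans subsetD)+
      then have "ennreal (chain_length \<gamma> (xs @ ys)) \<le> curve_length \<gamma> a c"
        by (rule chain_length_le_curve_length)
      moreover have "ennreal (chain_length \<gamma> xs) + ennreal (chain_length \<gamma> ys) \<le> ennreal (chain_length \<gamma> (xs @ ys))"
        using chain_length_append_ge[of \<gamma> xs ys] by (simp add: ennreal_plus[symmetric] ennreal_leI del: ennreal_plus)
      ultimately show "ennreal (chain_length \<gamma> xs) + ennreal (chain_length \<gamma> ys) \<le> curve_length \<gamma> a c"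
        by (rule order_trans[rotated])
    qed
  qed
qed

lemma chain_length_le_lipschitz:
  assumes "\<And>s t. a \<le> s \<Longrightarrow> s \<le> t \<Longrightarrow> t \<le> b \<Longrightarrow> dist (\<gamma> s) (\<gamma> t) \<le> t - s"
  shows "sorted (x # ts) \<Longrightarrow> set (x # ts) \<subseteq> {a..b} \<Longrightarrow> chain_length \<gamma> (x # ts) \<le> b - x"
proof (induction ts arbitrary: x)
  case (Cons y ts)
  then show ?case using assms[of x y] by fastforce
qed auto

lemma curve_length_le_lipschitz:
  assumes "\<And>s t. a \<le> s \<Longrightarrow> s \<le> t \<Longrightarrow> t \<le> b \<Longrightarrow> dist (\<gamma> s) (\<gamma> t) \<le> t - s" "a \<le> b"
  shows "curve_length \<gamma> a b \<le> ennreal (b - a)"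
proof (rule curve_length_leI)
  fix ts assume ts: "sorted ts" "set ts \<subseteq> {a..b}"
  have "chain_length \<gamma> ts \<le> b - a"
  proof (cases ts)
    case (Cons x xs)
    have "chain_length \<gamma> (x # xs) \<le> b - x"
      by (rule chain_length_le_lipschitz[where a = a]) (use assms ts Cons in auto)
    then show ?thesis using Cons ts by auto
  qed (use assms in auto)
  then show "ennreal (chain_length \<gamma> ts) \<le> ennreal (b - a)" by (rule ennreal_leI)
qed

text \<open>The change of parameter \<open>f\<close> is assumed monotone only, so it may jump or be
  constant on intervals; two opposite applications give equality of lengths.\<close>

lemma curve_length_reparam_le:
  assumes "\<And>s t. a \<le> s \<Longrightarrow> s \<le> t \<Longrightarrow> t \<le> b \<Longrightarrow> f s \<le> f t"
    and "\<And>s. a \<le> s \<Longrightarrow> s \<le> b \<Longrightarrow> \<delta> (f s) = \<gamma> s"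
  shows "curve_length \<gamma> a b \<le> curve_length \<delta> (f a) (f b)"
proof (rule curve_length_leI)
  fix ts assume ts: "sorted ts" "set ts \<subseteq> {a..b}"
  have "chain_length \<gamma> ts = chain_length (\<delta> \<circ> f) ts"
    by (rule chain_length_cong) (use assms(2) ts in auto)
  also have "\<dots> = chain_length \<delta> (map f ts)" by (simp add: chain_length_map)
  finally have eq: "chain_length \<gamma> ts = chain_length \<delta> (map f ts)" .
  have "sorted (map f ts)"
    using ts by (auto simp: sorted_map intro!: sorted_wrt_mono_rel[of ts "(\<le>)"] assms(1))
  moreover have "set (map f ts) \<subseteq> {f a..f b}" using ts by (auto intro!: assms(1))
  ultimately show "ennreal (chain_length \<gamma> ts) \<le> curve_length \<delta> (f a) (f b)"
    unfolding eq by (rule chain_length_le_curve_length)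
qed

text \<open>The arc length \<open>al\<close> is increasing and 1-Lipschitz, so by the intermediate
  value theorem it has a right inverse \<open>\<tau>\<close>. The choice of \<open>\<tau>\<close> is
  immaterial, and \<open>\<tau>\<close> may jump: wherever \<open>al\<close> is constant, so is the
  curve.\<close>

lemma arc_length_reparametrisation:
  fixes \<gamma> :: "real \<Rightarrow> 'a::metric_space"
  assumes L: "0 \<le> L"
    and lip: "\<And>s t. 0 \<le> s \<Longrightarrow> s \<le> t \<Longrightarrow> t \<le> L \<Longrightarrow> dist (\<gamma> s) (\<gamma> t) \<le> t - s"
  obtains al \<tau> :: "real \<Rightarrow> real" where "al 0 = 0"
    "\<And>s t. 0 \<le> s \<Longrightarrow> s \<le> t \<Longrightarrow> t \<le> L \<Longrightarrow> curve_length \<gamma> s t = ennreal (al t - al s)"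
    "\<And>s t. 0 \<le> s \<Longrightarrow> s \<le> t \<Longrightarrow> t \<le> L \<Longrightarrow> al s \<le> al t"
    "\<And>s t. 0 \<le> s \<Longrightarrow> s \<le> t \<Longrightarrow> t \<le> L \<Longrightarrow> al t - al s \<le> t - s"
    "\<And>t. 0 \<le> t \<Longrightarrow> t \<le> L \<Longrightarrow> \<gamma> (\<tau> (al t)) = \<gamma> t"
    "\<And>r. 0 \<le> r \<Longrightarrow> r \<le> al L \<Longrightarrow> 0 \<le> \<tau> r \<and> \<tau> r \<le> L \<and> al (\<tau> r) = r"
    "0 < al L \<Longrightarrow> (al L, \<gamma> \<circ> \<tau>) \<in> rectifiable_curves"
proof -
  define al where "al t = enn2real (curve_length \<gamma> 0 t)" for t
  have le: "curve_length \<gamma> s t \<le> ennreal (t - s)" if "0 \<le> s" "s \<le> t" "t \<le> L" for s t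
    by (rule curve_length_le_lipschitz) (use lip that in auto)
  have fin: "curve_length \<gamma> 0 t = ennreal (al t)" if "0 \<le> t" "t \<le> L" for t
    using le[of 0 t] that unfolding al_def
    by (metis ennreal_enn2real ennreal_less_top le_less_trans order_refl)
  have nn: "0 \<le> al t" for t by (simp add: al_def)
  have add: "ennreal (al t) = ennreal (al s) + curve_length \<gamma> s t" if "0 \<le> s" "s \<le> t" "t \<le> L" for s t
    using curve_length_add[of 0 s t \<gamma>] fin[of s] fin[of t] that by simp
  have mono: "al s \<le> al t" if "0 \<le> s" "s \<le> t" "t \<le> L" for s t
    using add[OF that] nn by (metis ennreal_le_iff le_iff_add)
  have len: "curve_length \<gamma> s t = ennreal (al t - al s)" if "0 \<le> s" "s \<le> t" "t \<le> L" for s t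
  proof -
    have "ennreal (al s) + curve_length \<gamma> s t = ennreal (al s) + ennreal (al t - al s)"
      using add[OF that] mono[OF that] nn[of s] by (simp add: ennreal_plus[symmetric] del: ennreal_plus)
    then show ?thesis by (simp add: ennreal_add_left_cancel)
  qed
  have lip': "al t - al s \<le> t - s" if "0 \<le> s" "s \<le> t" "t \<le> L" for s t
    using le[OF that] len[OF that] that by (simp add: ennreal_le_iff)
  have d: "dist (\<gamma> s) (\<gamma> t) \<le> al t - al s" if "0 \<le> s" "s \<le> t" "t \<le> L" for s t
    using dist_le_curve_length[of s t \<gamma>] len[OF that] mono[OF that] that by (simp add: ennreal_le_iff)
  have "curve_length \<gamma> 0 0 = 0" using le[of 0 0] L by simp
  then have l0: "al 0 = 0" by (simp add: al_def)
  have cont: "continuous_on {0..L} al"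
  proof (rule lipschitz_on_continuous_on)
    show "1-lipschitz_on {0..L} al"
    proof (rule lipschitz_onI)
      fix s t assume st: "s \<in> {0..L}" "t \<in> {0..L}"
      show "dist (al s) (al t) \<le> 1 * dist s t"
        using lip'[of s t] lip'[of t s] mono[of s t] mono[of t s] st
        by (cases "s \<le> t") (auto simp: dist_real_def)
    qed auto
  qed
  have "\<exists>t. 0 \<le> t \<and> t \<le> L \<and> al t = r" if "0 \<le> r" "r \<le> al L" for r
    using IVT'[of al 0 r L] that l0 L cont by auto
  then obtain \<tau> where \<tau>: "\<And>r. 0 \<le> r \<Longrightarrow> r \<le> al L \<Longrightarrow> 0 \<le> \<tau> r \<and> \<tau> r \<le> L \<and> al (\<tau> r) = r"
    by metis
  have \<gamma>\<tau>: "\<gamma> (\<tau> (al t)) = \<gamma> t" if "0 \<le> t" "t \<le> L" for t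
  proof -
    have *: "0 \<le> \<tau> (al t) \<and> \<tau> (al t) \<le> L \<and> al (\<tau> (al t)) = al t"
      using \<tau>[of "al t"] nn[of t] mono[of t L] that by auto
    show ?thesis
    proof (cases "\<tau> (al t) \<le> t")
      case True then show ?thesis using d[of "\<tau> (al t)" t] * that by simp
    next
      case False then show ?thesis using d[of t "\<tau> (al t)"] * that by simp
    qed
  qed
  have \<tau>mono: "\<tau> r \<le> \<tau> r'" if "0 \<le> r" "r \<le> r'" "r' \<le> al L" for r r'
  proof (rule ccontr)
    assume "\<not> \<tau> r \<le> \<tau> r'"
    then have "al (\<tau> r') \<le> al (\<tau> r)" using \<tau>[of r] \<tau>[of r'] that by (intro mono) auto
    then have "r = r'" using \<tau>[of r] \<tau>[of r'] that by auto
    with \<open>\<not> \<tau> r \<le> \<tau> r'\<close> show False by simp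
  qed
  \<comment> \<open>Lengths are compared along \<open>\<tau>\<close> in one direction and along
    \<open>al\<close> in the other, both being monotone.\<close>
  have "curve_length (\<gamma> \<circ> \<tau>) s t = ennreal (t - s)" if "0 \<le> s" "s \<le> t" "t \<le> al L" for s t
  proof (rule antisym)
    have \<tau>st: "0 \<le> \<tau> s" "\<tau> s \<le> \<tau> t" "\<tau> t \<le> L" "al (\<tau> s) = s" "al (\<tau> t) = t"
      using \<tau>[of s] \<tau>[of t] \<tau>mono[of s t] that by auto
    have "curve_length (\<gamma> \<circ> \<tau>) s t \<le> curve_length \<gamma> (\<tau> s) (\<tau> t)"
      by (rule curve_length_reparam_le) (use \<tau>mono that in auto)
    then show "curve_length (\<gamma> \<circ> \<tau>) s t \<le> ennreal (t - s)"
      using len[OF \<tau>st(1-3)] \<tau>st by simp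
    have "curve_length \<gamma> (\<tau> s) (\<tau> t) \<le> curve_length (\<gamma> \<circ> \<tau>) (al (\<tau> s)) (al (\<tau> t))"
      by (rule curve_length_reparam_le) (use mono \<gamma>\<tau> \<tau>st in auto)
    then show "ennreal (t - s) \<le> curve_length (\<gamma> \<circ> \<tau>) s t"
      using len[OF \<tau>st(1-3)] \<tau>st by simp
  qed
  then have "0 < al L \<Longrightarrow> (al L, \<gamma> \<circ> \<tau>) \<in> rectifiable_curves"
    unfolding rectifiable_curves_def by auto
  with l0 len mono lip' \<gamma>\<tau> \<tau> show ?thesis by (intro that[of al \<tau>]) auto
qed

lemma rectifiable_curve_lipschitz:
  assumes "(l, \<gamma>) \<in> rectifiable_curves" "0 \<le> s" "s \<le> t" "t \<le> l"
  shows "dist (\<gamma> s) (\<gamma> t) \<le> t - s"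
  using dist_le_curve_length[of s t \<gamma>] assms unfolding rectifiable_curves_def
  by (auto simp: ennreal_le_iff)

lemma rectifiable_curve_continuous:
  assumes "(l, \<gamma>) \<in> rectifiable_curves" shows "continuous_on {0..l} \<gamma>"
proof (rule lipschitz_on_continuous_on)
  show "1-lipschitz_on {0..l} \<gamma>"
  proof (rule lipschitz_onI)
    fix s t assume "s \<in> {0..l}" "t \<in> {0..l}"
    then show "dist (\<gamma> s) (\<gamma> t) \<le> 1 * dist s t"
      using rectifiable_curve_lipschitz[OF assms, of s t] rectifiable_curve_lipschitz[OF assms, of t s]
      by (cases "s \<le> t") (auto simp: dist_real_def dist_commute)
  qed auto
qed

lemma rectifiable_subcurve:
  assumes "(l, \<gamma>) \<in> rectifiable_curves" "0 \<le> s" "s < t" "t \<le> l"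
  shows "(t - s, \<lambda>x. \<gamma> (x + s)) \<in> rectifiable_curves"
proof -
  have "curve_length (\<lambda>x. \<gamma> (x + s)) a b = ennreal (b - a)" if "0 \<le> a" "a \<le> b" "b \<le> t - s" for a b
  proof -
    have "curve_length (\<lambda>x. \<gamma> (x + s)) a b \<le> curve_length \<gamma> (a + s) (b + s)"
      by (rule curve_length_reparam_le[where f = "\<lambda>x. x + s"]) auto
    moreover have "curve_length \<gamma> (a + s) (b + s)
        \<le> curve_length (\<lambda>x. \<gamma> (x + s)) ((a + s) - s) ((b + s) - s)"
      by (rule curve_length_reparam_le[where f = "\<lambda>x. x - s"]) auto
    moreover have "curve_length \<gamma> (a + s) (b + s) = ennreal ((b + s) - (a + s))"
      using assms that unfolding rectifiable_curves_def by auto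
    ultimately show ?thesis by simp
  qed
  then show ?thesis using assms unfolding rectifiable_curves_def by auto
qed

text \<open>Only the restriction of the curve to its parameter interval is known to be continuous.\<close>

lemma curve_integrand_measurable:
  assumes "(l, \<gamma>) \<in> rectifiable_curves" "g \<in> borel_measurable borel" "0 \<le> s" "t \<le> l"
  shows "(\<lambda>x. g (\<gamma> x) * indicator {s..t} x :: ennreal) \<in> borel_measurable borel"
proof -
  have l: "0 < l" using assms(1) unfolding rectifiable_curves_def by simp
  \<comment> \<open>Clamping the parameter to the interval extends the curve continuously to the
    whole line.\<close>
  let ?\<delta> = "\<lambda>x. \<gamma> (max 0 (min l x))"
  have "continuous_on UNIV ?\<delta>"
    by (rule continuous_on_compose2[OF rectifiable_curve_continuous[OF assms(1)]])
       (use l in \<open>auto intro!: continuous_intros\<close>)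
  then have "?\<delta> \<in> borel_measurable borel" by (rule borel_measurable_continuous_onI)
  then have "(\<lambda>x. g (?\<delta> x)) \<in> borel_measurable borel"
    using assms(2) by (rule measurable_compose)
  then have "(\<lambda>x. g (?\<delta> x) * indicator {s..t} x) \<in> borel_measurable borel" by measurable
  moreover have "g (?\<delta> x) * indicator {s..t} x = g (\<gamma> x) * indicator {s..t} x" for x
  proof (cases "x \<in> {s..t}")
    case True
    then have "max 0 (min l x) = x" using assms by auto
    then show ?thesis by simp
  qed simp
  ultimately show ?thesis by simp
qed

lemma curve_integral_subcurve:
  assumes "(l, \<gamma>) \<in> rectifiable_curves" "g \<in> borel_measurable borel" "0 \<le> s" "s < t" "t \<le> l"
  shows "curve_integral g (t - s, \<lambda>x. \<gamma> (x + s)) = (\<integral>\<^sup>+x\<in>{s..t}. g (\<gamma> x) \<partial>lborel)"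
proof -
  have "(\<integral>\<^sup>+x\<in>{s..t}. g (\<gamma> x) \<partial>lborel)
      = ennreal \<bar>1\<bar> * (\<integral>\<^sup>+x. g (\<gamma> (s + 1 * x)) * indicator {s..t} (s + 1 * x) \<partial>lborel)"
    by (rule nn_integral_real_affine) (use curve_integrand_measurable assms in auto)
  also have "\<dots> = (\<integral>\<^sup>+x. g (\<gamma> (x + s)) * indicator {0..t - s} x \<partial>lborel)"
    by (auto intro!: nn_integral_cong simp: add.commute indicator_def)
  finally show ?thesis by (simp add: curve_integral_def)
qed

section \<open>Weak upper gradients\<close>

text \<open>Sums over a net are written as integrals over \<open>count_space D\<close>: a countable
  index set is then used without enumeration, and sums and integrals are exchanged by Tonelli's
  theorem.\<close>

lemma borel_measurable_nn_integral_count_space: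
  fixes f :: "'i \<Rightarrow> 'b \<Rightarrow> ennreal"
  assumes "countable D" "\<And>j. j \<in> D \<Longrightarrow> f j \<in> borel_measurable N"
  shows "(\<lambda>x. \<integral>\<^sup>+j. f j x \<partial>count_space D) \<in> borel_measurable N"
proof (rule sigma_finite_measure.borel_measurable_nn_integral)
  show "sigma_finite_measure (count_space D)"
    using assms(1) by (rule sigma_finite_measure_count_space_countable)
  have "(\<lambda>(j, x). f j x) \<in> borel_measurable (count_space D \<Otimes>\<^sub>M N)"
    by (rule measurable_pair_measure_countable1) (use assms in auto)
  from measurable_pair_swap[OF this]
  show "(\<lambda>(x, j). f j x) \<in> borel_measurable (N \<Otimes>\<^sub>M count_space D)"
    by (simp add: case_prod_beta')
qed

section \<open>Increments of a function controlled by integrals over intervals\<close>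

lemma nn_integral_Icc_add_le:
  fixes G :: "real \<Rightarrow> ennreal"
  assumes G: "(\<lambda>x. G x * indicator {s..u} x) \<in> borel_measurable borel" and "s \<le> t" "t \<le> u"
  shows "(\<integral>\<^sup>+x\<in>{s..t}. G x \<partial>lborel) + (\<integral>\<^sup>+x\<in>{t..u}. G x \<partial>lborel) \<le> (\<integral>\<^sup>+x\<in>{s..u}. G x \<partial>lborel)"
proof -
  have m: "(\<lambda>x. G x * indicator {a..b} x) \<in> borel_measurable borel" if "s \<le> a" "b \<le> u" for a b
  proof -
    have "(\<lambda>x. G x * indicator {s..u} x * indicator {a..b} x) \<in> borel_measurable borel"
      using G by measurable
    moreover have "G x * indicator {s..u} x * indicator {a..b} x = G x * indicator {a..b} x" for x
      using that by (auto simp: indicator_def)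
    ultimately show ?thesis by simp
  qed
  have "(\<integral>\<^sup>+x\<in>{s..t}. G x \<partial>lborel) + (\<integral>\<^sup>+x\<in>{t..u}. G x \<partial>lborel)
      = (\<integral>\<^sup>+x. G x * indicator {s..t} x + G x * indicator {t..u} x \<partial>lborel)"
    by (rule nn_integral_add[symmetric]) (use m assms in auto)
  also have "\<dots> \<le> (\<integral>\<^sup>+x\<in>{s..u}. G x \<partial>lborel)"
  proof (rule nn_integral_mono_AE)
    have "AE x in lborel. x \<noteq> t" by (rule AE_lborel_singleton)
    then show "AE x in lborel. G x * indicator {s..t} x + G x * indicator {t..u} x \<le> G x * indicator {s..u} x"
      by eventually_elim (use assms in \<open>auto simp: indicator_def\<close>)
  qed
  finally show ?thesis .
qed

text \<open>Increments are subadditive and integrals additive under concatenation of intervals, so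
  \<open>Bolzano\<close> reduces the claim to short intervals around each point.\<close>

lemma increment_le_integral_if_locally:
  fixes G :: "real \<Rightarrow> ennreal" and f :: "real \<Rightarrow> real"
  assumes "0 \<le> l" and G: "(\<lambda>x. G x * indicator {0..l} x) \<in> borel_measurable borel"
    and loc: "\<And>x. 0 \<le> x \<Longrightarrow> x \<le> l \<Longrightarrow> \<exists>d>0. \<forall>s t. 0 \<le> s \<and> s \<le> x \<and> x \<le> t \<and> t \<le> l \<and> s < t \<and> t - s < d \<longrightarrow>
       ennreal \<bar>f s - f t\<bar> \<le> (\<integral>\<^sup>+x\<in>{s..t}. G x \<partial>lborel)"
  shows "ennreal \<bar>f 0 - f l\<bar> \<le> (\<integral>\<^sup>+x\<in>{0..l}. G x \<partial>lborel)"
proof -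
  let ?P = "\<lambda>s t. 0 \<le> s \<and> t \<le> l \<longrightarrow> ennreal \<bar>f s - f t\<bar> \<le> (\<integral>\<^sup>+x\<in>{s..t}. G x \<partial>lborel)"
  have "?P 0 l"
    using \<open>0 \<le> l\<close>
  proof (rule Bolzano[where P = "?P"])
    fix a b c assume trans: "?P a b" "?P b c" "a \<le> b" "b \<le> c"
    show "?P a c"
    proof
      assume ac: "0 \<le> a \<and> c \<le> l"
      have "(\<lambda>x. G x * indicator {0..l} x * indicator {a..c} x) \<in> borel_measurable borel"
        using G by measurable
      moreover have "G x * indicator {0..l} x * indicator {a..c} x = G x * indicator {a..c} x" for x
        using ac by (auto simp: indicator_def)
      ultimately have m: "(\<lambda>x. G x * indicator {a..c} x) \<in> borel_measurable borel" by simp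
      have "ennreal \<bar>f a - f c\<bar> \<le> ennreal (\<bar>f a - f b\<bar> + \<bar>f b - f c\<bar>)"
        by (intro ennreal_leI) linarith
      also have "\<dots> = ennreal \<bar>f a - f b\<bar> + ennreal \<bar>f b - f c\<bar>" by simp
      also have "\<dots> \<le> (\<integral>\<^sup>+x\<in>{a..b}. G x \<partial>lborel) + (\<integral>\<^sup>+x\<in>{b..c}. G x \<partial>lborel)"
        using trans ac by (intro add_mono) auto
      also have "\<dots> \<le> (\<integral>\<^sup>+x\<in>{a..c}. G x \<partial>lborel)"
        using trans m by (intro nn_integral_Icc_add_le) auto
      finally show "ennreal \<bar>f a - f c\<bar> \<le> (\<integral>\<^sup>+x\<in>{a..c}. G x \<partial>lborel)" .
    qed
  next
    fix x assume "0 \<le> x" "x \<le> l"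
    from loc[OF this] obtain d where "d > 0" and d: "\<And>s t. 0 \<le> s \<and> s \<le> x \<and> x \<le> t \<and> t \<le> l \<and> s < t \<and> t - s < d \<Longrightarrow>
       ennreal \<bar>f s - f t\<bar> \<le> (\<integral>\<^sup>+x\<in>{s..t}. G x \<partial>lborel)" by blast
    show "\<exists>d>0. \<forall>a b. a \<le> x \<and> x \<le> b \<and> b - a < d \<longrightarrow> ?P a b"
    proof (intro exI[of _ d] conjI allI impI \<open>d > 0\<close>)
      fix a b assume "a \<le> x \<and> x \<le> b \<and> b - a < d" "0 \<le> a \<and> b \<le> l"
      then show "ennreal \<bar>f a - f b\<bar> \<le> (\<integral>\<^sup>+x\<in>{a..b}. G x \<partial>lborel)"
        using d[of a b] by (cases "a = b") auto
    qed
  qed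
  then show ?thesis by simp
qed

text \<open>If both \<open>G\<close> and \<open>H\<close> control the increments of \<open>f\<close>, approximate \<open>{G \<le> H}\<close> and its complement
  by disjoint compact sets from inside: a short interval meets at most one of them.\<close>

lemma increment_le_integral_min:
  fixes G H :: "real \<Rightarrow> ennreal" and f :: "real \<Rightarrow> real"
  assumes "0 \<le> l"
    and G: "(\<lambda>x. G x * indicator {0..l} x) \<in> borel_measurable borel"
    and H: "(\<lambda>x. H x * indicator {0..l} x) \<in> borel_measurable borel"
    and fG: "(\<integral>\<^sup>+x\<in>{0..l}. G x \<partial>lborel) < \<infinity>"
    and fH: "(\<integral>\<^sup>+x\<in>{0..l}. H x \<partial>lborel) < \<infinity>"
    and iG: "\<And>s t. 0 \<le> s \<Longrightarrow> s < t \<Longrightarrow> t \<le> l \<Longrightarrow> ennreal \<bar>f s - f t\<bar> \<le> (\<integral>\<^sup>+x\<in>{s..t}. G x \<partial>lborel)"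
    and iH: "\<And>s t. 0 \<le> s \<Longrightarrow> s < t \<Longrightarrow> t \<le> l \<Longrightarrow> ennreal \<bar>f s - f t\<bar> \<le> (\<integral>\<^sup>+x\<in>{s..t}. H x \<partial>lborel)"
  shows "ennreal \<bar>f 0 - f l\<bar> \<le> (\<integral>\<^sup>+x\<in>{0..l}. min (G x) (H x) \<partial>lborel)"
proof -
  define G' where "G' x = G x * indicator {0..l} x" for x
  define H' where "H' x = H x * indicator {0..l} x" for x
  have [measurable]: "G' \<in> borel_measurable borel" "H' \<in> borel_measurable borel"
    using G H unfolding G'_def[abs_def] H'_def[abs_def] .
  \<comment> \<open>Finiteness of both integrals makes \<open>N\<close> a finite Borel measure on
    the line, hence inner regular by compact sets.\<close>
  define N where "N = density lborel (\<lambda>x. G' x + H' x)"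
  have sN: "sets N = sets borel" by (simp add: N_def)
  have eN: "emeasure N B = (\<integral>\<^sup>+x. (G' x + H' x) * indicator B x \<partial>lborel)" if "B \<in> sets borel" for B
    unfolding N_def by (rule emeasure_density) (use that in auto)
  have "emeasure N (space N) = (\<integral>\<^sup>+x. G' x + H' x \<partial>lborel)"
    by (simp add: N_def emeasure_density)
  also have "\<dots> = (\<integral>\<^sup>+x. G' x \<partial>lborel) + (\<integral>\<^sup>+x. H' x \<partial>lborel)" by (rule nn_integral_add) auto
  also have "\<dots> < \<infinity>" using fG fH by (simp add: G'_def H'_def)
  finally have fin: "emeasure N (space N) \<noteq> \<infinity>" by simp
  interpret N: finite_measure N by (rule finite_measureI) (use fin in simp)
  define A where "A = {x. G' x \<le> H' x}"
  have A [measurable]: "A \<in> sets borel" unfolding A_def by measurable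
  have inner: "\<exists>K. compact K \<and> K \<subseteq> B \<and> emeasure N (B - K) \<le> ennreal \<epsilon>"
    if B: "B \<in> sets borel" and "\<epsilon> > 0" for B \<epsilon>
  proof -
    have e: "emeasure N B = (SUP K\<in>{K. K \<subseteq> B \<and> compact K}. emeasure N K)"
      by (rule inner_regular[OF sN fin B])
    show ?thesis
    proof (cases "emeasure N B = 0")
      case True
      then show ?thesis by (intro exI[of _ "{}"]) auto
    next
      case False
      have "emeasure N B - ennreal \<epsilon> < emeasure N B"
        using False \<open>\<epsilon> > 0\<close> by (intro ennreal_between) (auto simp: zero_less_iff_neq_zero less_top[symmetric] N.emeasure_finite)
      then obtain K where K: "K \<subseteq> B" "compact K" "emeasure N B - ennreal \<epsilon> < emeasure N K"
        unfolding e less_SUP_iff by blast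
      have KN: "K \<in> sets N" using K sN borel_compact by blast
      have "emeasure N (B - K) = emeasure N B - emeasure N K"
        using K B sN KN by (intro emeasure_Diff) auto
      also have "\<dots> \<le> ennreal \<epsilon>"
      proof -
        have "measure N B - \<epsilon> < measure N K"
        proof (rule ccontr)
          assume "\<not> measure N B - \<epsilon> < measure N K"
          then have "ennreal (measure N K) \<le> ennreal (measure N B - \<epsilon>)" by (intro ennreal_leI) simp
          then show False using K(3) \<open>\<epsilon> > 0\<close>
            by (simp add: N.emeasure_eq_measure ennreal_minus)
        qed
        then have "ennreal (measure N B - measure N K) \<le> ennreal \<epsilon>" by (intro ennreal_leI) simp
        then show ?thesis by (simp add: N.emeasure_eq_measure ennreal_minus)
      qed
      finally show ?thesis using K by blast
    qed
  qed
  show ?thesis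
  proof (rule ennreal_le_epsilon)
    fix \<epsilon> :: real assume "\<epsilon> > 0"
    then have e2: "\<epsilon> / 2 > 0" by simp
    obtain K where K: "compact K" "K \<subseteq> A" "emeasure N (A - K) \<le> ennreal (\<epsilon> / 2)"
      using inner[OF A e2] by blast
    obtain C where C: "compact C" "C \<subseteq> - A" "emeasure N (- A - C) \<le> ennreal (\<epsilon> / 2)"
      using inner[of "- A", OF _ e2] A by (auto simp: Compl_in_sets_lebesgue)
    have [measurable]: "K \<in> sets borel" "C \<in> sets borel"
      using K C borel_compact by blast+
    define E where "E = (A - K) \<union> (- A - C)"
    have [measurable]: "E \<in> sets borel" unfolding E_def by measurable
    have NE: "emeasure N E \<le> ennreal \<epsilon>"
    proof -
      have "emeasure N E \<le> emeasure N (A - K) + emeasure N (- A - C)"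
        unfolding E_def by (rule emeasure_subadditive) (auto simp: sN)
      also have "\<dots> \<le> ennreal (\<epsilon> / 2) + ennreal (\<epsilon> / 2)" using K C by (intro add_mono)
      also have "\<dots> = ennreal \<epsilon>" using \<open>\<epsilon> > 0\<close> by (simp add: ennreal_plus[symmetric] del: ennreal_plus)
      finally show ?thesis .
    qed
    \<comment> \<open>\<open>\<Phi>\<close> is the smaller of the two functions on \<open>K\<close>
      and on \<open>C\<close>, and pays with \<open>G' + H'\<close> on the remaining set
      \<open>E\<close> of small \<open>N\<close>-measure. Off \<open>C\<close> it dominates
      \<open>G\<close>, off \<open>K\<close> it dominates \<open>H\<close>.\<close>
    define \<Phi> where "\<Phi> x = G' x * indicator K x + H' x * indicator C x + (G' x + H' x) * indicator E x" for x
    have [measurable]: "\<Phi> \<in> borel_measurable borel" unfolding \<Phi>_def[abs_def] by measurable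
    have \<Phi>G: "G x \<le> \<Phi> x" if "x \<in> {0..l}" "x \<notin> C" for x
    proof -
      have "x \<in> K \<or> x \<in> E" using that K C unfolding E_def by auto
      then show ?thesis using that
        by (auto simp: \<Phi>_def G'_def H'_def add.assoc intro: add_increasing2 add_increasing)
    qed
    have \<Phi>H: "H x \<le> \<Phi> x" if "x \<in> {0..l}" "x \<notin> K" for x
    proof -
      have "x \<in> C \<or> x \<in> E" using that K C unfolding E_def by auto
      then show ?thesis using that
        by (auto simp: \<Phi>_def G'_def H'_def add.assoc intro: add_increasing2 add_increasing)
    qed
    have "ennreal \<bar>f 0 - f l\<bar> \<le> (\<integral>\<^sup>+x\<in>{0..l}. \<Phi> x \<partial>lborel)"
    proof (rule increment_le_integral_if_locally[OF \<open>0 \<le> l\<close>])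
      fix x assume x: "0 \<le> x" "x \<le> l"
      show "\<exists>d>0. \<forall>s t. 0 \<le> s \<and> s \<le> x \<and> x \<le> t \<and> t \<le> l \<and> s < t \<and> t - s < d \<longrightarrow>
         ennreal \<bar>f s - f t\<bar> \<le> (\<integral>\<^sup>+x\<in>{s..t}. \<Phi> x \<partial>lborel)"
      proof (cases "x \<in> C")
        case False
        have "open (- C)" using C compact_imp_closed by blast
        then obtain d where d: "d > 0" "ball x d \<subseteq> - C" using False open_contains_ball by blast
        show ?thesis
        proof (intro exI[of _ d] conjI allI impI d(1))
          fix s t assume st: "0 \<le> s \<and> s \<le> x \<and> x \<le> t \<and> t \<le> l \<and> s < t \<and> t - s < d"
          have "{s..t} \<subseteq> ball x d" using st by (auto simp: dist_real_def)
          then have "(\<integral>\<^sup>+x\<in>{s..t}. G x \<partial>lborel) \<le> (\<integral>\<^sup>+x\<in>{s..t}. \<Phi> x \<partial>lborel)"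
            using d st by (intro nn_integral_mono) (auto simp: indicator_def intro!: \<Phi>G)
          then show "ennreal \<bar>f s - f t\<bar> \<le> (\<integral>\<^sup>+x\<in>{s..t}. \<Phi> x \<partial>lborel)"
            using iG[of s t] st by (auto intro: order_trans)
        qed
      next
        case True
        then have "x \<in> - K" using K C by auto
        moreover have "open (- K)" using K compact_imp_closed by blast
        ultimately obtain d where d: "d > 0" "ball x d \<subseteq> - K" using open_contains_ball by blast
        show ?thesis
        proof (intro exI[of _ d] conjI allI impI d(1))
          fix s t assume st: "0 \<le> s \<and> s \<le> x \<and> x \<le> t \<and> t \<le> l \<and> s < t \<and> t - s < d"
          have "{s..t} \<subseteq> ball x d" using st by (auto simp: dist_real_def)
          then have "(\<integral>\<^sup>+x\<in>{s..t}. H x \<partial>lborel) \<le> (\<integral>\<^sup>+x\<in>{s..t}. \<Phi> x \<partial>lborel)"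
            using d st by (intro nn_integral_mono) (auto simp: indicator_def intro!: \<Phi>H)
          then show "ennreal \<bar>f s - f t\<bar> \<le> (\<integral>\<^sup>+x\<in>{s..t}. \<Phi> x \<partial>lborel)"
            using iH[of s t] st by (auto intro: order_trans)
        qed
      qed
    qed measurable
    also have "\<dots> \<le> (\<integral>\<^sup>+x. min (G x) (H x) * indicator {0..l} x + (G' x + H' x) * indicator E x \<partial>lborel)"
    proof (rule nn_integral_mono)
      fix x
      have "G' x * indicator K x + H' x * indicator C x \<le> min (G' x) (H' x)"
        using K C by (auto simp: indicator_def A_def)
      also have "min (G' x) (H' x) = min (G x) (H x) * indicator {0..l} x"
        by (auto simp: G'_def H'_def indicator_def)
      finally have *: "\<Phi> x \<le> min (G x) (H x) * indicator {0..l} x + (G' x + H' x) * indicator E x"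
        unfolding \<Phi>_def by (intro add_mono) auto
      have "\<Phi> x * indicator {0..l} x \<le> \<Phi> x" by (auto simp: indicator_def)
      then show "\<Phi> x * indicator {0..l} x \<le> min (G x) (H x) * indicator {0..l} x + (G' x + H' x) * indicator E x"
        using * by (rule order_trans)
    qed
    also have "\<dots> = (\<integral>\<^sup>+x\<in>{0..l}. min (G x) (H x) \<partial>lborel) + emeasure N E"
    proof -
      have "(\<lambda>x. min (G' x) (H' x)) \<in> borel_measurable borel" by measurable
      moreover have "min (G' x) (H' x) = min (G x) (H x) * indicator {0..l} x" for x
        by (auto simp: G'_def H'_def indicator_def)
      ultimately have "(\<lambda>x. min (G x) (H x) * indicator {0..l} x) \<in> borel_measurable borel" by simp
      then show ?thesis by (subst nn_integral_add) (auto simp: eN)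
    qed
    also have "\<dots> \<le> (\<integral>\<^sup>+x\<in>{0..l}. min (G x) (H x) \<partial>lborel) + ennreal \<epsilon>"
      using NE by (rule add_left_mono)
    finally show "ennreal \<bar>f 0 - f l\<bar> \<le> (\<integral>\<^sup>+x\<in>{0..l}. min (G x) (H x) \<partial>lborel) + ennreal \<epsilon>" .
  qed
qed

lemma curve_integral_measurable:
  assumes "c \<in> rectifiable_curves" "g \<in> borel_measurable borel"
  shows "(\<lambda>x. g (snd c x) * indicator {0..fst c} x :: ennreal) \<in> borel_measurable borel"
  using curve_integrand_measurable[of "fst c" "snd c" g 0 "fst c"] assms by simp

lemma curve_integral_mono: "(\<And>x. g x \<le> h x) \<Longrightarrow> curve_integral g c \<le> curve_integral h c"
  unfolding curve_integral_def by (intro nn_integral_mono mult_right_mono) auto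

lemma curve_integral_suminf:
  assumes "c \<in> rectifiable_curves" "\<And>k. \<rho> k \<in> borel_measurable borel"
  shows "curve_integral (\<lambda>x. \<Sum>k. \<rho> k x) c = (\<Sum>k. curve_integral (\<rho> k) c)"
proof -
  have "curve_integral (\<lambda>x. \<Sum>k. \<rho> k x) c = (\<integral>\<^sup>+t. (\<Sum>k. \<rho> k (snd c t) * indicator {0..fst c} t) \<partial>lborel)"
    unfolding curve_integral_def by simp
  also have "\<dots> = (\<Sum>k. curve_integral (\<rho> k) c)"
    unfolding curve_integral_def
    by (rule nn_integral_suminf) (use curve_integral_measurable[OF assms(1)] assms(2) in auto)
  finally show ?thesis .
qed

lemma curve_integral_cmult:
  assumes "c \<in> rectifiable_curves" "g \<in> borel_measurable borel"
  shows "curve_integral (\<lambda>x. a * g x) c = a * curve_integral g c"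
proof -
  have "curve_integral (\<lambda>x. a * g x) c = (\<integral>\<^sup>+t. a * (g (snd c t) * indicator {0..fst c} t) \<partial>lborel)"
    unfolding curve_integral_def by (simp add: mult.assoc)
  also have "\<dots> = a * curve_integral g c"
    unfolding curve_integral_def
    by (rule nn_integral_cmult) (use curve_integral_measurable[OF assms] in auto)
  finally show ?thesis .
qed

text \<open>The exceptional curves of a weak upper gradient are those along which some integrable
  function has infinite integral; this family is closed under passing to larger curves.\<close>

definition upper_gradient_off ::
  "'a::metric_space measure \<Rightarrow> ('a \<Rightarrow> ennreal) \<Rightarrow> ('a \<Rightarrow> real) \<Rightarrow> ('a \<Rightarrow> ennreal) \<Rightarrow> bool" where
  "upper_gradient_off M \<rho> u g \<longleftrightarrow> \<rho> \<in> borel_measurable borel \<and> (\<integral>\<^sup>+x. \<rho> x \<partial>M) < \<infinity> \<and>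
     (\<forall>c\<in>rectifiable_curves. curve_integral \<rho> c < \<infinity> \<longrightarrow>
        ennreal \<bar>u (snd c 0) - u (snd c (fst c))\<bar> \<le> curve_integral g c)"

text \<open>Finiteness of the \<open>\<rho>\<close>-integral passes to subcurves, so the increment
  bound holds on every subinterval, as \<open>increment_le_integral_min\<close> requires.\<close>

lemma upper_gradient_off_subcurve:
  assumes "upper_gradient_off M \<rho> u g" "g \<in> borel_measurable borel" "(l, \<gamma>) \<in> rectifiable_curves"
    "curve_integral \<rho> (l, \<gamma>) < \<infinity>" "0 \<le> s" "s < t" "t \<le> l"
  shows "ennreal \<bar>u (\<gamma> s) - u (\<gamma> t)\<bar> \<le> (\<integral>\<^sup>+x\<in>{s..t}. g (\<gamma> x) \<partial>lborel)"
proof -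
  have \<rho>: "\<rho> \<in> borel_measurable borel" using assms(1) by (simp add: upper_gradient_off_def)
  have "curve_integral \<rho> (t - s, \<lambda>x. \<gamma> (x + s)) = (\<integral>\<^sup>+x\<in>{s..t}. \<rho> (\<gamma> x) \<partial>lborel)"
    using assms \<rho> by (intro curve_integral_subcurve) auto
  also have "\<dots> \<le> curve_integral \<rho> (l, \<gamma>)"
    unfolding curve_integral_def using assms by (intro nn_integral_mono) (auto simp: indicator_def)
  finally have "curve_integral \<rho> (t - s, \<lambda>x. \<gamma> (x + s)) < \<infinity>"
    using assms(4) by (rule le_less_trans)
  moreover have "(t - s, \<lambda>x. \<gamma> (x + s)) \<in> rectifiable_curves"
    using assms by (intro rectifiable_subcurve) auto
  ultimately have "ennreal \<bar>u (\<gamma> (0 + s)) - u (\<gamma> (t - s + s))\<bar> \<le> curve_integral g (t - s, \<lambda>x. \<gamma> (x + s))"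
    using assms(1) unfolding upper_gradient_off_def by fastforce
  then show ?thesis using curve_integral_subcurve[OF assms(3,2,5-7)] by simp
qed

section \<open>Exceptional families of curves\<close>

context metric_doubling
begin

text \<open>One integrable function replaces countably many: with positive weights, a finite
  integral of the weighted sum forces every summand to have a finite integral.\<close>

lemma countable_exceptional_union:
  fixes \<rho> :: "nat \<Rightarrow> 'a \<Rightarrow> ennreal"
  assumes \<rho>: "\<And>k. \<rho> k \<in> borel_measurable borel" "\<And>k. (\<integral>\<^sup>+x. \<rho> k x \<partial>M) < \<infinity>"
  obtains \<sigma> where "\<sigma> \<in> borel_measurable borel" "(\<integral>\<^sup>+x. \<sigma> x \<partial>M) < \<infinity>"
    "\<And>c k. c \<in> rectifiable_curves \<Longrightarrow> curve_integral \<sigma> c < \<infinity> \<Longrightarrow> curve_integral (\<rho> k) c < \<infinity>"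
proof -
  define I where "I k = enn2real (\<integral>\<^sup>+x. \<rho> k x \<partial>M)" for k
  have I: "(\<integral>\<^sup>+x. \<rho> k x \<partial>M) = ennreal (I k)" "0 \<le> I k" for k
    using \<rho>(2)[of k] by (auto simp: I_def)
  \<comment> \<open>The weights make the weighted integrals summable; the summand 1 keeps the
    denominator positive when \<open>I k = 0\<close>.\<close>
  define a where "a k = (1 / 2) ^ Suc k / (1 + I k)" for k
  have a: "0 < a k" "a k * I k \<le> 1 * (1 / 2) ^ Suc k" for k
  proof -
    have "0 < 1 + I k" using I(2)[of k] by linarith
    then show "0 < a k" unfolding a_def by (intro divide_pos_pos) auto
    have "a k * I k = (1 / 2) ^ Suc k * (I k / (1 + I k))" by (simp add: a_def)
    also have "\<dots> \<le> (1 / 2) ^ Suc k * 1"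
      using I(2)[of k] \<open>0 < 1 + I k\<close> by (intro mult_left_mono) (auto simp: divide_le_eq_1)
    finally show "a k * I k \<le> 1 * (1 / 2) ^ Suc k" by simp
  qed
  define \<sigma> where "\<sigma> x = (\<Sum>k. ennreal (a k) * \<rho> k x)" for x
  have m: "(\<lambda>x. ennreal (a k) * \<rho> k x) \<in> borel_measurable borel" for k using \<rho>(1)[of k] by measurable
  have 1: "\<sigma> \<in> borel_measurable borel" unfolding \<sigma>_def[abs_def] using m by measurable
  have "(\<integral>\<^sup>+x. \<sigma> x \<partial>M) = (\<Sum>k. \<integral>\<^sup>+x. ennreal (a k) * \<rho> k x \<partial>M)"
    unfolding \<sigma>_def by (rule nn_integral_suminf) (use m borel_measurable_M in auto)
  also have "\<dots> = (\<Sum>k. ennreal (a k * I k))"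
  proof -
    have "(\<integral>\<^sup>+x. ennreal (a k) * \<rho> k x \<partial>M) = ennreal (a k * I k)" for k
      using nn_integral_cmult[OF borel_measurable_M[OF \<rho>(1)], of "ennreal (a k)" k] a(1)[of k] I[of k]
      by (simp add: ennreal_mult)
    then show ?thesis by simp
  qed
  also have "\<dots> \<le> (\<Sum>k. ennreal (1 * (1 / 2) ^ Suc k))"
    by (intro suminf_le ennreal_leI a(2)) auto
  also have "\<dots> = ennreal 1" by (rule suminf_ennreal_half_powers) simp
  also have "\<dots> < \<infinity>" by simp
  finally have 2: "(\<integral>\<^sup>+x. \<sigma> x \<partial>M) < \<infinity>" .
  have 3: "curve_integral (\<rho> k) c < \<infinity>" if "c \<in> rectifiable_curves" "curve_integral \<sigma> c < \<infinity>" for c k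
  proof -
    have "ennreal (a k) * curve_integral (\<rho> k) c = curve_integral (\<lambda>x. ennreal (a k) * \<rho> k x) c"
      using curve_integral_cmult[OF that(1) \<rho>(1)] by simp
    also have "\<dots> \<le> curve_integral \<sigma> c"
      unfolding \<sigma>_def using sum_le_suminf[of "\<lambda>k. ennreal (a k) * \<rho> k _" "{k}"]
      by (intro curve_integral_mono) simp
    finally have "ennreal (a k) * curve_integral (\<rho> k) c < \<infinity>" using that(2) by (rule le_less_trans)
    moreover have "ennreal (a k) \<noteq> 0" using a(1)[of k] by simp
    ultimately show ?thesis by (auto simp: ennreal_mult_less_top)
  qed
  show ?thesis using that 1 2 3 by blast
qed

text \<open>Fuglede's description of families of modulus zero. A sum of admissible functions with
  integrals below \<open>(1 / 2) ^ Suc k\<close> is integrable, but has infinite integral along each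
  curve of the family; conversely, arbitrarily small multiples of such a function are
  admissible.\<close>

lemma weak_upper_gradient_1_iff:
  "weak_upper_gradient_1 M u g \<longleftrightarrow> g \<in> borel_measurable borel \<and> (\<exists>\<rho>. upper_gradient_off M \<rho> u g)"
proof (intro iffI conjI)
  assume w: "weak_upper_gradient_1 M u g"
  then show "g \<in> borel_measurable borel" by (simp add: weak_upper_gradient_1_def)
  let ?\<Gamma> = "{c \<in> rectifiable_curves. \<not> ennreal \<bar>u (snd c 0) - u (snd c (fst c))\<bar> \<le> curve_integral g c}"
  have "modulus_1 M ?\<Gamma> = 0" using w by (simp add: weak_upper_gradient_1_def)
  have "\<forall>k. \<exists>\<rho>. \<rho> \<in> borel_measurable borel \<and> (\<forall>c\<in>?\<Gamma>. 1 \<le> curve_integral \<rho> c) \<and>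
      (\<integral>\<^sup>+x. \<rho> x \<partial>M) < ennreal (1 * (1 / 2) ^ Suc k)"
  proof
    fix k :: nat
    have "modulus_1 M ?\<Gamma> < ennreal (1 * (1 / 2) ^ Suc k)"
      unfolding \<open>modulus_1 M ?\<Gamma> = 0\<close> by simp
    then show "\<exists>\<rho>. \<rho> \<in> borel_measurable borel \<and> (\<forall>c\<in>?\<Gamma>. 1 \<le> curve_integral \<rho> c) \<and>
      (\<integral>\<^sup>+x. \<rho> x \<partial>M) < ennreal (1 * (1 / 2) ^ Suc k)"
      unfolding modulus_1_def INF_less_iff by blast
  qed
  from choice[OF this] obtain \<rho> where \<rho>: "\<And>k::nat. \<rho> k \<in> borel_measurable borel"
    "\<And>k c. c \<in> ?\<Gamma> \<Longrightarrow> 1 \<le> curve_integral (\<rho> k) c"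
    "\<And>k. (\<integral>\<^sup>+x. \<rho> k x \<partial>M) < ennreal (1 * (1 / 2) ^ Suc k)" by blast
  have "(\<integral>\<^sup>+x. (\<Sum>k. \<rho> k x) \<partial>M) = (\<Sum>k. \<integral>\<^sup>+x. \<rho> k x \<partial>M)"
    by (rule nn_integral_suminf) (rule borel_measurable_M[OF \<rho>(1)])
  also have "\<dots> \<le> (\<Sum>k. ennreal (1 * (1 / 2) ^ Suc k))"
    by (intro suminf_le less_imp_le \<rho>(3)) auto
  also have "\<dots> = ennreal 1" by (rule suminf_ennreal_half_powers) simp
  also have "\<dots> < \<infinity>" by simp
  finally have fin: "(\<integral>\<^sup>+x. (\<Sum>k. \<rho> k x) \<partial>M) < \<infinity>" .
  have inf: "curve_integral (\<lambda>x. \<Sum>k. \<rho> k x) c = \<infinity>" if c: "c \<in> ?\<Gamma>" for c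
  proof (rule ccontr)
    assume "curve_integral (\<lambda>x. \<Sum>k. \<rho> k x) c \<noteq> \<infinity>"
    then have "curve_integral (\<lambda>x. \<Sum>k. \<rho> k x) c < top" by (simp add: less_top)
    then obtain n :: nat where n: "curve_integral (\<lambda>x. \<Sum>k. \<rho> k x) c < of_nat n"
      using ennreal_Ex_less_of_nat by blast
    have "of_nat n = (\<Sum>k<n. (1::ennreal))" by simp
    also have "\<dots> \<le> (\<Sum>k<n. curve_integral (\<rho> k) c)" by (intro sum_mono \<rho>(2) c)
    also have "\<dots> \<le> (\<Sum>k. curve_integral (\<rho> k) c)" by (rule sum_le_suminf) auto
    also have "\<dots> = curve_integral (\<lambda>x. \<Sum>k. \<rho> k x) c"
      using c \<rho>(1) by (subst curve_integral_suminf) auto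
    finally show False using n by simp
  qed
  have "upper_gradient_off M (\<lambda>x. \<Sum>k. \<rho> k x) u g"
    unfolding upper_gradient_off_def
  proof (intro conjI ballI impI)
    show "(\<lambda>x. \<Sum>k. \<rho> k x) \<in> borel_measurable borel" using \<rho>(1) by measurable
  next
    fix c :: "real \<times> (real \<Rightarrow> 'a)"
    assume "c \<in> rectifiable_curves" "curve_integral (\<lambda>x. \<Sum>k. \<rho> k x) c < \<infinity>"
    then show "ennreal \<bar>u (snd c 0) - u (snd c (fst c))\<bar> \<le> curve_integral g c"
      by - (rule ccontr, use inf[of c] in auto)
  qed (rule fin)
  then show "\<exists>\<rho>. upper_gradient_off M \<rho> u g" by blast
next
  assume "g \<in> borel_measurable borel \<and> (\<exists>\<rho>. upper_gradient_off M \<rho> u g)"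
  then obtain \<rho> where g: "g \<in> borel_measurable borel" and \<rho>: "upper_gradient_off M \<rho> u g" by blast
  let ?\<Gamma> = "{c \<in> rectifiable_curves. \<not> ennreal \<bar>u (snd c 0) - u (snd c (fst c))\<bar> \<le> curve_integral g c}"
  have \<rho>m: "\<rho> \<in> borel_measurable borel" and fin: "(\<integral>\<^sup>+x. \<rho> x \<partial>M) < \<infinity>"
    using \<rho> by (auto simp: upper_gradient_off_def)
  obtain I where I: "(\<integral>\<^sup>+x. \<rho> x \<partial>M) = ennreal I" "0 \<le> I"
    using fin by (cases "\<integral>\<^sup>+x. \<rho> x \<partial>M") auto
  have small: "modulus_1 M ?\<Gamma> \<le> ennreal \<epsilon>" if "\<epsilon> > 0" for \<epsilon>
  proof -
    let ?a = "\<epsilon> / (1 + I)"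
    have a: "?a > 0" using that I by simp
    have "modulus_1 M ?\<Gamma> \<le> (\<integral>\<^sup>+x. ennreal ?a * \<rho> x \<partial>M)"
      unfolding modulus_1_def
    proof (rule INF_lower, intro CollectI conjI ballI)
      show "(\<lambda>x. ennreal ?a * \<rho> x) \<in> borel_measurable borel" using \<rho>m by measurable
      fix c assume c: "c \<in> ?\<Gamma>"
      then have "curve_integral \<rho> c = \<infinity>"
        using \<rho> unfolding upper_gradient_off_def
        by (metis (mono_tags, lifting) infinity_ennreal_def less_top mem_Collect_eq)
      then have "curve_integral (\<lambda>x. ennreal ?a * \<rho> x) c = \<infinity>"
        using c \<rho>m a by (subst curve_integral_cmult) (auto simp: ennreal_mult_eq_top_iff)
      then show "1 \<le> curve_integral (\<lambda>x. ennreal ?a * \<rho> x) c" by simp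
    qed
    also have "\<dots> = ennreal (?a * I)"
      using nn_integral_cmult[OF borel_measurable_M[OF \<rho>m], of "ennreal ?a"] I
        ennreal_mult[OF less_imp_le[OF a] I(2)] by (simp only:)
    also have "\<dots> \<le> ennreal \<epsilon>" using I that by (intro ennreal_leI) (simp add: field_simps)
    finally show ?thesis .
  qed
  have "modulus_1 M ?\<Gamma> \<le> 0"
  proof (rule ennreal_le_epsilon)
    fix \<epsilon> :: real assume "\<epsilon> > 0"
    then show "modulus_1 M ?\<Gamma> \<le> 0 + ennreal \<epsilon>" using small by simp
  qed
  then show "weak_upper_gradient_1 M u g" using g by (simp add: weak_upper_gradient_1_def)
qed

end

lemma ball_borel [measurable]: "ball (x::'a::metric_space) r \<in> sets borel"
  by simp

text \<open>An order-reversing change of scale from \<open>[0, \<infinity>]\<close> to a bounded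
  interval, which lets possibly infinite gradients be compared through finite integrals.\<close>

lemma inverse_1_plus_ennreal_le_iff:
  "inverse (1 + a) \<le> inverse (1 + b) \<longleftrightarrow> b \<le> (a::ennreal)"
proof -
  have *: "inverse (1 + ennreal r) = ennreal (inverse (1 + r))" if "0 \<le> r" for r
  proof -
    have "1 + ennreal r = ennreal (1 + r)" using that by simp
    then show ?thesis using that by (simp only: inverse_ennreal)
  qed
  show ?thesis
  proof (cases a; cases b)
    fix r s assume "a = ennreal r" "0 \<le> r" "b = ennreal s" "0 \<le> s"
    then show ?thesis by (simp add: * ennreal_le_iff del: ennreal_plus)
  next
    fix r assume "a = ennreal r" "0 \<le> r" "b = top"
    then show ?thesis by (simp add: * ennreal_le_iff top_unique)
  qed (auto simp: top_unique)
qed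

section \<open>Minimal weak upper gradients in a proper space\<close>

locale complete_doubling = metric_doubling M c
  for M :: "'a::complete_space measure" and c :: real
begin

lemma compact_cball: "compact (cball (x::'a) R)"
  by (rule doubling_compact_cball[OF metric_doubling_axioms])

lemma locally_L1_ball:
  assumes "locally_L1 M g" "g \<in> borel_measurable borel"
  shows "(\<integral>\<^sup>+y\<in>ball x R. g y \<partial>M) < \<infinity>"
proof -
  obtain r where r: "\<And>x. r x > 0" "\<And>x. (\<integral>\<^sup>+y\<in>ball x (r x). g y \<partial>M) < \<infinity>"
    using assms(1) unfolding locally_L1_def by metis
  have "z \<in> ball z (r z)" for z using r(1) by simp
  then have "cball x R \<subseteq> (\<Union>z\<in>UNIV. ball z (r z))" by blast
  then obtain F where F: "finite F" "cball x R \<subseteq> (\<Union>z\<in>F. ball z (r z))"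
    using compactE_image[OF compact_cball, of UNIV "\<lambda>z. ball z (r z)" x R] by auto
  \<comment> \<open>Passing to the measure with density \<open>g\<close> turns the covering argument
    into subadditivity.\<close>
  let ?N = "density M g"
  have eN: "emeasure ?N B = (\<integral>\<^sup>+y\<in>B. g y \<partial>M)" if "B \<in> sets M" for B
    using that borel_measurable_M[OF assms(2)] by (intro emeasure_density)
  have "emeasure ?N (ball x R) \<le> emeasure ?N (\<Union>z\<in>F. ball z (r z))"
    using F by (intro emeasure_mono) (auto intro!: borel_in_M)
  also have "\<dots> \<le> (\<Sum>z\<in>F. emeasure ?N (ball z (r z)))"
    using F by (intro emeasure_subadditive_finite) auto
  also have "\<dots> < \<infinity>" using F r(2) by (auto simp: eN)
  finally show ?thesis by (simp add: eN)
qed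

text \<open>A locally integrable \<open>g\<close> may have infinite integral over the space, so its
  truncations to balls of radius \<open>n\<close> are combined; a curve of finite length stays in
  one of these balls.\<close>

lemma locally_L1_curve_integral_finite:
  assumes "locally_L1 M g" "g \<in> borel_measurable borel"
  obtains \<sigma> where "\<sigma> \<in> borel_measurable borel" "(\<integral>\<^sup>+x. \<sigma> x \<partial>M) < \<infinity>"
    "\<And>c. c \<in> rectifiable_curves \<Longrightarrow> curve_integral \<sigma> c < \<infinity> \<Longrightarrow> curve_integral g c < \<infinity>"
proof -
  define \<rho> where "\<rho> n x = g x * indicator (ball undefined (real n)) x" for n :: nat and x
  have "\<rho> n \<in> borel_measurable borel" for n
    unfolding \<rho>_def[abs_def] using assms(2) by measurable
  moreover have "(\<integral>\<^sup>+x. \<rho> n x \<partial>M) < \<infinity>" for n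
    unfolding \<rho>_def by (rule locally_L1_ball[OF assms])
  ultimately obtain \<sigma> where \<sigma>: "\<sigma> \<in> borel_measurable borel" "(\<integral>\<^sup>+x. \<sigma> x \<partial>M) < \<infinity>"
    "\<And>c k. c \<in> rectifiable_curves \<Longrightarrow> curve_integral \<sigma> c < \<infinity> \<Longrightarrow> curve_integral (\<rho> k) c < \<infinity>"
    using countable_exceptional_union[of \<rho>] by blast
  show ?thesis
  proof (rule that[OF \<sigma>(1,2)])
    fix cu :: "real \<times> (real \<Rightarrow> 'a)"
    assume cu: "cu \<in> rectifiable_curves" "curve_integral \<sigma> cu < \<infinity>"
    obtain l \<gamma> where lg: "cu = (l, \<gamma>)" by (cases cu)
    obtain n :: nat where n: "dist undefined (\<gamma> 0) + l < real n" using reals_Archimedean2 by blast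
    have "curve_integral g cu \<le> curve_integral (\<rho> n) cu"
      unfolding curve_integral_def
    proof (rule nn_integral_mono)
      fix t
      show "g (snd cu t) * indicator {0..fst cu} t \<le> \<rho> n (snd cu t) * indicator {0..fst cu} t"
      proof (cases "t \<in> {0..l}")
        case True
        then have "dist (\<gamma> 0) (\<gamma> t) \<le> t" using rectifiable_curve_lipschitz[of l \<gamma> 0 t] cu lg by auto
        then have "dist undefined (\<gamma> t) < real n"
          using n True dist_triangle[of undefined "\<gamma> t" "\<gamma> 0"] by auto
        then show ?thesis by (simp add: \<rho>_def lg)
      qed (simp add: lg)
    qed
    also have "\<dots> < \<infinity>" by (rule \<sigma>(3)[OF cu])
    finally show "curve_integral g cu < \<infinity>" .
  qed
qed

lemma locally_L1_mono:
  "locally_L1 M g \<Longrightarrow> (\<And>x. h x \<le> g x) \<Longrightarrow> locally_L1 M h"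
  unfolding locally_L1_def
  by (meson le_less_trans nn_integral_mono mult_right_mono zero_le)

abbreviation (input) local_wug where
  "local_wug u g \<equiv> weak_upper_gradient_1 M u g \<and> locally_L1 M g"

text \<open>Four exceptional functions are merged: one for each upper gradient inequality, and one
  for each of the finite curve integrals that \<open>increment_le_integral_min\<close>
  demands.\<close>

lemma local_wug_min:
  assumes g: "local_wug u g" and h: "local_wug u h"
  shows "local_wug u (\<lambda>x. min (g x) (h x))"
proof
  show "locally_L1 M (\<lambda>x. min (g x) (h x))" using g by (auto intro: locally_L1_mono)
  have m: "g \<in> borel_measurable borel" "h \<in> borel_measurable borel"
    using g h weak_upper_gradient_1_iff by blast+
  obtain \<rho> \<sigma> where \<rho>: "upper_gradient_off M \<rho> u g" and \<sigma>: "upper_gradient_off M \<sigma> u h"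
    using g h weak_upper_gradient_1_iff by blast
  obtain \<rho>' where \<rho>': "\<rho>' \<in> borel_measurable borel" "(\<integral>\<^sup>+x. \<rho>' x \<partial>M) < \<infinity>"
    "\<And>c. c \<in> rectifiable_curves \<Longrightarrow> curve_integral \<rho>' c < \<infinity> \<Longrightarrow> curve_integral g c < \<infinity>"
    using locally_L1_curve_integral_finite[of g] g m by blast
  obtain \<sigma>' where \<sigma>': "\<sigma>' \<in> borel_measurable borel" "(\<integral>\<^sup>+x. \<sigma>' x \<partial>M) < \<infinity>"
    "\<And>c. c \<in> rectifiable_curves \<Longrightarrow> curve_integral \<sigma>' c < \<infinity> \<Longrightarrow> curve_integral h c < \<infinity>"
    using locally_L1_curve_integral_finite[of h] h m by blast
  define P where "P k = (if k = 0 then \<rho> else if k = 1 then \<sigma> else if k = 2 then \<rho>' else \<sigma>')" for k :: nat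
  have "P k \<in> borel_measurable borel" "(\<integral>\<^sup>+x. P k x \<partial>M) < \<infinity>" for k
    using \<rho> \<sigma> \<rho>' \<sigma>' unfolding P_def upper_gradient_off_def by auto
  then obtain \<tau> where \<tau>: "\<tau> \<in> borel_measurable borel" "(\<integral>\<^sup>+x. \<tau> x \<partial>M) < \<infinity>"
    "\<And>c k. c \<in> rectifiable_curves \<Longrightarrow> curve_integral \<tau> c < \<infinity> \<Longrightarrow> curve_integral (P k) c < \<infinity>"
    using countable_exceptional_union[of P] by blast
  have "upper_gradient_off M \<tau> u (\<lambda>x. min (g x) (h x))"
    unfolding upper_gradient_off_def
  proof (intro conjI ballI impI \<tau>(1,2))
    fix cu :: "real \<times> (real \<Rightarrow> 'a)"
    assume cu: "cu \<in> rectifiable_curves" "curve_integral \<tau> cu < \<infinity>"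
    obtain l \<gamma> where lg: "cu = (l, \<gamma>)" by (cases cu)
    have fin: "curve_integral \<rho> (l, \<gamma>) < \<infinity>" "curve_integral \<sigma> (l, \<gamma>) < \<infinity>"
      "curve_integral \<rho>' (l, \<gamma>) < \<infinity>" "curve_integral \<sigma>' (l, \<gamma>) < \<infinity>"
      using \<tau>(3)[OF cu, of 0] \<tau>(3)[OF cu, of 1] \<tau>(3)[OF cu, of 2] \<tau>(3)[OF cu, of 3]
      by (simp_all add: P_def lg)
    have R: "(l, \<gamma>) \<in> rectifiable_curves" using cu lg by simp
    then have "0 \<le> l" by (simp add: rectifiable_curves_def)
    then have "ennreal \<bar>u (\<gamma> 0) - u (\<gamma> l)\<bar> \<le> (\<integral>\<^sup>+t\<in>{0..l}. min (g (\<gamma> t)) (h (\<gamma> t)) \<partial>lborel)"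
    proof (rule increment_le_integral_min)
      show "(\<lambda>x. g (\<gamma> x) * indicator {0..l} x) \<in> borel_measurable borel"
        "(\<lambda>x. h (\<gamma> x) * indicator {0..l} x) \<in> borel_measurable borel"
        using curve_integral_measurable[OF R] m by auto
      show "(\<integral>\<^sup>+t\<in>{0..l}. g (\<gamma> t) \<partial>lborel) < \<infinity>" "(\<integral>\<^sup>+t\<in>{0..l}. h (\<gamma> t) \<partial>lborel) < \<infinity>"
        using \<rho>'(3)[OF R] \<sigma>'(3)[OF R] fin by (auto simp: curve_integral_def)
      show "ennreal \<bar>u (\<gamma> s) - u (\<gamma> t)\<bar> \<le> (\<integral>\<^sup>+x\<in>{s..t}. g (\<gamma> x) \<partial>lborel)" if "0 \<le> s" "s < t" "t \<le> l" for s t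
        by (rule upper_gradient_off_subcurve[OF \<rho> m(1) R fin(1) that])
      show "ennreal \<bar>u (\<gamma> s) - u (\<gamma> t)\<bar> \<le> (\<integral>\<^sup>+x\<in>{s..t}. h (\<gamma> x) \<partial>lborel)" if "0 \<le> s" "s < t" "t \<le> l" for s t
        by (rule upper_gradient_off_subcurve[OF \<sigma> m(2) R fin(2) that])
    qed
    then show "ennreal \<bar>u (snd cu 0) - u (snd cu (fst cu))\<bar> \<le> curve_integral (\<lambda>x. min (g x) (h x)) cu"
      by (simp add: curve_integral_def lg)
  qed
  moreover have "(\<lambda>x. min (g x) (h x)) \<in> borel_measurable borel" using m by measurable
  ultimately show "weak_upper_gradient_1 M u (\<lambda>x. min (g x) (h x))"
    using weak_upper_gradient_1_iff by blast
qed

text \<open>Monotone convergence from above along a curve needs one finite integral; local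
  integrability of \<open>g 0\<close> provides it off an exceptional family, which is recorded as
  \<open>P 0\<close>.\<close>

lemma local_wug_INF:
  assumes g: "\<And>k::nat. local_wug u (g k)" and dec: "decseq g"
  shows "local_wug u (\<lambda>x. INF k. g k x)"
proof
  show "locally_L1 M (\<lambda>x. INF k. g k x)"
    using g by (auto intro: locally_L1_mono[of "g 0"] INF_lower)
  have m: "g k \<in> borel_measurable borel" for k
    using g[of k] weak_upper_gradient_1_iff by blast
  have "\<forall>k. \<exists>\<rho>. upper_gradient_off M \<rho> u (g k)"
    using g weak_upper_gradient_1_iff by blast
  from choice[OF this] obtain \<rho> where \<rho>: "\<And>k. upper_gradient_off M (\<rho> k) u (g k)" by blast
  obtain \<rho>' where \<rho>': "\<rho>' \<in> borel_measurable borel" "(\<integral>\<^sup>+x. \<rho>' x \<partial>M) < \<infinity>"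
    "\<And>c. c \<in> rectifiable_curves \<Longrightarrow> curve_integral \<rho>' c < \<infinity> \<Longrightarrow> curve_integral (g 0) c < \<infinity>"
    using locally_L1_curve_integral_finite[of "g 0"] g m by blast
  define P where "P k = (case k of 0 \<Rightarrow> \<rho>' | Suc j \<Rightarrow> \<rho> j)" for k :: nat
  have "P k \<in> borel_measurable borel" "(\<integral>\<^sup>+x. P k x \<partial>M) < \<infinity>" for k
    using \<rho> \<rho>' unfolding P_def upper_gradient_off_def by (auto split: nat.split)
  then obtain \<tau> where \<tau>: "\<tau> \<in> borel_measurable borel" "(\<integral>\<^sup>+x. \<tau> x \<partial>M) < \<infinity>"
    "\<And>c k. c \<in> rectifiable_curves \<Longrightarrow> curve_integral \<tau> c < \<infinity> \<Longrightarrow> curve_integral (P k) c < \<infinity>"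
    using countable_exceptional_union[of P] by blast
  have "upper_gradient_off M \<tau> u (\<lambda>x. INF k. g k x)"
    unfolding upper_gradient_off_def
  proof (intro conjI ballI impI \<tau>(1,2))
    fix cu :: "real \<times> (real \<Rightarrow> 'a)"
    assume cu: "cu \<in> rectifiable_curves" "curve_integral \<tau> cu < \<infinity>"
    have 0: "curve_integral (g 0) cu < \<infinity>" using \<rho>'(3)[OF cu(1)] \<tau>(3)[OF cu, of 0] by (simp add: P_def)
    have k: "ennreal \<bar>u (snd cu 0) - u (snd cu (fst cu))\<bar> \<le> curve_integral (g k) cu" for k
      using \<rho>[of k] cu(1) \<tau>(3)[OF cu, of "Suc k"] unfolding upper_gradient_off_def P_def by simp
    have "curve_integral (\<lambda>x. INF k. g k x) cu
        = (\<integral>\<^sup>+t. (INF k. g k (snd cu t) * indicator {0..fst cu} t) \<partial>lborel)"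
      unfolding curve_integral_def by (intro nn_integral_cong) (auto simp: indicator_def)
    also have "\<dots> = (INF k. \<integral>\<^sup>+t. g k (snd cu t) * indicator {0..fst cu} t \<partial>lborel)"
    proof (rule nn_integral_monotone_convergence_INF_decseq[where i = 0])
      show "decseq (\<lambda>k t. g k (snd cu t) * indicator {0..fst cu} t)"
      proof (rule decseq_SucI, rule le_funI)
        fix k t
        have "g (Suc k) (snd cu t) \<le> g k (snd cu t)"
          using decseq_SucD[OF dec] by (auto simp: le_fun_def)
        then show "g (Suc k) (snd cu t) * indicator {0..fst cu} t \<le> g k (snd cu t) * indicator {0..fst cu} t"
          by (rule mult_right_mono) simp
      qed
      show "(\<lambda>t. g k (snd cu t) * indicator {0..fst cu} t) \<in> borel_measurable lborel" for k
        using curve_integral_measurable[OF cu(1) m] by simp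
      show "(\<integral>\<^sup>+t. g 0 (snd cu t) * indicator {0..fst cu} t \<partial>lborel) < \<infinity>"
        using 0 by (simp add: curve_integral_def)
    qed
    finally have eq: "curve_integral (\<lambda>x. INF k. g k x) cu = (INF k. curve_integral (g k) cu)"
      by (simp add: curve_integral_def)
    show "ennreal \<bar>u (snd cu 0) - u (snd cu (fst cu))\<bar> \<le> curve_integral (\<lambda>x. INF k. g k x) cu"
      unfolding eq by (rule INF_greatest) (rule k)
  qed
  moreover have "(\<lambda>x. INF k. g k x) \<in> borel_measurable borel" using m by measurable
  ultimately show "weak_upper_gradient_1 M u (\<lambda>x. INF k. g k x)"
    using weak_upper_gradient_1_iff by blast
qed

text \<open>A minimal element maximises the bounded, strictly decreasing functional
  \<open>g \<mapsto> \<integral> w / (1 + g)\<close> for a positive integrable weight \<open>w\<close>.\<close>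

lemma minimal_weak_upper_gradient_exists:
  assumes "local_wug u g0"
  shows "is_minimal_weak_upper_gradient_1 M u (minimal_weak_upper_gradient_1 M u)"
proof -
  obtain w where w: "w \<in> borel_measurable M" "integral\<^sup>N M w \<noteq> \<infinity>"
    "\<And>x. 0 < w x \<and> w x < \<infinity>"
    using Ex_finite_integrable_function by (auto simp: space_M)
  define H where "H g = (\<integral>\<^sup>+x. inverse (1 + g x) * w x \<partial>M)" for g
  let ?G = "{g. local_wug u g}"
  have mG: "g \<in> borel_measurable borel" if "g \<in> ?G" for g
    using that weak_upper_gradient_1_iff by blast
  have HmI: "(\<lambda>x. inverse (1 + g x) * w x) \<in> borel_measurable M" if "g \<in> borel_measurable borel" for g
  proof -
    have "g \<in> borel_measurable M" using that by (rule borel_measurable_M)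
    then show ?thesis using w(1) by measurable
  qed
  have anti: "H g \<le> H h" if "\<And>x. h x \<le> g x" for g h
    unfolding H_def using that
    by (intro nn_integral_mono mult_right_mono) (simp_all add: inverse_1_plus_ennreal_le_iff)
  have "H ` ?G \<noteq> {}" using assms by blast
  from ennreal_Sup_countable_SUP[OF this]
  obtain f :: "nat \<Rightarrow> ennreal" where f: "range f \<subseteq> H ` ?G" "Sup (H ` ?G) = (SUP i. f i)"
    by (elim exE conjE) (rule that)
  have "\<forall>i. \<exists>g. g \<in> ?G \<and> H g = f i"
  proof
    fix i
    have "f i \<in> H ` ?G" using f(1) by (rule subsetD) simp
    then obtain g where "g \<in> ?G" "f i = H g" by (rule imageE) (rule that)
    then show "\<exists>g. g \<in> ?G \<and> H g = f i" by auto
  qed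
  from choice[OF this] obtain g where g: "\<And>i. g i \<in> ?G" "\<And>i. H (g i) = f i" by blast
  \<comment> \<open>A maximising sequence need not be monotone. Its running minima are again local
    weak upper gradients, and their values of \<open>H\<close> are at least as large.\<close>
  define m where "m k = rec_nat (g 0) (\<lambda>k r x. min (r x) (g (Suc k) x)) k" for k
  have m0: "m 0 = g 0" and mS: "m (Suc k) = (\<lambda>x. min (m k x) (g (Suc k) x))" for k
    by (auto simp: m_def)
  have mG': "local_wug u (m k)" for k
  proof (induction k)
    case 0 then show ?case using g(1)[of 0] by (simp add: m0)
  next
    case (Suc k)
    have "local_wug u (g (Suc k))" using g(1)[of "Suc k"] by simp
    with Suc show ?case unfolding mS by (rule local_wug_min)
  qed
  have mle: "m k x \<le> g k x" for k x by (cases k) (auto simp: m0 mS)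
  have "decseq m" by (rule decseq_SucI) (auto simp: mS le_fun_def)
  define g' where "g' x = (INF k. m k x)" for x
  have g': "g' \<in> ?G" using local_wug_INF[OF mG' \<open>decseq m\<close>] unfolding g'_def[abs_def] by simp
  have g'le: "g' x \<le> g k x" for k x
    unfolding g'_def by (rule INF_lower2[of k]) (auto intro: mle)
  have top: "H h \<le> H g'" if "h \<in> ?G" for h
  proof -
    have "H h \<le> Sup (H ` ?G)" using that by (intro Sup_upper) blast
    also have "\<dots> \<le> H g'"
      unfolding f(2) g(2)[symmetric] by (intro SUP_least anti) (rule g'le)
    finally show ?thesis .
  qed
  have "is_minimal_weak_upper_gradient_1 M u g'"
    unfolding is_minimal_weak_upper_gradient_1_def
  proof (intro conjI allI impI)
    show "weak_upper_gradient_1 M u g'" "locally_L1 M g'" using g' by auto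
    fix h assume h: "local_wug u h"
    \<comment> \<open>Minimality is tested on \<open>min g' h\<close>: lying below
      \<open>g'\<close>, it has the larger integrand in \<open>H\<close>, while maximality forbids a
      larger integral. So the integrands agree almost everywhere, and with them \<open>k\<close> and
      \<open>g'\<close>.\<close>
    define k where "k x = min (g' x) (h x)" for x
    have k: "k \<in> ?G" using local_wug_min[of u g' h] g' h unfolding k_def[abs_def] by simp
    have le: "inverse (1 + g' x) * w x \<le> inverse (1 + k x) * w x" for x
      by (rule mult_right_mono) (auto simp: inverse_1_plus_ennreal_le_iff k_def)
    have "H g' \<le> integral\<^sup>N M w"
      unfolding H_def
    proof (rule nn_integral_mono)
      fix x
      have "inverse (1 + g' x) \<le> inverse (1 + 0)" unfolding inverse_1_plus_ennreal_le_iff by simp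
      then have "inverse (1 + g' x) * w x \<le> 1 * w x" by (intro mult_right_mono) auto
      then show "inverse (1 + g' x) * w x \<le> w x" by simp
    qed
    then have fin: "H g' \<noteq> \<infinity>" using w(2) by (auto simp: top_unique)
    have "(\<integral>\<^sup>+x. inverse (1 + k x) * w x - inverse (1 + g' x) * w x \<partial>M) = H k - H g'"
      unfolding H_def
      by (rule nn_integral_diff) (use HmI[OF mG] k g' fin le in \<open>auto simp: H_def\<close>)
    also have "\<dots> = 0" using top[OF k] fin by (auto simp: diff_eq_0_iff_ennreal top_unique less_top)
    finally have "AE x in M. inverse (1 + k x) * w x - inverse (1 + g' x) * w x = 0"
      by (subst (asm) nn_integral_0_iff_AE) (use HmI[OF mG] k g' in auto)
    then show "AE x in M. g' x \<le> h x"
    proof eventually_elim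
      case (elim x)
      have ne: "w x \<noteq> 0" "w x \<noteq> top" using w(3)[of x] by auto
      have "inverse (1 + k x) * w x \<noteq> top"
        using ne by (auto simp: ennreal_mult_eq_top_iff)
      then have "w x * inverse (1 + k x) \<le> w x * inverse (1 + g' x)"
        using elim by (auto simp: diff_eq_0_iff_ennreal mult.commute)
      then have "inverse (1 + k x) \<le> inverse (1 + g' x)"
        using ne by (simp add: ennreal_mult_le_mult_iff)
      then have "g' x \<le> k x" by (simp add: inverse_1_plus_ennreal_le_iff)
      then show ?case by (simp add: k_def)
    qed
  qed
  then show ?thesis unfolding minimal_weak_upper_gradient_1_def by (rule someI[of "is_minimal_weak_upper_gradient_1 M u"])
qed

text \<open>Here \<open>a j\<close> will be a Lipschitz constant on \<open>ball j r\<close>. Adding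
  the constants of all balls that contain \<open>x\<close>, instead of selecting one, keeps the
  function measurable and its integral explicit.\<close>

definition net_gradient :: "real \<Rightarrow> 'a set \<Rightarrow> ('a \<Rightarrow> real) \<Rightarrow> 'a \<Rightarrow> ennreal" where
  "net_gradient r D a x = (\<integral>\<^sup>+j. ennreal (a j) * indicator (ball j r) x \<partial>count_space D)"

lemma net_gradient_measurable:
  assumes "0 < r" "net r D" shows "net_gradient r D a \<in> borel_measurable borel"
  unfolding net_gradient_def[abs_def]
  using assms separated_countable[of r D]
  by (intro borel_measurable_nn_integral_count_space) (auto simp: net_def intro!: borel_measurable_times borel_measurable_indicator)

lemma nn_integral_net_gradient:
  assumes "0 < r" "net r D"
  shows "(\<integral>\<^sup>+x. net_gradient r D a x \<partial>M) = (\<integral>\<^sup>+j. ennreal (a j) * emeasure M (ball j r) \<partial>count_space D)"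
proof -
  have "countable D" using assms separated_countable[of r D] by (simp add: net_def)
  moreover have "(\<lambda>x. ennreal (a j) * indicator (ball j r) x) \<in> borel_measurable M" for j
    by (rule borel_measurable_M) measurable
  ultimately have "(\<integral>\<^sup>+x. net_gradient r D a x \<partial>M)
      = (\<integral>\<^sup>+j. \<integral>\<^sup>+x. ennreal (a j) * indicator (ball j r) x \<partial>M \<partial>count_space D)"
    unfolding net_gradient_def by (intro nn_integral_count_space_nn_integral)
  then show ?thesis by (simp add: nn_integral_cmult_indicator)
qed

lemma net_gradient_locally_L1:
  assumes "0 < r" "net r D" shows "locally_L1 M (net_gradient r D a)"
  unfolding locally_L1_def
proof (intro allI exI[of _ r] conjI assms(1))
  fix x
  \<comment> \<open>Only net points within \<open>2 * r\<close> of \<open>x\<close> have balls of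
    radius \<open>r\<close> that meet \<open>ball x r\<close>.\<close>
  let ?F = "D \<inter> ball x (2 * r)"
  have fin: "finite ?F" using assms by (intro separated_finite_ball[of r]) (auto simp: net_def)
  have "net_gradient r D a y \<le> (\<Sum>j\<in>?F. ennreal (a j))" if "y \<in> ball x r" for y
  proof -
    have "net_gradient r D a y = (\<Sum>j\<in>?F. ennreal (a j) * indicator (ball j r) y)"
      unfolding net_gradient_def
    proof (rule nn_integral_count_space'[OF fin])
      fix j assume j: "j \<in> D" "j \<notin> ?F"
      have "y \<notin> ball j r"
      proof
        assume "y \<in> ball j r"
        then have "dist x j < 2 * r" using that dist_triangle2[of x j y] by auto
        then show False using j by auto
      qed
      then show "ennreal (a j) * indicator (ball j r) y = 0" by simp
    qed auto
    also have "\<dots> \<le> (\<Sum>j\<in>?F. ennreal (a j))"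
      by (intro sum_mono) (auto simp: indicator_def)
    finally show ?thesis .
  qed
  then have "(\<integral>\<^sup>+y\<in>ball x r. net_gradient r D a y \<partial>M)
      \<le> (\<integral>\<^sup>+y. (\<Sum>j\<in>?F. ennreal (a j)) * indicator (ball x r) y \<partial>M)"
    by (intro nn_integral_mono) (auto simp: indicator_def)
  also have "\<dots> = (\<Sum>j\<in>?F. ennreal (a j)) * emeasure M (ball x r)"
    by (subst nn_integral_cmult_indicator) auto
  also have "\<dots> < \<infinity>"
  proof -
    have "(\<Sum>j\<in>F. ennreal (a j)) < \<infinity>" if "finite F" for F :: "'a set"
      using that by (induction rule: finite_induct) auto
    then show ?thesis using fin by (simp add: emeasure_ball ennreal_mult_less_top)
  qed
  finally show "(\<integral>\<^sup>+y\<in>ball x r. net_gradient r D a y \<partial>M) < \<infinity>" .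
qed

text \<open>An arc-length curve is 1-Lipschitz, so near each parameter it stays in one ball
  \<open>ball j r\<close>, where \<open>a j\<close> times the elapsed length bounds the increment.
  No curve is exceptional, so the zero function serves as \<open>\<rho>\<close>.\<close>

lemma net_gradient_wug:
  assumes r: "0 < r" "net r D"
    and lip: "\<And>j x y. j \<in> D \<Longrightarrow> x \<in> ball j r \<Longrightarrow> y \<in> ball j r \<Longrightarrow> \<bar>v x - v y\<bar> \<le> a j * dist x y"
    and a: "\<And>j. j \<in> D \<Longrightarrow> 0 \<le> a j"
  shows "weak_upper_gradient_1 M v (net_gradient r D a)"
proof -
  let ?g = "net_gradient r D a"
  have m: "?g \<in> borel_measurable borel" by (rule net_gradient_measurable[OF r])
  have "upper_gradient_off M (\<lambda>x. 0) v ?g"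
    unfolding upper_gradient_off_def
  proof (intro conjI ballI impI)
    fix cu :: "real \<times> (real \<Rightarrow> 'a)"
    assume cu: "cu \<in> rectifiable_curves"
    obtain l \<gamma> where lg: "cu = (l, \<gamma>)" by (cases cu)
    have R: "(l, \<gamma>) \<in> rectifiable_curves" using cu lg by simp
    then have "0 \<le> l" by (simp add: rectifiable_curves_def)
    then have "ennreal \<bar>v (\<gamma> 0) - v (\<gamma> l)\<bar> \<le> (\<integral>\<^sup>+t\<in>{0..l}. ?g (\<gamma> t) \<partial>lborel)"
    proof (rule increment_le_integral_if_locally)
      show "(\<lambda>x. ?g (\<gamma> x) * indicator {0..l} x) \<in> borel_measurable borel"
        using curve_integral_measurable[OF R m] by simp
      fix x assume x: "0 \<le> x" "x \<le> l"
      obtain j where j: "j \<in> D" "dist j (\<gamma> x) < r" using r unfolding net_def by blast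
      show "\<exists>d>0. \<forall>s t. 0 \<le> s \<and> s \<le> x \<and> x \<le> t \<and> t \<le> l \<and> s < t \<and> t - s < d \<longrightarrow>
         ennreal \<bar>v (\<gamma> s) - v (\<gamma> t)\<bar> \<le> (\<integral>\<^sup>+x\<in>{s..t}. ?g (\<gamma> x) \<partial>lborel)"
      proof (intro exI[of _ "r - dist j (\<gamma> x)"] conjI allI impI)
        fix s t assume st: "0 \<le> s \<and> s \<le> x \<and> x \<le> t \<and> t \<le> l \<and> s < t \<and> t - s < r - dist j (\<gamma> x)"
        have inb: "\<gamma> y \<in> ball j r" if "y \<in> {s..t}" for y
        proof -
          have "dist (\<gamma> x) (\<gamma> y) \<le> \<bar>x - y\<bar>"
            using rectifiable_curve_lipschitz[OF R, of x y] rectifiable_curve_lipschitz[OF R, of y x] that st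
            by (cases "x \<le> y") (auto simp: dist_commute)
          moreover have "\<bar>x - y\<bar> \<le> t - s" using st that by auto
          ultimately show ?thesis using st dist_triangle[of j "\<gamma> y" "\<gamma> x"] by auto
        qed
        have "\<bar>v (\<gamma> s) - v (\<gamma> t)\<bar> \<le> a j * dist (\<gamma> s) (\<gamma> t)"
          using inb[of s] inb[of t] st by (intro lip j) auto
        also have "\<dots> \<le> a j * (t - s)"
          using a[OF j(1)] rectifiable_curve_lipschitz[OF R, of s t] st by (intro mult_left_mono) auto
        finally have "ennreal \<bar>v (\<gamma> s) - v (\<gamma> t)\<bar> \<le> ennreal (a j * (t - s))" by (rule ennreal_leI)
        also have "\<dots> = (\<integral>\<^sup>+x\<in>{s..t}. ennreal (a j) \<partial>lborel)"
          using st a[OF j(1)] by (subst nn_integral_cmult_indicator) (auto simp: ennreal_mult)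
        also have "\<dots> \<le> (\<integral>\<^sup>+x\<in>{s..t}. ?g (\<gamma> x) \<partial>lborel)"
        proof (rule nn_integral_mono)
          fix y
          show "ennreal (a j) * indicator {s..t} y \<le> ?g (\<gamma> y) * indicator {s..t} y"
          proof (cases "y \<in> {s..t}")
            case True
            have "ennreal (a j) = (\<integral>\<^sup>+i. ennreal (a i) * indicator (ball i r) (\<gamma> y) \<partial>count_space {j})"
              using inb[OF True] by (subst nn_integral_count_space_finite) auto
            also have "\<dots> \<le> ?g (\<gamma> y)"
              unfolding net_gradient_def using j(1)
              by (subst (1 2) nn_integral_count_space_indicator)
                 (auto intro!: nn_integral_mono simp: indicator_def)
            finally show ?thesis using True by simp
          qed simp
        qed
        finally show "ennreal \<bar>v (\<gamma> s) - v (\<gamma> t)\<bar> \<le> (\<integral>\<^sup>+x\<in>{s..t}. ?g (\<gamma> x) \<partial>lborel)" .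
      qed (use j in simp)
    qed
    then show "ennreal \<bar>v (snd cu 0) - v (snd cu (fst cu))\<bar> \<le> curve_integral ?g cu"
      by (simp add: curve_integral_def lg)
  qed auto
  then show ?thesis using m weak_upper_gradient_1_iff by blast
qed

lemma locally_lipschitz_on_cball:
  assumes "locally_lipschitz (v :: 'a \<Rightarrow> real)"
  obtains L where "L-lipschitz_on (cball x R) v"
proof -
  \<comment> \<open>The compactness theorem for local Lipschitz continuity concerns time-dependent
    maps; a single dummy time is used.\<close>
  have "local_lipschitz {0::real} (cball x R) (\<lambda>_. v)"
    unfolding local_lipschitz_def
  proof (intro ballI)
    fix z t assume "z \<in> cball x R" "t \<in> {0::real}"
    obtain r L where r: "r > 0" "L-lipschitz_on (ball z r) v"
      using assms unfolding locally_lipschitz_def by blast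
    have "L-lipschitz_on (cball z (r/2) \<inter> cball x R) v"
      by (rule lipschitz_on_subset[OF r(2)]) (use r in auto)
    then show "\<exists>u>0. \<exists>L. \<forall>t\<in>cball t u \<inter> {0}. L-lipschitz_on (cball z u \<inter> cball x R) v"
      using r by (intro exI[of _ "r/2"]) auto
  qed
  then obtain L where "\<And>t. t \<in> {0::real} \<Longrightarrow> L-lipschitz_on (cball x R) v"
    using local_lipschitz_compact_implies_lipschitz[OF _ compact_cball, of "{0::real}" x R "\<lambda>_. v"] by fastforce
  then show ?thesis using that by blast
qed

text \<open>A \<open>net_gradient\<close> at scale 1 supplies the locally integrable weak upper
  gradient from which existence of a minimal one follows; from here on the choice in
  \<open>minimal_weak_upper_gradient_1\<close> is meaningful.\<close>

lemma minimal_weak_upper_gradient_locally_lipschitz: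
  assumes "locally_lipschitz v"
  shows "is_minimal_weak_upper_gradient_1 M v (minimal_weak_upper_gradient_1 M v)"
proof -
  obtain D :: "'a set" where D: "net 1 D" using net_exists[of 1] by auto
  have "\<forall>j. \<exists>L. L-lipschitz_on (cball j 1) v"
    using locally_lipschitz_on_cball[OF assms] by blast
  from choice[OF this] obtain a where a: "\<And>j. (a j)-lipschitz_on (cball j 1) v" by blast
  have "weak_upper_gradient_1 M v (net_gradient 1 D a)"
  proof (rule net_gradient_wug[OF _ D])
    show "\<bar>v x - v y\<bar> \<le> a j * dist x y" if "x \<in> ball j 1" "y \<in> ball j 1" for j x y
      using lipschitz_onD[OF a, of x j y] that by (auto simp: dist_real_def)
    show "0 \<le> a j" for j using a lipschitz_on_nonneg by blast
  qed auto
  moreover have "locally_L1 M (net_gradient 1 D a)" by (rule net_gradient_locally_L1[OF _ D]) simp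
  ultimately show ?thesis using minimal_weak_upper_gradient_exists by blast
qed

end

section \<open>Regularisation by chains\<close>

lemma sum_lessThan_diff:
  fixes f :: "nat \<Rightarrow> real"
  assumes "m \<le> n" shows "sum f {..<n} - sum f {..<m} = sum f {m..<n}"
  using sum.atLeastLessThan_concat[of 0 m n f] assms by (simp add: lessThan_atLeast0)

text \<open>A discrete chain is turned into a step curve parametrised by its accumulated length; \<open>w\<close> is
  the accumulated weighted length.\<close>

lemma chain_parametrisation:
  fixes p :: "nat \<Rightarrow> 'a::metric_space" and \<psi> :: "'a \<Rightarrow> real"
  assumes step: "\<And>i. i < k \<Longrightarrow> dist (p i) (p (Suc i)) \<le> s"
    and \<psi>: "\<And>x. 0 \<le> \<psi> x"
    and L: "(\<Sum>i<k. dist (p i) (p (Suc i))) \<le> L"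
    and s: "0 \<le> s"
  obtains \<sigma> :: "real \<Rightarrow> 'a" and w :: "real \<Rightarrow> real" where
    "\<sigma> 0 = p 0" "\<sigma> L = p k" "0 \<le> w 0" "w L = (\<Sum>i<k. \<psi> (p i) * dist (p i) (p (Suc i)))"
    "\<And>a b. 0 \<le> a \<Longrightarrow> a \<le> b \<Longrightarrow> dist (\<sigma> a) (\<sigma> b) \<le> b - a + s"
    "\<And>a b m. 0 \<le> a \<Longrightarrow> a \<le> b \<Longrightarrow> (\<And>r. a \<le> r \<Longrightarrow> r \<le> b \<Longrightarrow> m \<le> \<psi> (\<sigma> r)) \<Longrightarrow>
        m * dist (\<sigma> a) (\<sigma> b) \<le> w b - w a"
proof -
  let ?d = "\<lambda>i. dist (p i) (p (Suc i))"
  define A where "A i = (\<Sum>j<i. ?d j)" for i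
  have A0: "A 0 = 0" and AS: "A (Suc i) = A i + ?d i" for i by (auto simp: A_def)
  have Amono: "A i \<le> A j" if "i \<le> j" for i j
    unfolding A_def using that by (intro sum_mono2) auto
  have Anonneg: "0 \<le> A i" for i unfolding A_def by (intro sum_nonneg) auto
  have Akl: "A k \<le> L" using L by (simp add: A_def)
  \<comment> \<open>\<open>I t\<close> is the last index reached by time \<open>t\<close>: the step
    curve rests at \<open>p i\<close> from \<open>A i\<close> until \<open>A (Suc i)\<close>, and at
    \<open>p k\<close> from \<open>A k\<close> on.\<close>
  define I where "I t = Max {i. i \<le> k \<and> A i \<le> t}" for t
  have fin: "finite {i. i \<le> k \<and> A i \<le> t}" for t by (rule finite_subset[of _ "{..k}"]) auto
  have ne: "{i. i \<le> k \<and> A i \<le> t} \<noteq> {}" if "0 \<le> t" for t using that A0 by auto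
  have I: "I t \<le> k" "A (I t) \<le> t" if "0 \<le> t" for t
    using Max_in[OF fin ne[OF that]] unfolding I_def by auto
  have Ige: "i \<le> I t" if "i \<le> k" "A i \<le> t" for i t
    using Max_ge[OF fin, of i t] that unfolding I_def by auto
  have Igt: "t < A i" if "I t < i" "i \<le> k" for i t
    using Ige[of i t] that by force
  have Imono: "I a \<le> I b" if "0 \<le> a" "a \<le> b" for a b
    using I[of a] that by (intro Ige) auto
  have IL: "I L = k" using I[of L] Ige[of k L] Akl Anonneg[of k] by force
  have dA: "dist (p i) (p j) \<le> A j - A i" if "i \<le> j" for i j
    using that
  proof (induction rule: dec_induct)
    case (step n)
    then show ?case using dist_triangle[of "p i" "p (Suc n)" "p n"] AS[of n] by simp
  qed simp
  define \<sigma> where "\<sigma> t = p (I t)" for t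
  define w where "w t = (\<Sum>i<I t. \<psi> (p i) * ?d i)" for t
  show ?thesis
  proof (rule that[of \<sigma> w])
    have "A (I 0) = 0" using I[of 0] Anonneg[of "I 0"] by auto
    then have "dist (p 0) (p (I 0)) \<le> 0" using dA[of 0 "I 0"] A0 by simp
    then show "\<sigma> 0 = p 0" by (simp add: \<sigma>_def)
    show "\<sigma> L = p k" by (simp add: \<sigma>_def IL)
    show "0 \<le> w 0" unfolding w_def by (intro sum_nonneg mult_nonneg_nonneg \<psi>) auto
    show "w L = (\<Sum>i<k. \<psi> (p i) * ?d i)" by (simp add: w_def IL)
    fix a b :: real assume ab: "0 \<le> a" "a \<le> b"
    show "dist (\<sigma> a) (\<sigma> b) \<le> b - a + s"
    proof (cases "I a = k")
      case True
      then have "I b = k" using Imono[OF ab] I[of b] ab by auto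
      then show ?thesis using True ab s by (simp add: \<sigma>_def)
    next
      case False
      then have "I a < k" using I[of a] ab by auto
      then have "a < A (Suc (I a))" by (intro Igt) auto
      moreover have "?d (I a) \<le> s" using \<open>I a < k\<close> by (rule step)
      moreover have "A (I b) \<le> b" using I ab by auto
      ultimately show ?thesis
        using dA[OF Imono[OF ab]] AS[of "I a"] unfolding \<sigma>_def by linarith
    qed
    fix m assume m: "\<And>r. a \<le> r \<Longrightarrow> r \<le> b \<Longrightarrow> m \<le> \<psi> (\<sigma> r)"
    have eq: "w b - w a = (\<Sum>i\<in>{I a..<I b}. \<psi> (p i) * ?d i)"
      unfolding w_def using Imono[OF ab]
      by (rule sum_lessThan_diff)
    show "m * dist (\<sigma> a) (\<sigma> b) \<le> w b - w a"
    proof (cases "0 \<le> m")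
      case False
      have "m * dist (\<sigma> a) (\<sigma> b) \<le> 0" using False by (simp add: mult_nonpos_nonneg)
      also have "0 \<le> w b - w a" unfolding eq by (intro sum_nonneg mult_nonneg_nonneg \<psi>) auto
      finally show ?thesis .
    next
      case True
      \<comment> \<open>Links of length zero contribute nothing. Any other link starts at a point
        that the step curve visits in \<open>[a, b]\<close>, at time \<open>a\<close> or at time
        \<open>A i\<close>, so the lower bound \<open>m\<close> applies to its weight.\<close>
      have trm: "m * ?d i \<le> \<psi> (p i) * ?d i" if i: "i \<in> {I a..<I b}" for i
      proof (cases "?d i = 0")
        case False
        have "i < k" using i I[of b] ab by auto
        have "\<exists>r. a \<le> r \<and> r \<le> b \<and> \<sigma> r = p i"
        proof (cases "i = I a")
          case True
          then show ?thesis using ab by (intro exI[of _ a]) (simp add: \<sigma>_def)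
        next
          case ne': False
          then have "a < A i" using i \<open>i < k\<close> by (intro Igt) auto
          moreover have "A i \<le> b" using Amono[of i "I b"] i I[of b] ab by auto
          moreover have "I (A i) = i"
          proof (rule antisym)
            show "i \<le> I (A i)" using \<open>i < k\<close> by (intro Ige) auto
            show "I (A i) \<le> i"
            proof (rule ccontr)
              assume "\<not> I (A i) \<le> i"
              then have "A (Suc i) \<le> A (I (A i))" by (intro Amono) auto
              also have "\<dots> \<le> A i" using I Anonneg by blast
              finally have "?d i \<le> 0" using AS by simp
              then show False using False zero_le_dist[of "p i" "p (Suc i)"] by linarith
            qed
          qed
          ultimately show ?thesis by (intro exI[of _ "A i"]) (simp add: \<sigma>_def)
        qed
        then have "m \<le> \<psi> (p i)" using m by metis
        then show ?thesis by (intro mult_right_mono) auto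
      qed simp
      have "dist (\<sigma> a) (\<sigma> b) \<le> (\<Sum>i\<in>{I a..<I b}. ?d i)"
      proof -
        have "A (I b) - A (I a) = (\<Sum>i\<in>{I a..<I b}. ?d i)"
          unfolding A_def using Imono[OF ab]
          by (rule sum_lessThan_diff)
        then show ?thesis using dA[OF Imono[OF ab]] by (simp add: \<sigma>_def)
      qed
      then have "m * dist (\<sigma> a) (\<sigma> b) \<le> m * (\<Sum>i\<in>{I a..<I b}. ?d i)" using True by (rule mult_left_mono)
      also have "\<dots> = (\<Sum>i\<in>{I a..<I b}. m * ?d i)" by (rule sum_distrib_left)
      also have "\<dots> \<le> w b - w a" unfolding eq by (intro sum_mono trm)
      finally show ?thesis .
    qed
  qed
qed

text \<open>The step curves are discontinuous, so Tychonoff's theorem takes the place of an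
  equicontinuity argument. The product topology gives closeness on finite parameter sets, which
  suffices for partition sums.\<close>

lemma pointwise_cluster_point:
  fixes \<sigma> :: "nat \<Rightarrow> 'b \<Rightarrow> 'a::metric_space"
  assumes "compact K" "\<And>n t. \<sigma> n t \<in> K"
  obtains \<gamma> where "\<And>T \<epsilon> n0. finite T \<Longrightarrow> \<epsilon> > 0 \<Longrightarrow> \<exists>n\<ge>n0. \<forall>t\<in>T. dist (\<sigma> n t) (\<gamma> t) < \<epsilon>"
proof -
  have "compactin (product_topology (\<lambda>_::'b. euclidean :: 'a topology) UNIV) (PiE UNIV (\<lambda>_. K))"
    unfolding compactin_PiE using assms(1) by (simp add: compactin_euclidean_iff)
  then have "compact (PiE UNIV (\<lambda>_::'b. K))"
    by (simp add: euclidean_product_topology compactin_euclidean_iff)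
  moreover have "filtermap \<sigma> sequentially \<noteq> bot" by (simp add: filtermap_bot_iff)
  moreover have "eventually (\<lambda>f. f \<in> PiE UNIV (\<lambda>_. K)) (filtermap \<sigma> sequentially)"
    using assms(2) by (simp add: eventually_filtermap PiE_iff extensional_def)
  ultimately obtain \<gamma> where \<gamma>: "inf (nhds \<gamma>) (filtermap \<sigma> sequentially) \<noteq> bot"
    unfolding compact_filter by blast
  show ?thesis
  proof (rule that)
    fix T :: "'b set" and \<epsilon> :: real and n0 :: nat assume T: "finite T" "\<epsilon> > 0"
    let ?W = "{f. \<forall>t\<in>T. dist (f t) (\<gamma> t) < \<epsilon>}"
    have "?W = (\<Inter>t\<in>T. {f. dist (f t) (\<gamma> t) < \<epsilon>})" by auto
    moreover have "open {f. dist (f t) (\<gamma> t) < \<epsilon>}" for t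
      by (intro open_Collect_less continuous_intros continuous_on_product_coordinates)
    ultimately have "open ?W" using T by (simp add: open_INT)
    then have 1: "eventually (\<lambda>f. f \<in> ?W) (nhds \<gamma>)"
      using T by (intro eventually_nhds_in_open) auto
    show "\<exists>n\<ge>n0. \<forall>t\<in>T. dist (\<sigma> n t) (\<gamma> t) < \<epsilon>"
    proof (rule ccontr)
      assume "\<not> (\<exists>n\<ge>n0. \<forall>t\<in>T. dist (\<sigma> n t) (\<gamma> t) < \<epsilon>)"
      then have "eventually (\<lambda>f. f \<notin> ?W) (filtermap \<sigma> sequentially)"
        unfolding eventually_filtermap eventually_sequentially by auto
      with 1 have "eventually (\<lambda>f. False) (inf (nhds \<gamma>) (filtermap \<sigma> sequentially))"
        unfolding eventually_inf by blast
      then show False using \<gamma> by (simp add: trivial_limit_def)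
    qed
  qed
qed

lemma insort_split:
  "\<exists>as bs. xs = as @ bs \<and> insort b xs = as @ b # bs"
proof (induction xs)
  case (Cons x xs)
  then obtain as bs where "xs = as @ bs \<and> insort b xs = as @ b # bs" by blast
  then show ?case
    by (cases "b \<le> x") (auto intro: exI[of _ "[]"] exI[of _ "x # as"])
qed auto

lemma chain_length_insort: "chain_length \<gamma> xs \<le> chain_length \<gamma> (insort b xs)"
proof -
  obtain as bs where eq: "xs = as @ bs" "insort b xs = as @ b # bs" using insort_split by metis
  have "chain_length \<gamma> (as @ [b]) + chain_length \<gamma> (b # bs) = chain_length \<gamma> (as @ b # bs)"
  proof (induction as)
    case (Cons x as) then show ?case by (cases as) auto
  qed simp
  then show ?thesis using chain_length_append_le[of \<gamma> as bs b] eq by simp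
qed

text \<open>Refining a partition cannot shorten the polygon; partitions appear as finite sets so
  that they can be merged by union.\<close>

lemma chain_length_superset:
  assumes "finite B" "finite A"
  shows "chain_length \<gamma> (sorted_list_of_set A) \<le> chain_length \<gamma> (sorted_list_of_set (A \<union> B))"
  using assms(1)
proof (induction rule: finite_induct)
  case (insert b B)
  show ?case
  proof (cases "b \<in> A \<union> B")
    case True
    then have "A \<union> insert b B = A \<union> B" by auto
    then show ?thesis using insert by simp
  next
    case False
    then have "sorted_list_of_set (A \<union> insert b B) = insort b (sorted_list_of_set (A \<union> B))"
      using insert assms by simp
    then show ?thesis using insert chain_length_insort order_trans by metis
  qed
qed simp

text \<open>In a sorted list equal entries are adjacent and are joined by links of length
  zero.\<close>

lemma chain_length_le_sorted_list_of_set: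
  "sorted ts \<Longrightarrow> chain_length \<gamma> ts \<le> chain_length \<gamma> (sorted_list_of_set (set ts))"
proof -
  assume "sorted ts"
  then have "chain_length \<gamma> ts = chain_length \<gamma> (remdups ts)"
  proof (induction ts)
    case (Cons x ts)
    show ?case
    proof (cases "x \<in> set ts")
      case True
      then obtain y ys where ts: "ts = y # ys" by (cases ts) auto
      with Cons.prems True have "x = y" by auto
      then show ?thesis using Cons ts True by auto
    next
      case False
      then have r: "remdups (x # ts) = x # remdups ts" by simp
      show ?thesis
      proof (cases ts)
        case (Cons y ys)
        then have "\<exists>zs. remdups ts = y # zs"
        proof -
          have "sorted (remdups ts)" "set (remdups ts) = set ts" using \<open>sorted (x # ts)\<close> by auto
          moreover have "\<forall>z\<in>set ts. y \<le> z" using \<open>sorted (x # ts)\<close> Cons by auto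
          moreover have "y \<in> set ts" using Cons by simp
          moreover have "remdups ts \<noteq> []" using \<open>y \<in> set ts\<close> by auto
          then obtain a as where "remdups ts = a # as" unfolding neq_Nil_conv by blast
          ultimately have "a = y" by (metis antisym insert_iff list.simps(15) sorted_simps(2))
          then show ?thesis using \<open>remdups ts = a # as\<close> by blast
        qed
        then obtain zs where zs: "remdups ts = y # zs" by blast
        have "chain_length \<gamma> ts = chain_length \<gamma> (remdups ts)" using Cons.IH \<open>sorted (x # ts)\<close> by simp
        then show ?thesis using r Cons zs by simp
      qed simp
    qed
  qed simp
  moreover have "remdups ts = sorted_list_of_set (set ts)"
    using \<open>sorted ts\<close> by (intro sorted_distinct_set_unique) auto
  ultimately show ?thesis by simp
qed

text \<open>The step curves satisfy a 1-Lipschitz bound up to the step size, so a cluster point is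
  1-Lipschitz. For fixed \<open>m\<close> the weight \<open>\<psi> m\<close> lies below all later
  ones and, on a partition interval, drops below its initial value by at most \<open>C m\<close>
  times the interval length plus step size. This gives the corrected partition sums, which survive
  the limit because they involve finitely many parameters.\<close>

lemma chain_limit_curve:
  fixes u :: "'a::metric_space \<Rightarrow> real" and \<psi> :: "nat \<Rightarrow> 'a \<Rightarrow> real"
  assumes cpt: "\<And>x R. compact (cball (x::'a) R)"
    and u: "continuous_on UNIV u"
    and \<psi>: "\<And>n x. 0 \<le> \<psi> n x" "\<And>m n x. m \<le> n \<Longrightarrow> \<psi> m x \<le> \<psi> n x"
    and C: "\<And>m. (C m)-lipschitz_on UNIV (\<psi> m)"
    and L: "0 \<le> L"
    and chains: "\<And>n. \<exists>p k. p k = x \<and> (\<forall>i<k. dist (p i) (p (Suc i)) \<le> 1 / real (Suc n)) \<and>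
        (\<Sum>i<k. dist (p i) (p (Suc i))) \<le> L \<and>
        u (p 0) + (\<Sum>i<k. \<psi> n (p i) * dist (p i) (p (Suc i))) \<le> B"
  obtains \<gamma> where "\<gamma> L = x" "u (\<gamma> 0) \<le> B"
    "\<And>s t. 0 \<le> s \<Longrightarrow> s \<le> t \<Longrightarrow> t \<le> L \<Longrightarrow> dist (\<gamma> s) (\<gamma> t) \<le> t - s"
    "\<And>m ts. sorted ts \<Longrightarrow> set ts \<subseteq> {0..L} \<Longrightarrow>
        u (\<gamma> 0) + (\<Sum>i<length ts - 1. (\<psi> m (\<gamma> (ts ! i)) - C m * (ts ! Suc i - ts ! i)) *
           dist (\<gamma> (ts ! i)) (\<gamma> (ts ! Suc i))) \<le> B"
proof -
  let ?s = "\<lambda>n. 1 / real (Suc n)"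
  have "\<exists>\<sigma> w. \<sigma> L = x \<and> u (\<sigma> 0) + (w L - w 0) \<le> B \<and>
      (\<forall>a b. 0 \<le> a \<longrightarrow> a \<le> b \<longrightarrow> dist (\<sigma> a) (\<sigma> b) \<le> b - a + ?s n) \<and>
      (\<forall>a b m. 0 \<le> a \<longrightarrow> a \<le> b \<longrightarrow> (\<forall>r. a \<le> r \<longrightarrow> r \<le> b \<longrightarrow> m \<le> \<psi> n (\<sigma> r)) \<longrightarrow>
        m * dist (\<sigma> a) (\<sigma> b) \<le> w b - w a)" for n :: nat
  proof -
    obtain p k where pk: "p k = x" "\<And>i. i < k \<Longrightarrow> dist (p i) (p (Suc i)) \<le> ?s n"
      "(\<Sum>i<k. dist (p i) (p (Suc i))) \<le> L"
      "u (p 0) + (\<Sum>i<k. \<psi> n (p i) * dist (p i) (p (Suc i))) \<le> B" using chains[of n] by blast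
    obtain \<sigma> w where "\<sigma> 0 = p 0" "\<sigma> L = p k" "0 \<le> w 0"
      "w L = (\<Sum>i<k. \<psi> n (p i) * dist (p i) (p (Suc i)))"
      "\<And>a b. 0 \<le> a \<Longrightarrow> a \<le> b \<Longrightarrow> dist (\<sigma> a) (\<sigma> b) \<le> b - a + ?s n"
      "\<And>a b m. 0 \<le> a \<Longrightarrow> a \<le> b \<Longrightarrow> (\<And>r. a \<le> r \<Longrightarrow> r \<le> b \<Longrightarrow> m \<le> \<psi> n (\<sigma> r)) \<Longrightarrow>
        m * dist (\<sigma> a) (\<sigma> b) \<le> w b - w a"
      by (rule chain_parametrisation[of k p "?s n" "\<psi> n" L]) (use pk \<psi> in auto)
    then show ?thesis using pk(1,4) by (intro exI[of _ \<sigma>] exI[of _ w]) auto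
  qed
  then obtain \<sigma> w where \<sigma>: "\<And>n. \<sigma> n L = x" "\<And>n. u (\<sigma> n 0) + (w n L - w n 0) \<le> B"
    "\<And>n a b. 0 \<le> a \<Longrightarrow> a \<le> b \<Longrightarrow> dist (\<sigma> n a) (\<sigma> n b) \<le> b - a + ?s n"
    "\<And>n a b m. 0 \<le> a \<Longrightarrow> a \<le> b \<Longrightarrow> (\<And>r. a \<le> r \<Longrightarrow> r \<le> b \<Longrightarrow> m \<le> \<psi> n (\<sigma> n r)) \<Longrightarrow>
        m * dist (\<sigma> n a) (\<sigma> n b) \<le> w n b - w n a"
    by metis
  have wmono: "w n a \<le> w n b" if "0 \<le> a" "a \<le> b" for n a b
    using \<sigma>(4)[OF that, of 0 n] \<psi>(1) by simp
  \<comment> \<open>Outside \<open>[0, L]\<close> the values are frozen, so that all values lie in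
    one compact ball.\<close>
  define \<sigma>' where "\<sigma>' n t = (if 0 \<le> t \<and> t \<le> L then \<sigma> n t else x)" for n t
  have "\<sigma>' n t \<in> cball x (L + 1)" for n t
  proof (cases "0 \<le> t \<and> t \<le> L")
    case True
    then have "dist (\<sigma> n t) (\<sigma> n L) \<le> L - t + ?s n" by (intro \<sigma>(3)) auto
    also have "?s n \<le> 1" by simp
    finally show ?thesis using True \<sigma>(1) by (simp add: \<sigma>'_def dist_commute)
  qed (use L in \<open>auto simp: \<sigma>'_def\<close>)
  with cpt obtain \<gamma> where
    \<gamma>: "\<And>T \<epsilon> n0. finite T \<Longrightarrow> \<epsilon> > 0 \<Longrightarrow> \<exists>n\<ge>n0. \<forall>t\<in>T. dist (\<sigma>' n t) (\<gamma> t) < \<epsilon>"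
    using pointwise_cluster_point[of "cball x (L + 1)" \<sigma>'] by blast
  \<comment> \<open>The subsequence depends on the finite set \<open>T\<close>; a common one is
    never extracted.\<close>
  have subseq: "\<exists>\<nu>. (\<forall>j. m \<le> \<nu> j \<and> j \<le> \<nu> j) \<and> (\<forall>t\<in>T. (\<lambda>j. \<sigma> (\<nu> j) t) \<longlonglongrightarrow> \<gamma> t)"
    if T: "finite T" "T \<subseteq> {0..L}" for T and m :: nat
  proof -
    have "\<exists>n. max m j \<le> n \<and> (\<forall>t\<in>T. dist (\<sigma>' n t) (\<gamma> t) < ?s j)" for j
      using \<gamma>[OF T(1), of "?s j" "max m j"] by auto
    then obtain \<nu> where \<nu>: "\<And>j. max m j \<le> \<nu> j" "\<And>j t. t \<in> T \<Longrightarrow> dist (\<sigma>' (\<nu> j) t) (\<gamma> t) < ?s j"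
      by metis
    have "(\<lambda>j. \<sigma> (\<nu> j) t) \<longlonglongrightarrow> \<gamma> t" if t: "t \<in> T" for t
    proof (rule metric_LIMSEQ_I)
      fix r :: real assume "r > 0"
      then obtain N where N: "inverse (real (Suc N)) < r" using reals_Archimedean by blast
      have "dist (\<sigma> (\<nu> j) t) (\<gamma> t) < r" if "j \<ge> N" for j
      proof -
        have "\<sigma>' (\<nu> j) t = \<sigma> (\<nu> j) t" using t T by (auto simp: \<sigma>'_def)
        then have "dist (\<sigma> (\<nu> j) t) (\<gamma> t) < ?s j" using \<nu>(2)[OF t, of j] by simp
        also have "?s j \<le> inverse (real (Suc N))" using that by (simp add: field_simps)
        finally show ?thesis using N by simp
      qed
      then show "\<exists>no. \<forall>n\<ge>no. dist (\<sigma> (\<nu> n) t) (\<gamma> t) < r" by blast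
    qed
    then show ?thesis using \<nu>(1) by (intro exI[of _ \<nu>]) auto
  qed
  have s0: "(\<lambda>j. ?s (\<nu> j)) \<longlonglongrightarrow> 0" if "\<And>j. j \<le> \<nu> j" for \<nu> :: "nat \<Rightarrow> nat"
  proof (rule tendsto_sandwich[of "\<lambda>_. 0" _ _ "\<lambda>j. 1 / real (Suc j)"])
    show "(\<lambda>j. 1 / real (Suc j)) \<longlonglongrightarrow> 0" using LIMSEQ_inverse_real_of_nat by (simp add: inverse_eq_divide)
    show "\<forall>\<^sub>F j in sequentially. ?s (\<nu> j) \<le> 1 / real (Suc j)"
      using that by (intro always_eventually allI divide_left_mono) auto
  qed auto
  show ?thesis
  proof (rule that[of \<gamma>])
    obtain \<nu> where \<nu>: "\<forall>j. 0 \<le> \<nu> j \<and> j \<le> \<nu> j" "\<forall>t\<in>{0,L}. (\<lambda>j. \<sigma> (\<nu> j) t) \<longlonglongrightarrow> \<gamma> t"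
      using subseq[of "{0, L}" 0] L by auto
    then have "(\<lambda>j. x) \<longlonglongrightarrow> \<gamma> L" using \<sigma>(1) by simp
    then show "\<gamma> L = x" using LIMSEQ_unique tendsto_const by blast
    fix s t assume st: "0 \<le> s" "s \<le> t" "t \<le> L"
    obtain \<nu> where \<nu>: "\<forall>j. 0 \<le> \<nu> j \<and> j \<le> \<nu> j" "\<forall>a\<in>{s,t}. (\<lambda>j. \<sigma> (\<nu> j) a) \<longlonglongrightarrow> \<gamma> a"
      using subseq[of "{s, t}" 0] st by auto
    show "dist (\<gamma> s) (\<gamma> t) \<le> t - s"
    proof (rule LIMSEQ_le)
      show "(\<lambda>j. dist (\<sigma> (\<nu> j) s) (\<sigma> (\<nu> j) t)) \<longlonglongrightarrow> dist (\<gamma> s) (\<gamma> t)"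
        using \<nu> by (intro tendsto_dist) auto
      have "(\<lambda>j. t - s + ?s (\<nu> j)) \<longlonglongrightarrow> t - s + 0"
        using \<nu> by (intro tendsto_add tendsto_const s0) auto
      then show "(\<lambda>j. t - s + ?s (\<nu> j)) \<longlonglongrightarrow> t - s" by simp
      show "\<exists>N. \<forall>n\<ge>N. dist (\<sigma> (\<nu> n) s) (\<sigma> (\<nu> n) t) \<le> t - s + ?s (\<nu> n)"
        using \<sigma>(3)[OF st(1,2)] by blast
    qed
  next
    have *: "u (\<gamma> 0) + (\<Sum>i<length ts - 1. (\<psi> m (\<gamma> (ts ! i)) - C m * (ts ! Suc i - ts ! i)) *
           dist (\<gamma> (ts ! i)) (\<gamma> (ts ! Suc i))) \<le> B"
      if ts: "sorted ts" "set ts \<subseteq> {0..L}" for m ts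
    proof -
      let ?n = "length ts - 1"
      have T: "finite (insert 0 (set ts))" "insert 0 (set ts) \<subseteq> {0..L}" using ts L by auto
      obtain \<nu> where \<nu>: "\<And>j. m \<le> \<nu> j \<and> j \<le> \<nu> j" "\<And>t. t \<in> insert 0 (set ts) \<Longrightarrow> (\<lambda>j. \<sigma> (\<nu> j) t) \<longlonglongrightarrow> \<gamma> t"
        using subseq[OF T, of m] by blast
      have mem: "ts ! i \<in> set ts" "ts ! Suc i \<in> set ts" "0 \<le> ts ! i" "ts ! i \<le> ts ! Suc i" "ts ! Suc i \<le> L"
        if "i < ?n" for i
        using that ts by (auto simp: sorted_nth_mono subset_iff intro!: nth_mem)
      \<comment> \<open>The argument \<open>e\<close> stands for the step size of the approximating
        chain and becomes 0 in the limit.\<close>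
      let ?F = "\<lambda>\<sigma> e. u (\<sigma> 0) + (\<Sum>i<?n. (\<psi> m (\<sigma> (ts ! i)) - C m * (ts ! Suc i - ts ! i + e)) *
           dist (\<sigma> (ts ! i)) (\<sigma> (ts ! Suc i)))"
      have Cn: "0 \<le> C m" using C lipschitz_on_nonneg by blast
      have le: "?F (\<sigma> n) (?s n) \<le> B" if "m \<le> n" for n
      proof -
        have each: "(\<psi> m (\<sigma> n (ts ! i)) - C m * (ts ! Suc i - ts ! i + ?s n)) * dist (\<sigma> n (ts ! i)) (\<sigma> n (ts ! Suc i))
            \<le> w n (ts ! Suc i) - w n (ts ! i)" if i: "i < ?n" for i
        proof (rule \<sigma>(4))
          fix r assume r: "ts ! i \<le> r" "r \<le> ts ! Suc i"
          have "\<bar>\<psi> m (\<sigma> n (ts ! i)) - \<psi> m (\<sigma> n r)\<bar> \<le> C m * dist (\<sigma> n (ts ! i)) (\<sigma> n r)"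
            using lipschitz_onD[OF C, of "\<sigma> n (ts ! i)" "\<sigma> n r"] by (simp add: dist_real_def)
          also have "\<dots> \<le> C m * (ts ! Suc i - ts ! i + ?s n)"
          proof (rule mult_left_mono[OF _ Cn])
            have "dist (\<sigma> n (ts ! i)) (\<sigma> n r) \<le> r - ts ! i + ?s n" using mem[OF i] r by (intro \<sigma>(3)) auto
            then show "dist (\<sigma> n (ts ! i)) (\<sigma> n r) \<le> ts ! Suc i - ts ! i + ?s n" using r by linarith
          qed
          finally have "\<psi> m (\<sigma> n (ts ! i)) - C m * (ts ! Suc i - ts ! i + ?s n) \<le> \<psi> m (\<sigma> n r)" by linarith
          also have "\<dots> \<le> \<psi> n (\<sigma> n r)" using \<open>m \<le> n\<close> by (rule \<psi>(2))
          finally show "\<psi> m (\<sigma> n (ts ! i)) - C m * (ts ! Suc i - ts ! i + ?s n) \<le> \<psi> n (\<sigma> n r)" .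
        qed (use mem[OF i] in auto)
        have "(\<Sum>i<?n. (\<psi> m (\<sigma> n (ts ! i)) - C m * (ts ! Suc i - ts ! i + ?s n)) * dist (\<sigma> n (ts ! i)) (\<sigma> n (ts ! Suc i)))
            \<le> (\<Sum>i<?n. w n (ts ! Suc i) - w n (ts ! i))"
          by (intro sum_mono each) auto
        also have "\<dots> = w n (ts ! ?n) - w n (ts ! 0)" by (rule sum_lessThan_telescope)
        also have "\<dots> \<le> w n L - w n 0"
        proof (cases "ts = []")
          case True then show ?thesis using wmono[of 0 L n] L by simp
        next
          case False
          then have "ts ! ?n \<in> set ts" "ts ! 0 \<in> set ts" by auto
          then have "0 \<le> ts ! 0" "0 \<le> ts ! ?n" "ts ! ?n \<le> L" using ts by auto
          then show ?thesis using wmono[of "ts ! ?n" L n] wmono[of 0 "ts ! 0" n] by simp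
        qed
        finally show ?thesis using \<sigma>(2)[of n] by linarith
      qed
      have "(\<lambda>j. ?F (\<sigma> (\<nu> j)) (?s (\<nu> j))) \<longlonglongrightarrow> ?F \<gamma> 0"
      proof (intro tendsto_add tendsto_sum tendsto_mult tendsto_diff tendsto_dist tendsto_const)
        show "(\<lambda>j. u (\<sigma> (\<nu> j) 0)) \<longlonglongrightarrow> u (\<gamma> 0)"
          using continuous_on_tendsto_compose[OF u \<nu>(2)] by simp
        fix i assume "i \<in> {..<?n}"
        then have i: "i < ?n" by simp
        show "(\<lambda>j. \<sigma> (\<nu> j) (ts ! i)) \<longlonglongrightarrow> \<gamma> (ts ! i)" "(\<lambda>j. \<sigma> (\<nu> j) (ts ! Suc i)) \<longlonglongrightarrow> \<gamma> (ts ! Suc i)"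
          using mem[OF i] \<nu>(2) by auto
        show "(\<lambda>j. \<psi> m (\<sigma> (\<nu> j) (ts ! i))) \<longlonglongrightarrow> \<psi> m (\<gamma> (ts ! i))"
          using continuous_on_tendsto_compose[OF lipschitz_on_continuous_on[OF C] \<nu>(2)] mem[OF i] by auto
        show "(\<lambda>j. ?s (\<nu> j)) \<longlonglongrightarrow> 0" using \<nu>(1) by (intro s0) auto
      qed
      moreover have "?F (\<sigma> (\<nu> j)) (?s (\<nu> j)) \<le> B" for j using \<nu>(1) by (intro le) auto
      ultimately have "?F \<gamma> 0 \<le> B" by (intro LIMSEQ_le_const2) auto
      then show ?thesis by simp
    qed
    then show "u (\<gamma> 0) + (\<Sum>i<length ts - 1. (\<psi> m (\<gamma> (ts ! i)) - C m * (ts ! Suc i - ts ! i)) *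
           dist (\<gamma> (ts ! i)) (\<gamma> (ts ! Suc i))) \<le> B" if "sorted ts" "set ts \<subseteq> {0..L}" for m ts
      using that .
    show "u (\<gamma> 0) \<le> B" using *[of "[]" 0] by simp
  qed
qed

text \<open>A uniform grid with spacing \<open>L / real K\<close> is merged into \<open>S\<close>:
  the grid bounds the mesh, and refinement loses no polygonal length.\<close>

lemma fine_partition:
  fixes \<gamma> :: "real \<Rightarrow> 'a::metric_space"
  assumes "0 < L" "0 < h" "finite S" "S \<subseteq> {0..L}"
  obtains ts where "sorted ts" "S \<subseteq> set ts" "set ts \<subseteq> {0..L}" "ts \<noteq> []" "hd ts = 0" "last ts = L"
    "\<And>i. i < length ts - 1 \<Longrightarrow> ts ! Suc i - ts ! i \<le> h"
    "chain_length \<gamma> (sorted_list_of_set S) \<le> chain_length \<gamma> ts"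
proof -
  obtain K :: nat where K: "L / h < real K" using reals_Archimedean2 by blast
  have "0 < L / h" using assms by simp
  then have "0 < real K" using K by linarith
  have Kh: "L / real K \<le> h" using K \<open>0 < real K\<close> assms by (simp add: field_simps)
  define G where "G = (\<lambda>i. real i * L / real K) ` {..K}"
  have G: "finite G" "G \<subseteq> {0..L}"
    using \<open>0 < real K\<close> assms by (auto simp: G_def field_simps)
  have "0 \<in> G" unfolding G_def by (rule image_eqI[of _ _ 0]) auto
  have "L \<in> G" unfolding G_def by (rule image_eqI[of _ _ K]) (use \<open>0 < real K\<close> in auto)
  define ts where "ts = sorted_list_of_set (S \<union> G)"
  have set: "set ts = S \<union> G" using G assms by (simp add: ts_def)
  have so: "sorted ts" by (simp add: ts_def)
  have ne: "ts \<noteq> []" using set \<open>0 \<in> G\<close> by auto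
  have sub: "set ts \<subseteq> {0..L}" using set G assms by auto
  show ?thesis
  proof (rule that[of ts])
    show "hd ts = 0"
    proof (rule antisym)
      have "0 \<in> set ts" using set \<open>0 \<in> G\<close> by simp
      then show "hd ts \<le> 0" using so by (cases ts) auto
      have "hd ts \<in> {0..L}" using sub hd_in_set[OF ne] by blast
      then show "0 \<le> hd ts" by simp
    qed
    show "last ts = L"
    proof (rule antisym)
      have "last ts \<in> {0..L}" using sub last_in_set[OF ne] by blast
      then show "last ts \<le> L" by simp
      have "L \<in> set ts" using set \<open>L \<in> G\<close> by simp
      then obtain k where "k < length ts" "ts ! k = L" by (auto simp: in_set_conv_nth)
      then show "L \<le> last ts" using so ne sorted_nth_mono[of ts k "length ts - 1"] by (auto simp: last_conv_nth)
    qed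
    show "chain_length \<gamma> (sorted_list_of_set S) \<le> chain_length \<gamma> ts"
      unfolding ts_def by (rule chain_length_superset) (use G assms in auto)
    fix i assume i: "i < length ts - 1"
    show "ts ! Suc i - ts ! i \<le> h"
    proof (cases "ts ! i < L")
      case False
      have "ts ! Suc i \<in> set ts" using i by (intro nth_mem) simp
      then have "ts ! Suc i \<le> L" "ts ! i \<ge> L" using sub False by auto
      then show ?thesis using assms by simp
    next
      case True
      have "ts ! i \<in> set ts" using i by (intro nth_mem) simp
      then have ti: "0 \<le> ts ! i" using sub by auto
      \<comment> \<open>The index of the first grid point strictly after \<open>ts ! i\<close>; the
        next partition point comes no later.\<close>
      define j where "j = nat \<lfloor>ts ! i * real K / L\<rfloor> + 1"
      have f: "0 \<le> ts ! i * real K / L" using ti assms by simp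
      have j1: "ts ! i * real K / L < real j" "real j \<le> ts ! i * real K / L + 1"
        using f unfolding j_def by linarith+
      have "ts ! i * real K / L < real K" using True \<open>0 < real K\<close> assms by (simp add: field_simps)
      then have "j \<le> K" using f unfolding j_def by linarith
      then have q: "real j * L / real K \<in> set ts" unfolding set G_def by auto
      have q1: "ts ! i < real j * L / real K" using j1(1) \<open>0 < real K\<close> assms by (simp add: field_simps)
      have "real j * L / real K \<le> (ts ! i * real K / L + 1) * L / real K"
        using j1(2) \<open>0 < real K\<close> assms by (intro divide_right_mono mult_right_mono) auto
      also have "\<dots> = ts ! i + L / real K" using \<open>0 < real K\<close> assms by (simp add: field_simps)
      finally have q2: "real j * L / real K \<le> ts ! i + h" using Kh by linarith
      obtain k where k: "k < length ts" "ts ! k = real j * L / real K" using q by (auto simp: in_set_conv_nth)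
      have "i < length ts" using i by simp
      then have "\<not> k \<le> i" using sorted_nth_mono[OF so, of k i] q1 k by auto
      then have "ts ! Suc i \<le> ts ! k" using so k by (intro sorted_nth_mono) auto
      then show ?thesis using q2 k by linarith
    qed
  qed (use so set sub ne in auto)
qed

lemma chain_length_conv_sum:
  "chain_length \<gamma> ts = (\<Sum>i<length ts - 1. dist (\<gamma> (ts ! i)) (\<gamma> (ts ! Suc i)))"
proof -
  have "ennreal (chain_length \<gamma> ts) = ennreal (\<Sum>i<length ts - 1. dist (\<gamma> (ts ! i)) (\<gamma> (ts ! Suc i)))"
    unfolding sum_dist_eq_chain_length[symmetric] by (simp add: sum_ennreal)
  then show ?thesis by (subst (asm) ennreal_inj) (auto intro: sum_nonneg)
qed

text \<open>A Riemann sum in arc length is compared with partition sums in chord length. Chords that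
  miss at most \<open>\<epsilon>\<close> of the total length cost \<open>Bd * \<epsilon>\<close>; a
  mesh of at most \<open>h\<close> costs \<open>C * h * R\<close> twice, once for the variation of
  the weight on a piece and once for the correction in the hypothesis.\<close>

lemma arc_length_integral_le:
  fixes \<gamma> :: "real \<Rightarrow> 'a::metric_space" and \<psi> :: "'a \<Rightarrow> real" and al \<tau> :: "real \<Rightarrow> real"
  assumes L: "0 < L"
    and al0: "al 0 = 0"
    and len: "\<And>s t. 0 \<le> s \<Longrightarrow> s \<le> t \<Longrightarrow> t \<le> L \<Longrightarrow> curve_length \<gamma> s t = ennreal (al t - al s)"
    and mono: "\<And>s t. 0 \<le> s \<Longrightarrow> s \<le> t \<Longrightarrow> t \<le> L \<Longrightarrow> al s \<le> al t"
    and lip: "\<And>s t. 0 \<le> s \<Longrightarrow> s \<le> t \<Longrightarrow> t \<le> L \<Longrightarrow> al t - al s \<le> t - s"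
    and \<tau>: "\<And>r. 0 \<le> r \<Longrightarrow> r \<le> al L \<Longrightarrow> 0 \<le> \<tau> r \<and> \<tau> r \<le> L \<and> al (\<tau> r) = r"
    and \<psi>: "\<And>x. 0 \<le> \<psi> x" "\<And>x. \<psi> x \<le> Bd" "C-lipschitz_on UNIV \<psi>"
    and A: "0 \<le> A"
    and chains: "\<And>ts. sorted ts \<Longrightarrow> set ts \<subseteq> {0..L} \<Longrightarrow>
        (\<Sum>i<length ts - 1. (\<psi> (\<gamma> (ts ! i)) - C * (ts ! Suc i - ts ! i)) *
           dist (\<gamma> (ts ! i)) (\<gamma> (ts ! Suc i))) \<le> A"
  shows "(\<integral>\<^sup>+r\<in>{0..al L}. ennreal (\<psi> (\<gamma> (\<tau> r))) \<partial>lborel) \<le> ennreal A"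
proof (rule ennreal_le_epsilon)
  fix e :: real assume "e > 0"
  define R where "R = al L"
  have R: "0 \<le> R" using mono[of 0 L] al0 L by (simp add: R_def)
  have Cn: "0 \<le> C" using \<psi>(3) by (rule lipschitz_on_nonneg)
  have Bn: "0 \<le> Bd" using \<psi>(1,2) order_trans by blast
  \<comment> \<open>Each of the two kinds of error gets half of \<open>e\<close>; the summands 1
    guard against vanishing \<open>Bd\<close> and \<open>C * R\<close>.\<close>
  define \<epsilon> where "\<epsilon> = e / (2 * (Bd + 1))"
  define h where "h = e / (4 * (C * R + 1))"
  have eh: "\<epsilon> > 0" "Bd * \<epsilon> \<le> e / 2" "h > 0" "2 * C * h * R \<le> e / 2"
  proof -
    have CR: "0 \<le> C * R" using Cn R by simp
    show "\<epsilon> > 0" "h > 0" using \<open>e > 0\<close> Bn CR by (auto simp: \<epsilon>_def h_def)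
    have "Bd * \<epsilon> = (Bd / (Bd + 1)) * (e / 2)" by (simp add: \<epsilon>_def)
    also have "\<dots> \<le> 1 * (e / 2)" using Bn \<open>e > 0\<close> by (intro mult_right_mono) auto
    finally show "Bd * \<epsilon> \<le> e / 2" by simp
    have "h * (4 * (C * R + 1)) = e" using CR by (simp add: h_def)
    then have "4 * (C * h * R) + 4 * h = e" by (simp add: algebra_simps)
    then show "2 * C * h * R \<le> e / 2" using \<open>h > 0\<close> by simp
  qed
  have dal: "dist (\<gamma> s) (\<gamma> t) \<le> al t - al s" if "0 \<le> s" "s \<le> t" "t \<le> L" for s t
    using dist_le_curve_length[of s t \<gamma>] len[OF that] mono[OF that] that by (simp add: ennreal_le_iff)
  \<comment> \<open>Otherwise the supremum defining the length would be at most
    \<open>R - \<epsilon>\<close>. The empty chain, of length 0, shows that this number would be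
    positive, so \<open>ennreal\<close> does not truncate it.\<close>
  have "\<exists>ts. sorted ts \<and> set ts \<subseteq> {0..L} \<and> R - \<epsilon> \<le> chain_length \<gamma> ts"
  proof (rule ccontr)
    assume a: "\<not> ?thesis"
    have "\<not> R - \<epsilon> \<le> chain_length \<gamma> []" using a by (metis empty_set empty_subsetI sorted_simps(1))
    then have "R - \<epsilon> > 0" by simp
    have "curve_length \<gamma> 0 L \<le> ennreal (R - \<epsilon>)"
    proof (rule curve_length_leI, rule ennreal_leI)
      fix ts assume "sorted ts" "set ts \<subseteq> {0..L}"
      then have "\<not> R - \<epsilon> \<le> chain_length \<gamma> ts" using a by blast
      then show "chain_length \<gamma> ts \<le> R - \<epsilon>" by simp
    qed
    then have "R \<le> R - \<epsilon>" using len[of 0 L] L al0 \<open>R - \<epsilon> > 0\<close> by (simp add: R_def ennreal_le_iff)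
    then show False using eh by simp
  qed
  then obtain us where us: "sorted us" "set us \<subseteq> {0..L}" "R - \<epsilon> \<le> chain_length \<gamma> us" by blast
  obtain ts where ts: "sorted ts" "set ts \<subseteq> {0..L}" "ts \<noteq> []" "hd ts = 0" "last ts = L"
    "\<And>i. i < length ts - 1 \<Longrightarrow> ts ! Suc i - ts ! i \<le> h"
    "chain_length \<gamma> (sorted_list_of_set (set us)) \<le> chain_length \<gamma> ts"
    by (rule fine_partition[OF L eh(3) finite_set us(2), of \<gamma>]) (rule that)
  let ?n = "length ts - 1"
  define d where "d i = dist (\<gamma> (ts ! i)) (\<gamma> (ts ! Suc i))" for i
  define v where "v i = al (ts ! Suc i) - al (ts ! i)" for i
  have mem: "0 \<le> ts ! i" "ts ! i \<le> ts ! Suc i" "ts ! Suc i \<le> L" if "i < ?n" for i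
  proof -
    have "ts ! i \<in> set ts" "ts ! Suc i \<in> set ts" using that by (auto intro!: nth_mem)
    then have "ts ! i \<in> {0..L}" "ts ! Suc i \<in> {0..L}" using ts(2) by blast+
    then show "0 \<le> ts ! i" "ts ! Suc i \<le> L" by auto
    show "ts ! i \<le> ts ! Suc i" using that ts(1) by (intro sorted_nth_mono) auto
  qed
  have first: "ts ! 0 = 0" and last: "ts ! ?n = L" using ts(3,4,5) by (auto simp: hd_conv_nth last_conv_nth)
  have dv: "d i \<le> v i" "0 \<le> d i" "v i \<le> h" if "i < ?n" for i
    using dal[OF mem[OF that]] lip[OF mem[OF that]] ts(6)[OF that] by (auto simp: d_def v_def)
  have sumv: "(\<Sum>i<?n. v i) = R"
    using sum_lessThan_telescope[of "\<lambda>i. al (ts ! i)" ?n] first last al0 by (simp add: R_def v_def)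
  have "chain_length \<gamma> ts = (\<Sum>i<?n. d i)" by (simp only: chain_length_conv_sum d_def)
  then have sumd: "R - \<epsilon> \<le> (\<Sum>i<?n. d i)"
    using us(3) chain_length_le_sorted_list_of_set[OF us(1), of \<gamma>] ts(7) by linarith
  \<comment> \<open>Bounds \<open>\<psi>\<close> on the whole \<open>i\<close>-th piece of the
    curve: the arc-length increment there is at most \<open>h\<close>, and \<open>\<psi>\<close> is
    \<open>C\<close>-Lipschitz.\<close>
  define q where "q i = \<psi> (\<gamma> (ts ! i)) + C * h" for i
  have q0: "0 \<le> q i" for i using \<psi>(1) Cn eh by (simp add: q_def)
  have point: "ennreal (\<psi> (\<gamma> (\<tau> r))) * indicator {0..R} r
      \<le> (\<Sum>i<?n. ennreal (q i) * indicator {al (ts ! i)..al (ts ! Suc i)} r)" if "R > 0" for r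
  proof (cases "r \<in> {0..R}")
    case True
    have "\<exists>i<?n. al (ts ! i) \<le> r \<and> r \<le> al (ts ! Suc i)"
    proof -
      \<comment> \<open>Induction on \<open>k\<close> finds a piece whose arc-length interval
        contains \<open>r\<close>.\<close>
      have "k \<le> ?n \<Longrightarrow> r \<le> al (ts ! k) \<Longrightarrow> 0 < k \<Longrightarrow> \<exists>i<k. al (ts ! i) \<le> r \<and> r \<le> al (ts ! Suc i)" for k
      proof (induction k)
        case (Suc k)
        show ?case
        proof (cases "r < al (ts ! k) \<and> 0 < k")
          case True
          then obtain i where "i < k" "al (ts ! i) \<le> r" "r \<le> al (ts ! Suc i)" using Suc by auto
          then show ?thesis by (intro exI[of _ i]) auto
        next
          case False
          then have "al (ts ! k) \<le> r" using True first al0 by (cases "k = 0") auto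
          then show ?thesis using Suc by blast
        qed
      qed simp
      moreover have "0 < ?n"
      proof (rule ccontr)
        assume "\<not> 0 < ?n"
        then have "ts ! 0 = L" using last by simp
        then show False using first L by simp
      qed
      ultimately show ?thesis using True last by (simp add: R_def)
    qed
    then obtain i where i: "i < ?n" "al (ts ! i) \<le> r" "r \<le> al (ts ! Suc i)" by blast
    have \<tau>r: "0 \<le> \<tau> r" "\<tau> r \<le> L" "al (\<tau> r) = r" using \<tau>[of r] True by (auto simp: R_def)
    have "dist (\<gamma> (ts ! i)) (\<gamma> (\<tau> r)) \<le> \<bar>r - al (ts ! i)\<bar>"
      using dal[of "ts ! i" "\<tau> r"] dal[of "\<tau> r" "ts ! i"] \<tau>r mem[OF i(1)]
      by (cases "ts ! i \<le> \<tau> r") (auto simp: dist_commute)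
    also have "\<dots> \<le> h" using i dv(3)[OF i(1)] by (simp add: v_def)
    finally have "C * dist (\<gamma> (ts ! i)) (\<gamma> (\<tau> r)) \<le> C * h" using Cn by (rule mult_left_mono)
    then have "\<psi> (\<gamma> (\<tau> r)) \<le> q i"
      using lipschitz_onD[OF \<psi>(3), of "\<gamma> (ts ! i)" "\<gamma> (\<tau> r)"] by (simp add: q_def dist_real_def)
    then have "ennreal (\<psi> (\<gamma> (\<tau> r))) * indicator {0..R} r \<le> ennreal (q i) * indicator {al (ts ! i)..al (ts ! Suc i)} r"
      using i True by (simp add: ennreal_leI)
    also have "\<dots> \<le> (\<Sum>i<?n. ennreal (q i) * indicator {al (ts ! i)..al (ts ! Suc i)} r)"
      using i(1) by (intro member_le_sum) auto
    finally show ?thesis .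
  qed simp
  have sumq: "(\<Sum>i<?n. q i * v i) \<le> A + e"
  proof -
    have each: "q i * v i \<le> (\<psi> (\<gamma> (ts ! i)) - C * (ts ! Suc i - ts ! i)) * d i + Bd * (v i - d i) + 2 * C * h * v i"
      if i: "i < ?n" for i
    proof -
      have "C * (ts ! Suc i - ts ! i) * d i \<le> C * h * d i"
        using ts(6)[OF i] Cn dv(2)[OF i] by (intro mult_right_mono mult_left_mono) auto
      also have "\<dots> \<le> C * h * v i" using dv[OF i] Cn eh(3) by (intro mult_left_mono) auto
      finally have 1: "C * (ts ! Suc i - ts ! i) * d i \<le> C * h * v i" .
      have 2: "\<psi> (\<gamma> (ts ! i)) * (v i - d i) \<le> Bd * (v i - d i)"
        using \<psi>(2) dv[OF i] by (intro mult_right_mono) auto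
      have "q i * v i = \<psi> (\<gamma> (ts ! i)) * d i + \<psi> (\<gamma> (ts ! i)) * (v i - d i) + C * h * v i"
        by (simp add: q_def algebra_simps)
      also have "\<dots> \<le> \<psi> (\<gamma> (ts ! i)) * d i + Bd * (v i - d i) + C * h * v i
          + (C * h * v i - C * (ts ! Suc i - ts ! i) * d i)" using 1 2 by linarith
      also have "\<dots> = (\<psi> (\<gamma> (ts ! i)) - C * (ts ! Suc i - ts ! i)) * d i + Bd * (v i - d i) + 2 * C * h * v i"
        by (simp add: algebra_simps)
      finally show ?thesis .
    qed
    have "(\<Sum>i<?n. q i * v i) \<le> (\<Sum>i<?n. (\<psi> (\<gamma> (ts ! i)) - C * (ts ! Suc i - ts ! i)) * d i
        + Bd * (v i - d i) + 2 * C * h * v i)"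
      by (intro sum_mono each) auto
    also have "\<dots> = (\<Sum>i<?n. (\<psi> (\<gamma> (ts ! i)) - C * (ts ! Suc i - ts ! i)) * d i)
        + Bd * ((\<Sum>i<?n. v i) - (\<Sum>i<?n. d i)) + 2 * C * h * (\<Sum>i<?n. v i)"
      by (simp add: sum.distrib sum_distrib_left[symmetric] sum_subtractf)
    also have "\<dots> \<le> A + Bd * \<epsilon> + 2 * C * h * R"
    proof (intro add_mono)
      show "(\<Sum>i<?n. (\<psi> (\<gamma> (ts ! i)) - C * (ts ! Suc i - ts ! i)) * d i) \<le> A"
        using chains[OF ts(1,2)] by (simp only: d_def)
      show "Bd * ((\<Sum>i<?n. v i) - (\<Sum>i<?n. d i)) \<le> Bd * \<epsilon>"
      proof (rule mult_left_mono[OF _ Bn])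
        show "(\<Sum>i<?n. v i) - (\<Sum>i<?n. d i) \<le> \<epsilon>" using sumv sumd by linarith
      qed
      show "2 * C * h * (\<Sum>i<?n. v i) \<le> 2 * C * h * R" by (simp only: sumv)
    qed
    also have "\<dots> \<le> A + e" using eh by linarith
    finally show ?thesis .
  qed
  show "(\<integral>\<^sup>+r\<in>{0..al L}. ennreal (\<psi> (\<gamma> (\<tau> r))) \<partial>lborel) \<le> ennreal A + ennreal e"
  proof (cases "R > 0")
    case True
    have "(\<integral>\<^sup>+r\<in>{0..al L}. ennreal (\<psi> (\<gamma> (\<tau> r))) \<partial>lborel)
        \<le> (\<integral>\<^sup>+r. (\<Sum>i<?n. ennreal (q i) * indicator {al (ts ! i)..al (ts ! Suc i)} r) \<partial>lborel)"
      using point[OF True] unfolding R_def by (rule nn_integral_mono)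
    also have "\<dots> = (\<Sum>i<?n. \<integral>\<^sup>+r. ennreal (q i) * indicator {al (ts ! i)..al (ts ! Suc i)} r \<partial>lborel)"
      by (rule nn_integral_sum) auto
    also have "\<dots> = (\<Sum>i<?n. ennreal (q i * v i))"
    proof (rule sum.cong[OF refl])
      fix i assume "i \<in> {..<?n}"
      then have "0 \<le> v i" "al (ts ! i) \<le> al (ts ! Suc i)" using dv[of i] mono[OF mem[of i]] by auto
      then show "(\<integral>\<^sup>+r. ennreal (q i) * indicator {al (ts ! i)..al (ts ! Suc i)} r \<partial>lborel) = ennreal (q i * v i)"
        using q0[of i] by (subst nn_integral_cmult_indicator) (auto simp: v_def ennreal_mult)
    qed
    also have "\<dots> = ennreal (\<Sum>i<?n. q i * v i)"
    proof (rule sum_ennreal)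
      fix i assume "i \<in> {..<?n}"
      then have "0 \<le> v i" using dv[of i] by auto
      then show "0 \<le> q i * v i" using q0[of i] by (rule mult_nonneg_nonneg[rotated])
    qed
    also have "\<dots> \<le> ennreal (A + e)" using sumq by (rule ennreal_leI)
    also have "\<dots> = ennreal A + ennreal e" using A \<open>e > 0\<close> by simp
    finally show ?thesis .
  next
    case False
    then have al0': "al L = 0" using R by (simp add: R_def)
    have "(\<integral>\<^sup>+r\<in>{0..al L}. ennreal (\<psi> (\<gamma> (\<tau> r))) \<partial>lborel)
        = (\<integral>\<^sup>+r. ennreal (\<psi> (\<gamma> (\<tau> 0))) * indicator {0::real} r \<partial>lborel)"
      unfolding al0' by (intro nn_integral_cong) (auto simp: indicator_def)
    also have "\<dots> = 0" by (subst nn_integral_cmult_indicator) auto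
    finally have "(\<integral>\<^sup>+r\<in>{0..al L}. ennreal (\<psi> (\<gamma> (\<tau> r))) \<partial>lborel) = 0" .
    then show ?thesis by simp
  qed
qed

text \<open>The positive \<open>\<delta>\<close> bounds the length of a cheap chain by
  \<open>2 * N / \<delta>\<close>, so that all chains fit one parameter interval. Along the limit
  curve the integrals of the \<open>\<phi> n\<close> increase to that of \<open>h\<close>, which
  therefore falls short of the increment of \<open>u\<close> by at least
  \<open>\<eta>\<close>.\<close>

lemma upper_gradient_forbids_cheap_chains:
  fixes u :: "'a::metric_space \<Rightarrow> real"
  assumes cpt: "\<And>x R. compact (cball (x::'a) R)"
    and u: "continuous_on UNIV u" "\<And>x. \<bar>u x\<bar> \<le> N"
    and h: "lsc_limit \<phi> h"
    and ug: "\<And>c. c \<in> rectifiable_curves \<Longrightarrow> ennreal \<bar>u (snd c 0) - u (snd c (fst c))\<bar> \<le> curve_integral h c"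
    and hm: "h \<in> borel_measurable borel"
    and \<delta>: "\<delta> > 0" and \<eta>: "\<eta> > 0"
  shows "\<exists>n. \<forall>(p :: nat \<Rightarrow> 'a) k. p k = x \<longrightarrow> (\<forall>i<k. dist (p i) (p (Suc i)) \<le> 1 / real (Suc n)) \<longrightarrow>
     u x - \<eta> < u (p 0) + (\<Sum>i<k. (\<phi> n (p i) + \<delta>) * dist (p i) (p (Suc i)))"
proof (rule ccontr)
  assume neg: "\<not> ?thesis"
  define \<psi> where "\<psi> n x = \<phi> n x + \<delta>" for n x
  have bl: "bdd_lip (\<phi> n)" for n using h by (simp add: lsc_limit_def)
  have \<phi>0: "0 \<le> \<phi> n x" for n x using bl unfolding bdd_lip_def by metis
  have bl\<psi>: "bdd_lip (\<psi> n)" for n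
    unfolding \<psi>_def using bdd_lip_add[OF bl bdd_lip_const] \<delta> by simp
  then have "\<forall>n. \<exists>C. C-lipschitz_on UNIV (\<psi> n)" unfolding bdd_lip_def by blast
  then obtain C where C: "\<And>n. (C n)-lipschitz_on UNIV (\<psi> n)" by metis
  have \<psi>mono: "\<psi> m x \<le> \<psi> n x" if "m \<le> n" for m n x
    using h that unfolding \<psi>_def lsc_limit_def incseq_def by auto
  \<comment> \<open>The summand 1 keeps the parameter interval nondegenerate when
    \<open>N = 0\<close>.\<close>
  define L where "L = (2 * N) / \<delta> + 1"
  have N: "0 \<le> N" using u(2)[of x] by linarith
  have L: "0 < L" using N \<delta> by (simp add: L_def add_nonneg_pos)
  have ch: "\<exists>p k. p k = x \<and> (\<forall>i<k. dist (p i) (p (Suc i)) \<le> 1 / real (Suc n)) \<and>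
        (\<Sum>i<k. dist (p i) (p (Suc i))) \<le> L \<and>
        u (p 0) + (\<Sum>i<k. \<psi> n (p i) * dist (p i) (p (Suc i))) \<le> u x - \<eta>" for n
  proof -
    obtain p :: "nat \<Rightarrow> 'a" and k where pk: "p k = x" "\<forall>i<k. dist (p i) (p (Suc i)) \<le> 1 / real (Suc n)"
      "u (p 0) + (\<Sum>i<k. \<psi> n (p i) * dist (p i) (p (Suc i))) \<le> u x - \<eta>"
    proof -
      from neg have "\<exists>(p :: nat \<Rightarrow> 'a) k. p k = x \<and> (\<forall>i<k. dist (p i) (p (Suc i)) \<le> 1 / real (Suc n)) \<and>
        \<not> u x - \<eta> < u (p 0) + (\<Sum>i<k. \<psi> n (p i) * dist (p i) (p (Suc i)))"
        unfolding \<psi>_def by blast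
      then show ?thesis using that by (elim exE conjE) (simp add: not_less)
    qed
    have "\<delta> * (\<Sum>i<k. dist (p i) (p (Suc i))) \<le> (\<Sum>i<k. \<psi> n (p i) * dist (p i) (p (Suc i)))"
      unfolding sum_distrib_left using \<phi>0 by (intro sum_mono mult_right_mono) (auto simp: \<psi>_def)
    also have "\<dots> \<le> 2 * N" using pk(3) u(2)[of x] u(2)[of "p 0"] \<eta> by linarith
    finally have "(\<Sum>i<k. dist (p i) (p (Suc i))) \<le> 2 * N / \<delta>" using \<delta> by (simp add: field_simps)
    then show ?thesis using pk by (intro exI[of _ p] exI[of _ k]) (auto simp: L_def)
  qed
  have \<psi>0: "0 \<le> \<psi> n x" for n x using \<phi>0 \<delta> by (simp add: \<psi>_def add_nonneg_nonneg less_imp_le)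
  obtain \<gamma> where \<gamma>: "\<gamma> L = x" "u (\<gamma> 0) \<le> u x - \<eta>"
    "\<And>s t. 0 \<le> s \<Longrightarrow> s \<le> t \<Longrightarrow> t \<le> L \<Longrightarrow> dist (\<gamma> s) (\<gamma> t) \<le> t - s"
    "\<And>m ts. sorted ts \<Longrightarrow> set ts \<subseteq> {0..L} \<Longrightarrow>
        u (\<gamma> 0) + (\<Sum>i<length ts - 1. (\<psi> m (\<gamma> (ts ! i)) - C m * (ts ! Suc i - ts ! i)) *
           dist (\<gamma> (ts ! i)) (\<gamma> (ts ! Suc i))) \<le> u x - \<eta>"
    by (rule chain_limit_curve[OF cpt u(1) \<psi>0 \<psi>mono C less_imp_le[OF L] ch], assumption, rule that)
  obtain al \<tau> where al: "al 0 = 0"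
    "\<And>s t. 0 \<le> s \<Longrightarrow> s \<le> t \<Longrightarrow> t \<le> L \<Longrightarrow> curve_length \<gamma> s t = ennreal (al t - al s)"
    "\<And>s t. 0 \<le> s \<Longrightarrow> s \<le> t \<Longrightarrow> t \<le> L \<Longrightarrow> al s \<le> al t"
    "\<And>s t. 0 \<le> s \<Longrightarrow> s \<le> t \<Longrightarrow> t \<le> L \<Longrightarrow> al t - al s \<le> t - s"
    "\<And>t. 0 \<le> t \<Longrightarrow> t \<le> L \<Longrightarrow> \<gamma> (\<tau> (al t)) = \<gamma> t"
    "\<And>r. 0 \<le> r \<Longrightarrow> r \<le> al L \<Longrightarrow> 0 \<le> \<tau> r \<and> \<tau> r \<le> L \<and> al (\<tau> r) = r"
    "0 < al L \<Longrightarrow> (al L, \<gamma> \<circ> \<tau>) \<in> rectifiable_curves"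
    by (rule arc_length_reparametrisation[OF less_imp_le[OF L] \<gamma>(3)], assumption+, rule that)
  define A where "A = u x - \<eta> - u (\<gamma> 0)"
  have A: "0 \<le> A" using \<gamma>(2) by (simp add: A_def)
  have int: "(\<integral>\<^sup>+r\<in>{0..al L}. ennreal (\<psi> m (\<gamma> (\<tau> r))) \<partial>lborel) \<le> ennreal A" for m
  proof -
    obtain Bd where "\<And>x. 0 \<le> \<psi> m x \<and> \<psi> m x \<le> Bd" using bl\<psi>[of m] unfolding bdd_lip_def by blast
    then have Bd: "\<And>x. 0 \<le> \<psi> m x" "\<And>x. \<psi> m x \<le> Bd" by blast+
    show ?thesis
    proof (rule arc_length_integral_le[OF L al(1-4) al(6) Bd C A])
      fix ts assume "sorted ts" "set ts \<subseteq> {0..L}"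
      from \<gamma>(4)[OF this, of m]
      show "(\<Sum>i<length ts - 1. (\<psi> m (\<gamma> (ts ! i)) - C m * (ts ! Suc i - ts ! i)) *
           dist (\<gamma> (ts ! i)) (\<gamma> (ts ! Suc i))) \<le> A" by (simp add: A_def)
    qed
  qed
  show False
  \<comment> \<open>A limit curve of length zero is constant and does not belong to
    \<open>rectifiable_curves\<close>; the gap \<open>\<eta>\<close> alone excludes it.\<close>
  proof (cases "0 < al L")
    case False
    then have "al L = 0" using al(1) al(3)[of 0 L] L by simp
    then have "curve_length \<gamma> 0 L = 0" using al(2)[of 0 L] al(1) L by simp
    then have "dist (\<gamma> 0) (\<gamma> L) = 0" using dist_le_curve_length[of 0 L \<gamma>] L by simp
    then show False using \<gamma>(1,2) \<eta> by simp
  next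
    case True
    let ?c = "(al L, \<gamma> \<circ> \<tau>)"
    have c: "?c \<in> rectifiable_curves" using al(7) True .
    have "curve_integral h ?c = (\<integral>\<^sup>+r. (SUP n. ennreal (\<phi> n (\<gamma> (\<tau> r))) * indicator {0..al L} r) \<partial>lborel)"
      using h unfolding curve_integral_def lsc_limit_def
      by (auto intro!: nn_integral_cong simp: indicator_def)
    also have "\<dots> = (SUP n. \<integral>\<^sup>+r. ennreal (\<phi> n (\<gamma> (\<tau> r))) * indicator {0..al L} r \<partial>lborel)"
    proof (rule nn_integral_monotone_convergence_SUP)
      show "incseq (\<lambda>n r. ennreal (\<phi> n (\<gamma> (\<tau> r))) * indicator {0..al L} r)"
        using h unfolding lsc_limit_def incseq_def le_fun_def
        by (auto intro!: mult_right_mono ennreal_leI)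
      show "(\<lambda>r. ennreal (\<phi> n (\<gamma> (\<tau> r))) * indicator {0..al L} r) \<in> borel_measurable lborel" for n
      proof -
        have "continuous_on UNIV (\<phi> n)"
          using bl lipschitz_on_continuous_on unfolding bdd_lip_def by blast
        from measurable_compose[OF borel_measurable_continuous_onI[OF this] measurable_ennreal]
        have "(\<lambda>x. ennreal (\<phi> n x)) \<in> borel_measurable borel" .
        from curve_integral_measurable[OF c this] show ?thesis by simp
      qed
    qed
    also have "\<dots> \<le> ennreal A"
    proof (rule SUP_least)
      fix n
      have "(\<integral>\<^sup>+r. ennreal (\<phi> n (\<gamma> (\<tau> r))) * indicator {0..al L} r \<partial>lborel)
          \<le> (\<integral>\<^sup>+r\<in>{0..al L}. ennreal (\<psi> n (\<gamma> (\<tau> r))) \<partial>lborel)"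
        using \<delta> by (intro nn_integral_mono mult_right_mono ennreal_leI) (auto simp: \<psi>_def)
      also have "\<dots> \<le> ennreal A" by (rule int)
      finally show "(\<integral>\<^sup>+r. ennreal (\<phi> n (\<gamma> (\<tau> r))) * indicator {0..al L} r \<partial>lborel) \<le> ennreal A" .
    qed
    finally have "curve_integral h ?c \<le> ennreal A" .
    then have "ennreal \<bar>u (\<gamma> (\<tau> 0)) - u (\<gamma> (\<tau> (al L)))\<bar> \<le> ennreal A"
      using ug[OF c] by (auto intro: order_trans)
    moreover have "\<gamma> (\<tau> 0) = \<gamma> 0" "\<gamma> (\<tau> (al L)) = x" using al(5)[of 0] al(5)[of L] al(1) L \<gamma>(1) by auto
    ultimately have "\<bar>u (\<gamma> 0) - u x\<bar> \<le> A" using A by (simp add: ennreal_le_iff)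
    then show False using \<eta> unfolding A_def by linarith
  qed
qed

text \<open>A discrete form of the infimum, over curves ending at \<open>x\<close>, of
  \<open>u\<close> at the start plus the integral of \<open>\<psi>\<close>. The case
  \<open>k = 0\<close> gives the upper bound \<open>u x\<close>; weighting each link at its starting
  point makes extension by one link exact.\<close>

definition chain_inf :: "('a::metric_space \<Rightarrow> real) \<Rightarrow> ('a \<Rightarrow> real) \<Rightarrow> real \<Rightarrow> 'a \<Rightarrow> real" where
  "chain_inf u \<psi> s x = Inf {u (p 0) + (\<Sum>i<k. \<psi> (p i) * dist (p i) (p (Suc i))) |
     (p :: nat \<Rightarrow> 'a) k. p k = x \<and> (\<forall>i<k. dist (p i) (p (Suc i)) \<le> s)}"

lemma chain_inf_lower:
  assumes "\<And>x. \<bar>u x\<bar> \<le> N" "\<And>x. 0 \<le> \<psi> x" "p k = x" "\<And>i. i < k \<Longrightarrow> dist (p i) (p (Suc i)) \<le> s"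
  shows "chain_inf u \<psi> s x \<le> u (p 0) + (\<Sum>i<k. \<psi> (p i) * dist (p i) (p (Suc i)))"
  unfolding chain_inf_def
proof (rule cInf_lower)
  show "bdd_below {u (p 0) + (\<Sum>i<k. \<psi> (p i) * dist (p i) (p (Suc i))) |
     p k. p k = x \<and> (\<forall>i<k. dist (p i) (p (Suc i)) \<le> s)}"
  proof (rule bdd_belowI)
    fix y assume "y \<in> {u (p 0) + (\<Sum>i<k. \<psi> (p i) * dist (p i) (p (Suc i))) |
     p k. p k = x \<and> (\<forall>i<k. dist (p i) (p (Suc i)) \<le> s)}"
    then obtain p k where y: "y = u (p 0) + (\<Sum>i<k. \<psi> (p i) * dist (p i) (p (Suc i)))" by blast
    have "0 \<le> (\<Sum>i<k. \<psi> (p i) * dist (p i) (p (Suc i)))"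
      by (intro sum_nonneg mult_nonneg_nonneg assms(2)) auto
    then show "- N \<le> y" unfolding y using assms(1)[of "p 0"] by linarith
  qed
qed (use assms in blast)

lemma chain_inf_greatest:
  assumes "\<And>p k. p k = x \<Longrightarrow> (\<And>i. i < k \<Longrightarrow> dist (p i) (p (Suc i)) \<le> s) \<Longrightarrow>
     z \<le> u (p 0) + (\<Sum>i<k. \<psi> (p i) * dist (p i) (p (Suc i)))"
  shows "z \<le> chain_inf u \<psi> s x"
  unfolding chain_inf_def
proof (rule cInf_greatest)
  show "{u (p 0) + (\<Sum>i<k. \<psi> (p i) * dist (p i) (p (Suc i))) |
     p k. p k = x \<and> (\<forall>i<k. dist (p i) (p (Suc i)) \<le> s)} \<noteq> {}"
    by (auto intro!: exI[of _ "\<lambda>_. x"] exI[of _ 0])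
qed (use assms in blast)

lemma chain_inf_le:
  assumes "\<And>x. \<bar>u x\<bar> \<le> N" "\<And>x. 0 \<le> \<psi> x"
  shows "chain_inf u \<psi> s x \<le> u x"
  using chain_inf_lower[of u N \<psi> "\<lambda>_. x" 0 x s] assms by simp

lemma chain_inf_ge:
  assumes "\<And>x. \<bar>u x\<bar> \<le> N" "\<And>x. 0 \<le> \<psi> x"
  shows "- N \<le> chain_inf u \<psi> s x"
proof (rule chain_inf_greatest)
  fix p :: "nat \<Rightarrow> 'a" and k
  have "0 \<le> (\<Sum>i<k. \<psi> (p i) * dist (p i) (p (Suc i)))"
    by (intro sum_nonneg mult_nonneg_nonneg assms(2)) auto
  then show "- N \<le> u (p 0) + (\<Sum>i<k. \<psi> (p i) * dist (p i) (p (Suc i)))"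
    using assms(1)[of "p 0"] by linarith
qed

text \<open>A chain ending at \<open>x\<close> is extended by the single link to \<open>y\<close>.
  Both the Lipschitz bound and the bound on \<open>pointwise_lip\<close> come from this.\<close>

lemma chain_inf_step:
  assumes "\<And>x. \<bar>u x\<bar> \<le> N" "\<And>x. 0 \<le> \<psi> x" "dist x y \<le> s"
  shows "chain_inf u \<psi> s y \<le> chain_inf u \<psi> s x + \<psi> x * dist x y"
proof -
  have "chain_inf u \<psi> s y - \<psi> x * dist x y \<le> chain_inf u \<psi> s x"
  proof (rule chain_inf_greatest)
    fix p :: "nat \<Rightarrow> 'a" and k assume p: "p k = x" "\<And>i. i < k \<Longrightarrow> dist (p i) (p (Suc i)) \<le> s"
    let ?q = "p(Suc k := y)"
    have "chain_inf u \<psi> s y \<le> u (?q 0) + (\<Sum>i<Suc k. \<psi> (?q i) * dist (?q i) (?q (Suc i)))"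
      by (rule chain_inf_lower[OF assms(1,2)]) (use p assms(3) in \<open>auto simp: less_Suc_eq\<close>)
    also have "(\<Sum>i<Suc k. \<psi> (?q i) * dist (?q i) (?q (Suc i)))
        = (\<Sum>i<k. \<psi> (p i) * dist (p i) (p (Suc i))) + \<psi> x * dist x y"
      using p(1) by simp
    finally show "chain_inf u \<psi> s y - \<psi> x * dist x y \<le> u (p 0) + (\<Sum>i<k. \<psi> (p i) * dist (p i) (p (Suc i)))"
      by simp
  qed
  then show ?thesis by simp
qed

lemma chain_inf_mono:
  assumes "\<And>x. \<bar>u x\<bar> \<le> N" "\<And>x. 0 \<le> \<psi> x" "\<And>x. \<psi> x \<le> \<psi>' x" "s' \<le> s"
  shows "chain_inf u \<psi> s x \<le> chain_inf u \<psi>' s' x"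
proof (rule chain_inf_greatest)
  fix p :: "nat \<Rightarrow> 'a" and k assume p: "p k = x" "\<And>i. i < k \<Longrightarrow> dist (p i) (p (Suc i)) \<le> s'"
  have "chain_inf u \<psi> s x \<le> u (p 0) + (\<Sum>i<k. \<psi> (p i) * dist (p i) (p (Suc i)))"
    by (rule chain_inf_lower[OF assms(1,2)]) (use p assms(4) order_trans in blast)+
  also have "\<dots> \<le> u (p 0) + (\<Sum>i<k. \<psi>' (p i) * dist (p i) (p (Suc i)))"
    by (intro add_left_mono sum_mono mult_right_mono assms(3)) auto
  finally show "chain_inf u \<psi> s x \<le> u (p 0) + (\<Sum>i<k. \<psi>' (p i) * dist (p i) (p (Suc i)))" .
qed

text \<open>Within distance \<open>s\<close> one link suffices; beyond it the oscillation, at most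
  \<open>2 * N\<close>, is absorbed by the slope \<open>2 * N / s\<close>.\<close>

lemma chain_inf_lipschitz:
  assumes "\<And>x. \<bar>u x\<bar> \<le> N" "\<And>x. 0 \<le> \<psi> x" "\<And>x. \<psi> x \<le> Bd" "0 < s"
  shows "\<exists>L. L-lipschitz_on UNIV (chain_inf u \<psi> s)"
proof -
  let ?v = "chain_inf u \<psi> s"
  have N: "0 \<le> N" using assms(1) abs_ge_zero order_trans by blast
  have B: "0 \<le> Bd" using assms(2,3) order_trans by blast
  have one: "?v y - ?v x \<le> max Bd (2 * N / s) * dist x y" for x y
  proof (cases "dist x y \<le> s")
    case True
    have "?v y - ?v x \<le> \<psi> x * dist x y" using chain_inf_step[of u N \<psi> x y s] assms(1,2) True by simp
    also have "\<dots> \<le> max Bd (2 * N / s) * dist x y"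
      using assms(3)[of x] by (intro mult_right_mono) auto
    finally show ?thesis .
  next
    case False
    have "?v y \<le> N" "- N \<le> ?v x"
      using chain_inf_le[of u N \<psi> s y] chain_inf_ge[of u N \<psi> s x] assms(1,2) abs_le_D1 order_trans by blast+
    then have "?v y - ?v x \<le> (2 * N / s) * s" using assms(4) by simp
    also have "\<dots> \<le> (2 * N / s) * dist x y" using False N assms(4) by (intro mult_left_mono) auto
    also have "\<dots> \<le> max Bd (2 * N / s) * dist x y" by (intro mult_right_mono) auto
    finally show ?thesis .
  qed
  have "(max Bd (2 * N / s))-lipschitz_on UNIV ?v"
  proof (rule lipschitz_onI)
    fix x y :: 'a
    show "dist (?v x) (?v y) \<le> max Bd (2 * N / s) * dist x y"
      using one[of x y] one[of y x] by (simp add: dist_real_def dist_commute abs_le_iff)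
  qed (use B in auto)
  then show ?thesis by blast
qed

text \<open>Applying \<open>chain_inf_step\<close> in both directions weights the link at
  \<open>y\<close> or at the nearby \<open>z\<close>; continuity of \<open>\<psi>\<close> removes
  the difference as the radius shrinks.\<close>

lemma pointwise_lip_chain_inf:
  assumes "\<And>x. \<bar>u x\<bar> \<le> N" "\<And>x. 0 \<le> \<psi> x" "C-lipschitz_on UNIV \<psi>" "0 < s"
  shows "pointwise_lip (chain_inf u \<psi> s) y \<le> ennreal (\<psi> y)"
proof (rule ennreal_le_epsilon)
  fix e :: real assume "e > 0"
  let ?v = "chain_inf u \<psi> s"
  have C: "0 \<le> C" using assms(3) by (rule lipschitz_on_nonneg)
  \<comment> \<open>Radii below \<open>s\<close> keep the link to \<open>z\<close> admissible; radii
    below \<open>e / (C + 1)\<close> keep the variation of \<open>\<psi>\<close> below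
    \<open>e\<close>.\<close>
  define \<rho>0 where "\<rho>0 = min s (e / (C + 1))"
  have \<rho>0: "\<rho>0 > 0" using assms(4) \<open>e > 0\<close> C by (simp add: \<rho>0_def add_nonneg_pos)
  have bound: "(SUP z\<in>ball y \<rho> - {y}. ennreal (\<bar>?v y - ?v z\<bar> / dist y z)) \<le> ennreal (\<psi> y + e)"
    if \<rho>: "0 < \<rho>" "\<rho> < \<rho>0" for \<rho>
  proof (rule SUP_least, rule ennreal_leI)
    fix z assume "z \<in> ball y \<rho> - {y}"
    then have z: "dist y z < \<rho>" "0 < dist y z" by auto
    have ds: "dist y z \<le> s" "dist z y \<le> s" using z \<rho> by (auto simp: \<rho>0_def dist_commute)
    have "C * dist y z \<le> C * (e / (C + 1))" using z \<rho> C by (intro mult_left_mono) (auto simp: \<rho>0_def)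
    also have "\<dots> = e * (C / (C + 1))" by simp
    also have "\<dots> \<le> e * 1" using C \<open>e > 0\<close> by (intro mult_left_mono) auto
    finally have "C * dist y z \<le> e" by simp
    then have "\<psi> z \<le> \<psi> y + e" using lipschitz_onD[OF assms(3), of y z] by (simp add: dist_real_def)
    then have "\<psi> z * dist z y \<le> (\<psi> y + e) * dist y z" by (simp add: dist_commute mult_right_mono)
    moreover have "\<psi> y * dist y z \<le> (\<psi> y + e) * dist y z" using \<open>e > 0\<close> by (intro mult_right_mono) auto
    ultimately have "\<bar>?v y - ?v z\<bar> \<le> (\<psi> y + e) * dist y z"
      using chain_inf_step[of u N \<psi>, OF assms(1,2) ds(1)] chain_inf_step[of u N \<psi>, OF assms(1,2) ds(2)]
      by linarith
    then show "\<bar>?v y - ?v z\<bar> / dist y z \<le> \<psi> y + e" using z by (simp add: divide_le_eq)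
  qed
  have "pointwise_lip ?v y \<le> Liminf (at_right (0::real)) (\<lambda>\<rho>. ennreal (\<psi> y + e))"
    unfolding pointwise_lip_def
  proof (rule Liminf_mono)
    show "\<forall>\<^sub>F \<rho> in at_right 0. (SUP z\<in>ball y \<rho> - {y}. ennreal (\<bar>?v y - ?v z\<bar> / dist y z)) \<le> ennreal (\<psi> y + e)"
      unfolding eventually_at_right_field using \<rho>0 bound by blast
  qed
  also have "\<dots> = ennreal (\<psi> y + e)" by (rule Liminf_const) simp
  also have "\<dots> = ennreal (\<psi> y) + ennreal e" using assms(2) \<open>e > 0\<close> by simp
  finally show "pointwise_lip ?v y \<le> ennreal (\<psi> y) + ennreal e" .
qed

section \<open>The Poincare inequality for weak upper gradients\<close>

definition poincare_with :: "'a::metric_space measure \<Rightarrow> real \<Rightarrow> real \<Rightarrow> bool" where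
  "poincare_with M cP \<Lambda> \<longleftrightarrow> 0 < cP \<and> 1 \<le> \<Lambda> \<and> (\<forall>u L x. \<forall>r>0. L-lipschitz_on UNIV u \<longrightarrow>
        (\<integral>\<^sup>+y\<in>ball x r. ennreal \<bar>u y - mean_value M (ball x r) u\<bar> \<partial>M)
          \<le> ennreal (cP * r) * (\<integral>\<^sup>+y\<in>ball x (\<Lambda> * r). pointwise_lip u y \<partial>M))"

context complete_doubling
begin

lemma continuous_measurable_M:
  assumes "continuous_on UNIV (u :: 'a \<Rightarrow> real)" shows "u \<in> borel_measurable M"
  by (rule borel_measurable_M[OF borel_measurable_continuous_onI[OF assms]])

text \<open>All errors are multiples of one \<open>\<kappa>\<close>: the exceptional function costs
  \<open>\<kappa> * I\<close>, the lower semicontinuous majorant \<open>\<kappa>\<close>, and the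
  slack added to the chain weights \<open>\<kappa> * b\<close>. Their total, multiplied by
  \<open>cP * r\<close>, is \<open>e\<close>.\<close>

lemma poincare_bounded:
  assumes P: "poincare_with M cP \<Lambda>" and "0 < r"
    and u: "continuous_on UNIV u" "\<And>x. \<bar>u x\<bar> \<le> N"
    and g: "g \<in> borel_measurable borel" and ug: "upper_gradient_off M \<rho> u g"
  shows "(\<integral>\<^sup>+y\<in>ball x r. ennreal \<bar>u y - mean_value M (ball x r) u\<bar> \<partial>M)
    \<le> ennreal (cP * r) * (\<integral>\<^sup>+y\<in>ball x (\<Lambda> * r). g y \<partial>M)"
proof (rule ennreal_le_epsilon)
  fix e :: real assume "e > 0"
  have cP: "0 < cP * r" "0 < \<Lambda> * r" using P \<open>0 < r\<close> by (auto simp: poincare_with_def)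
  let ?B = "ball x r" and ?B' = "ball x (\<Lambda> * r)"
  have \<rho>: "\<rho> \<in> borel_measurable borel" "(\<integral>\<^sup>+x. \<rho> x \<partial>M) < \<infinity>"
    using ug by (auto simp: upper_gradient_off_def)
  define I where "I = enn2real (\<integral>\<^sup>+x. \<rho> x \<partial>M)"
  have I: "(\<integral>\<^sup>+x. \<rho> x \<partial>M) = ennreal I" "0 \<le> I" using \<rho>(2) by (auto simp: I_def)
  define b where "b = measure M ?B'"
  have b: "emeasure M ?B' = ennreal b" "0 \<le> b" by (auto simp: b_def emeasure_ball)
  define Z where "Z = cP * r * (I + 1 + b)"
  define \<kappa> where "\<kappa> = e / Z"
  have den: "0 < Z" using cP(1) I b unfolding Z_def by (intro mult_pos_pos[OF cP(1)]) auto
  have \<kappa>: "\<kappa> > 0" "cP * r * (\<kappa> * I + \<kappa> + \<kappa> * b) = e"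
  proof -
    show "\<kappa> > 0" using den \<open>e > 0\<close> by (simp add: \<kappa>_def)
    have "cP * r * (\<kappa> * I + \<kappa> + \<kappa> * b) = \<kappa> * Z" by (simp add: Z_def algebra_simps)
    then show "cP * r * (\<kappa> * I + \<kappa> + \<kappa> * b) = e" using den by (simp add: \<kappa>_def)
  qed
  define f where "f y = g y + ennreal \<kappa> * \<rho> y" for y
  have f: "f \<in> borel_measurable borel" unfolding f_def[abs_def] using g \<rho>(1) by measurable
  obtain h d where h: "lsc h" "d \<in> borel_measurable borel" "\<And>y. f y \<le> h y" "\<And>y. h y \<le> f y + d y"
    "(\<integral>\<^sup>+y. d y \<partial>M) \<le> ennreal \<kappa>" by (rule vitali_caratheodory[OF f \<kappa>(1)]) (rule that)
  obtain \<phi> where \<phi>: "lsc_limit \<phi> h" using h(1) by (auto simp: lsc_def)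
  have bl: "bdd_lip (\<phi> n)" and inc: "incseq (\<lambda>n. \<phi> n y)" and hS: "h y = (SUP n. ennreal (\<phi> n y))" for n y
    using \<phi> by (auto simp: lsc_limit_def)
  have cont\<phi>: "continuous_on UNIV (\<phi> n)" for n
    using bl[of n] lipschitz_on_continuous_on unfolding bdd_lip_def by blast
  have h_meas: "h \<in> borel_measurable borel"
  proof -
    have "(\<lambda>y. ennreal (\<phi> n y)) \<in> borel_measurable borel" for n
      by (rule measurable_compose[OF borel_measurable_continuous_onI[OF cont\<phi>] measurable_ennreal])
    then have "(\<lambda>y. SUP n. ennreal (\<phi> n y)) \<in> borel_measurable borel" by measurable
    moreover have "h = (\<lambda>y. SUP n. ennreal (\<phi> n y))" using hS by blast
    ultimately show ?thesis by simp
  qed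
  have ugh: "ennreal \<bar>u (snd c 0) - u (snd c (fst c))\<bar> \<le> curve_integral h c" if c: "c \<in> rectifiable_curves" for c
  proof (cases "curve_integral \<rho> c < \<infinity>")
    case True
    then have "ennreal \<bar>u (snd c 0) - u (snd c (fst c))\<bar> \<le> curve_integral g c"
      using ug c by (auto simp: upper_gradient_off_def)
    also have "\<dots> \<le> curve_integral h c"
    proof (rule curve_integral_mono)
      fix y
      have "g y \<le> f y" by (simp add: f_def)
      then show "g y \<le> h y" using h(3) by (rule order_trans)
    qed
    finally show ?thesis .
  next
    case False
    have "ennreal \<kappa> * curve_integral \<rho> c = curve_integral (\<lambda>y. ennreal \<kappa> * \<rho> y) c"
      using curve_integral_cmult[OF c \<rho>(1)] by simp
    also have "\<dots> \<le> curve_integral h c"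
    proof (rule curve_integral_mono)
      fix y
      have "ennreal \<kappa> * \<rho> y \<le> f y" by (simp add: f_def)
      then show "ennreal \<kappa> * \<rho> y \<le> h y" using h(3) by (rule order_trans)
    qed
    finally have "curve_integral h c = top"
      using False \<kappa>(1) by (simp add: not_less top_unique ennreal_mult_top)
    then show ?thesis by simp
  qed
  define \<psi> where "\<psi> n y = \<phi> n y + \<kappa>" for n y
  define U where "U n = chain_inf u (\<psi> n) (1 / real (Suc n))" for n
  have \<phi>0: "0 \<le> \<phi> n y" for n y using bl[of n] unfolding bdd_lip_def by metis
  then have \<psi>0: "0 \<le> \<psi> n y" for n y using \<kappa>(1) by (simp add: \<psi>_def add_nonneg_nonneg less_imp_le)
  have "bdd_lip (\<psi> n)" for n
    unfolding \<psi>_def using bdd_lip_add[OF bl bdd_lip_const] \<kappa>(1) by simp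
  then have "\<forall>n. \<exists>C Bd. C-lipschitz_on UNIV (\<psi> n) \<and> (\<forall>y. \<psi> n y \<le> Bd)" unfolding bdd_lip_def by blast
  then obtain C Bd where CB: "\<And>n. (C n)-lipschitz_on UNIV (\<psi> n)" "\<And>n y. \<psi> n y \<le> Bd n" by metis
  have Ulip: "\<exists>L. L-lipschitz_on UNIV (U n)" for n
    unfolding U_def by (rule chain_inf_lipschitz[of u N "\<psi> n", OF u(2) \<psi>0 CB(2)]) simp
  then have Ucont: "continuous_on UNIV (U n)" for n using lipschitz_on_continuous_on by blast
  have Ubd: "\<bar>U n y\<bar> \<le> N" for n y
    using chain_inf_le[of u N "\<psi> n" "1 / real (Suc n)" y, OF u(2) \<psi>0]
      chain_inf_ge[of u N "\<psi> n" "1 / real (Suc n)" y, OF u(2) \<psi>0] u(2)[of y]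
    unfolding U_def by linarith
  have Umono: "U m y \<le> U n y" if "m \<le> n" for m n y
    unfolding U_def
  proof (rule chain_inf_mono[of u N "\<psi> m", OF u(2) \<psi>0])
    show "\<psi> m z \<le> \<psi> n z" for z using inc[of z] that by (simp add: \<psi>_def incseq_def)
    show "1 / real (Suc n) \<le> 1 / real (Suc m)" using that by (intro divide_left_mono) auto
  qed
  have Ule: "U n y \<le> u y" for n y unfolding U_def by (rule chain_inf_le[of u N "\<psi> n", OF u(2) \<psi>0])
  have Ulim: "(\<lambda>n. U n y) \<longlonglongrightarrow> u y" for y
  proof (rule LIMSEQ_I)
    fix \<eta> :: real assume "\<eta> > 0"
    then have "\<eta> / 2 > 0" by simp
    obtain n where n: "\<And>(p :: nat \<Rightarrow> 'a) k. p k = y \<Longrightarrow> (\<forall>i<k. dist (p i) (p (Suc i)) \<le> 1 / real (Suc n)) \<Longrightarrow>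
       u y - \<eta> / 2 < u (p 0) + (\<Sum>i<k. (\<phi> n (p i) + \<kappa>) * dist (p i) (p (Suc i)))"
      using upper_gradient_forbids_cheap_chains[OF compact_cball u \<phi> ugh h_meas \<kappa>(1) \<open>\<eta> / 2 > 0\<close>, of y] by blast
    have "u y - \<eta> / 2 \<le> U n y"
      unfolding U_def by (rule chain_inf_greatest) (use n in \<open>force simp: \<psi>_def intro: less_imp_le\<close>)
    then have "u y - \<eta> / 2 \<le> U k y" if "n \<le> k" for k using Umono[OF that, of y] by linarith
    then have "norm (U k y - u y) < \<eta>" if "n \<le> k" for k
      using that Ule[of k y] \<open>\<eta> > 0\<close> by (force simp: abs_if)
    then show "\<exists>no. \<forall>n\<ge>no. norm (U n y - u y) < \<eta>" by blast
  qed
  let ?m = "mean_value M ?B"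
  \<comment> \<open>The means converge by dominated convergence, the constant \<open>N\<close> being
    integrable on the ball; this identifies the integrand to which Fatou's lemma is applied at the
    end.\<close>
  have mlim: "(\<lambda>n. ?m (U n)) \<longlonglongrightarrow> ?m u"
    unfolding mean_value_def set_lebesgue_integral_def
  proof (intro tendsto_mult tendsto_const integral_dominated_convergence[where w = "\<lambda>y. N * indicator ?B y"])
    show "(\<lambda>y. indicator ?B y *\<^sub>R u y) \<in> borel_measurable M"
      using continuous_measurable_M[OF u(1)] by (intro borel_measurable_scaleR borel_measurable_indicator) auto
    show "(\<lambda>y. indicator ?B y *\<^sub>R U n y) \<in> borel_measurable M" for n
      using continuous_measurable_M[OF Ucont] by (intro borel_measurable_scaleR borel_measurable_indicator) auto
    show "integrable M (\<lambda>y. N * indicator ?B y)"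
      using \<open>0 < r\<close> by (intro integrable_mult_right integrable_real_indicator) (auto simp: emeasure_ball)
    show "AE y in M. (\<lambda>n. indicator ?B y *\<^sub>R U n y) \<longlonglongrightarrow> indicator ?B y *\<^sub>R u y"
      using Ulim by (intro AE_I2 tendsto_scaleR tendsto_const)
    show "AE y in M. norm (indicator ?B y *\<^sub>R U n y) \<le> N * indicator ?B y" for n
      using Ubd by (intro AE_I2) (auto simp: indicator_def)
  qed
  have each: "(\<integral>\<^sup>+y\<in>?B. ennreal \<bar>U n y - ?m (U n)\<bar> \<partial>M)
      \<le> ennreal (cP * r) * (\<integral>\<^sup>+y\<in>?B'. g y \<partial>M) + ennreal e" for n
  proof -
    obtain L where "L-lipschitz_on UNIV (U n)" using Ulip by blast
    then have "(\<integral>\<^sup>+y\<in>?B. ennreal \<bar>U n y - ?m (U n)\<bar> \<partial>M)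
        \<le> ennreal (cP * r) * (\<integral>\<^sup>+y\<in>?B'. pointwise_lip (U n) y \<partial>M)"
      using P \<open>0 < r\<close> unfolding poincare_with_def by blast
    also have "\<dots> \<le> ennreal (cP * r) * ((\<integral>\<^sup>+y\<in>?B'. g y \<partial>M) + ennreal (\<kappa> * I + \<kappa> + \<kappa> * b))"
    proof (rule mult_left_mono)
      have "(\<integral>\<^sup>+y\<in>?B'. pointwise_lip (U n) y \<partial>M)
          \<le> (\<integral>\<^sup>+y. g y * indicator ?B' y + (ennreal \<kappa> * \<rho> y + (d y + ennreal \<kappa> * indicator ?B' y)) \<partial>M)"
      proof (rule nn_integral_mono)
        fix y
        have "pointwise_lip (U n) y \<le> ennreal (\<psi> n y)"
          unfolding U_def by (rule pointwise_lip_chain_inf[of u N "\<psi> n", OF u(2) \<psi>0 CB(1)]) simp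
        also have "\<dots> = ennreal (\<phi> n y) + ennreal \<kappa>" using \<phi>0 \<kappa>(1) by (simp add: \<psi>_def)
        also have "\<dots> \<le> h y + ennreal \<kappa>" unfolding hS by (intro add_right_mono SUP_upper) auto
        also have "\<dots> \<le> (f y + d y) + ennreal \<kappa>" using h(4) by (rule add_right_mono)
        finally have *: "pointwise_lip (U n) y \<le> g y + (ennreal \<kappa> * \<rho> y + (d y + ennreal \<kappa>))"
          by (simp add: f_def ac_simps)
        show "pointwise_lip (U n) y * indicator ?B' y
            \<le> g y * indicator ?B' y + (ennreal \<kappa> * \<rho> y + (d y + ennreal \<kappa> * indicator ?B' y))"
          using * by (auto simp: indicator_def)
      qed
      also have "\<dots> = (\<integral>\<^sup>+y\<in>?B'. g y \<partial>M) + (ennreal \<kappa> * (\<integral>\<^sup>+y. \<rho> y \<partial>M)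
          + ((\<integral>\<^sup>+y. d y \<partial>M) + ennreal \<kappa> * emeasure M ?B'))"
      proof -
        have m: "(\<lambda>y. g y * indicator ?B' y) \<in> borel_measurable M" "(\<lambda>y. ennreal \<kappa> * \<rho> y) \<in> borel_measurable M"
          "d \<in> borel_measurable M" "(\<lambda>y. ennreal \<kappa> * indicator ?B' y) \<in> borel_measurable M" "\<rho> \<in> borel_measurable M"
          using g \<rho>(1) h(2) by (auto intro!: borel_measurable_M borel_measurable_times borel_measurable_indicator)
        show ?thesis
          using m by (simp add: nn_integral_add nn_integral_cmult nn_integral_cmult_indicator)
      qed
      also have "\<dots> \<le> (\<integral>\<^sup>+y\<in>?B'. g y \<partial>M) + (ennreal \<kappa> * ennreal I + (ennreal \<kappa> + ennreal \<kappa> * ennreal b))"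
        unfolding I(1) b(1) using h(5) by (intro add_left_mono add_right_mono)
      also have "\<dots> = (\<integral>\<^sup>+y\<in>?B'. g y \<partial>M) + ennreal (\<kappa> * I + \<kappa> + \<kappa> * b)"
        using \<kappa>(1) I b by (simp add: ennreal_mult ennreal_plus add.assoc)
      finally show "(\<integral>\<^sup>+y\<in>?B'. pointwise_lip (U n) y \<partial>M) \<le> (\<integral>\<^sup>+y\<in>?B'. g y \<partial>M) + ennreal (\<kappa> * I + \<kappa> + \<kappa> * b)" .
    qed simp
    also have "\<dots> = ennreal (cP * r) * (\<integral>\<^sup>+y\<in>?B'. g y \<partial>M) + ennreal (cP * r) * ennreal (\<kappa> * I + \<kappa> + \<kappa> * b)"
      by (rule distrib_left)
    also have "ennreal (cP * r) * ennreal (\<kappa> * I + \<kappa> + \<kappa> * b) = ennreal e"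
      unfolding \<kappa>(2)[symmetric] using cP \<kappa>(1) I b by (intro ennreal_mult[symmetric]) auto
    finally show ?thesis .
  qed
  have "(\<integral>\<^sup>+y\<in>?B. ennreal \<bar>u y - ?m u\<bar> \<partial>M)
      = (\<integral>\<^sup>+y. liminf (\<lambda>n. ennreal \<bar>U n y - ?m (U n)\<bar> * indicator ?B y) \<partial>M)"
  proof (rule nn_integral_cong)
    fix y
    have "(\<lambda>n. ennreal \<bar>U n y - ?m (U n)\<bar>) \<longlonglongrightarrow> ennreal \<bar>u y - ?m u\<bar>"
      by (intro tendsto_ennrealI tendsto_rabs tendsto_diff Ulim mlim)
    then have "(\<lambda>n. ennreal \<bar>U n y - ?m (U n)\<bar> * indicator ?B y) \<longlonglongrightarrow> ennreal \<bar>u y - ?m u\<bar> * indicator ?B y"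
      by (cases "y \<in> ?B") auto
    then show "ennreal \<bar>u y - ?m u\<bar> * indicator ?B y = liminf (\<lambda>n. ennreal \<bar>U n y - ?m (U n)\<bar> * indicator ?B y)"
      by (intro lim_imp_Liminf[symmetric]) auto
  qed
  also have "\<dots> \<le> liminf (\<lambda>n. \<integral>\<^sup>+y\<in>?B. ennreal \<bar>U n y - ?m (U n)\<bar> \<partial>M)"
  proof (rule nn_integral_liminf)
    fix n
    have "U n \<in> borel_measurable M" using Ucont by (rule continuous_measurable_M)
    then have "(\<lambda>y. ennreal \<bar>U n y - ?m (U n)\<bar>) \<in> borel_measurable M" by measurable
    then show "(\<lambda>y. ennreal \<bar>U n y - ?m (U n)\<bar> * indicator ?B y) \<in> borel_measurable M"
      by (intro borel_measurable_times_ennreal borel_measurable_indicator) auto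
  qed
  also have "\<dots> \<le> ennreal (cP * r) * (\<integral>\<^sup>+y\<in>?B'. g y \<partial>M) + ennreal e"
    by (rule Liminf_le) (simp_all add: each)
  finally show "(\<integral>\<^sup>+y\<in>?B. ennreal \<bar>u y - ?m u\<bar> \<partial>M) \<le> ennreal (cP * r) * (\<integral>\<^sup>+y\<in>?B'. g y \<partial>M) + ennreal e" .
qed

lemma locally_lipschitz_continuous:
  assumes "locally_lipschitz (v :: 'a \<Rightarrow> real)" shows "continuous_on UNIV v"
proof (rule continuous_at_imp_continuous_on, rule ballI)
  fix x
  obtain r L where "r > 0" "L-lipschitz_on (ball x r) v" using assms unfolding locally_lipschitz_def by blast
  then show "isCont v x"
    using lipschitz_on_continuous_on by (intro continuous_on_interior[of "ball x r"]) (auto simp: interior_open)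
qed

text \<open>Truncating at a bound of \<open>v\<close> on the compact closed ball changes nothing
  inside the ball and does not enlarge increments, so the minimal gradient of \<open>v\<close> still
  serves for the truncation.\<close>

lemma poincare_locally_lipschitz:
  assumes P: "poincare_with M cP \<Lambda>" and "0 < r" and v: "locally_lipschitz v"
  shows "(\<integral>\<^sup>+y\<in>ball x r. ennreal \<bar>v y - mean_value M (ball x r) v\<bar> \<partial>M)
    \<le> ennreal (cP * r) * (\<integral>\<^sup>+y\<in>ball x (\<Lambda> * r). minimal_weak_upper_gradient_1 M v y \<partial>M)"
proof -
  let ?g = "minimal_weak_upper_gradient_1 M v"
  have "weak_upper_gradient_1 M v ?g"
    using minimal_weak_upper_gradient_locally_lipschitz[OF v]
    by (simp add: is_minimal_weak_upper_gradient_1_def)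
  then obtain \<rho> where g: "?g \<in> borel_measurable borel" and \<rho>: "upper_gradient_off M \<rho> v ?g"
    using weak_upper_gradient_1_iff by blast
  have cont: "continuous_on UNIV v" by (rule locally_lipschitz_continuous[OF v])
  have "compact (v ` cball x r)"
    using compact_cball by (intro compact_continuous_image continuous_on_subset[OF cont]) auto
  then have "bounded (v ` cball x r)" by (rule compact_imp_bounded)
  then obtain N where "\<forall>z\<in>v ` cball x r. norm z \<le> N" unfolding bounded_iff by blast
  then have N: "\<And>y. y \<in> cball x r \<Longrightarrow> \<bar>v y\<bar> \<le> N" by (metis imageI real_norm_def)
  have "0 \<le> N" using N[of x] \<open>0 < r\<close> by simp
  define u where "u y = max (- N) (min N (v y))" for y
  have "\<bar>u a - u b\<bar> \<le> \<bar>v a - v b\<bar>" for a b unfolding u_def by linarith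
  then have \<rho>u: "upper_gradient_off M \<rho> u ?g"
    using \<rho> unfolding upper_gradient_off_def by (meson ennreal_leI order_trans)
  have u: "continuous_on UNIV u" unfolding u_def[abs_def] by (intro continuous_intros cont)
  have ub: "\<bar>u y\<bar> \<le> N" for y using \<open>0 \<le> N\<close> unfolding u_def by linarith
  have eq: "u y = v y" if "y \<in> ball x r" for y using N[of y] that unfolding u_def by auto
  have "mean_value M (ball x r) u = mean_value M (ball x r) v"
    unfolding mean_value_def using eq
    by (intro arg_cong[where f = "\<lambda>z. _ * z"] set_lebesgue_integral_cong) auto
  then have "(\<integral>\<^sup>+y\<in>ball x r. ennreal \<bar>v y - mean_value M (ball x r) v\<bar> \<partial>M)
      = (\<integral>\<^sup>+y\<in>ball x r. ennreal \<bar>u y - mean_value M (ball x r) u\<bar> \<partial>M)"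
    using eq by (intro nn_integral_cong) (auto simp: indicator_def)
  also have "\<dots> \<le> ennreal (cP * r) * (\<integral>\<^sup>+y\<in>ball x (\<Lambda> * r). ?g y \<partial>M)"
    by (rule poincare_bounded[OF P \<open>0 < r\<close> u ub g \<rho>u])
  finally show ?thesis .
qed

end

section \<open>The energy of a BV function\<close>

lemma liminf_ennreal_cmult:
  fixes a :: "nat \<Rightarrow> ennreal"
  assumes "k < top"
  shows "liminf (\<lambda>j. k * a j) = k * liminf a"
proof -
  have "continuous_on UNIV (\<lambda>x::ennreal. k * x)"
    using assms by (intro ennreal_continuous_on_cmult continuous_on_id)
  from Liminf_compose_continuous_mono[OF this, of sequentially a] show ?thesis
    by (simp add: mono_def mult_left_mono)
qed

lemma le_liminf_if_le_null_add:
  fixes \<alpha> \<beta> :: "nat \<Rightarrow> ennreal"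
  assumes "\<alpha> \<longlonglongrightarrow> 0" "\<And>j. J \<le> \<alpha> j + \<beta> j"
  shows "J \<le> liminf \<beta>"
proof (rule ennreal_le_epsilon)
  fix e :: real assume "e > 0"
  have "eventually (\<lambda>j. \<alpha> j < ennreal e) sequentially"
    using assms(1) \<open>e > 0\<close> by (intro order_tendstoD(2)) auto
  then have "eventually (\<lambda>j. J - ennreal e \<le> \<beta> j) sequentially"
  proof eventually_elim
    case (elim j)
    have "J \<le> ennreal e + \<beta> j" using assms(2)[of j] elim by (meson add_right_mono less_imp_le order_trans)
    then show ?case by (simp add: ennreal_minus_le_iff)
  qed
  then have "J - ennreal e \<le> liminf \<beta>" by (rule Liminf_bounded)
  then show "J \<le> liminf \<beta> + ennreal e" by (simp add: ennreal_minus_le_iff add.commute)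
qed

section \<open>Energies and oscillations over balls\<close>

context complete_doubling
begin

definition energy :: "('a \<Rightarrow> real) \<Rightarrow> real \<Rightarrow> ennreal" where
  "energy u \<epsilon> = (\<integral>\<^sup>+(x, y)\<in>{(x, y). dist x y < \<epsilon>}.
     ennreal (\<bar>u x - u y\<bar> / (sqrt (measure M (ball x \<epsilon>)) * sqrt (measure M (ball y \<epsilon>)))) \<partial>(M \<Otimes>\<^sub>M M))"

text \<open>Stated on measurable rectangles so that Tonelli's theorem applies, and on pairs so that
  sums over a net can be exchanged with the product integral.\<close>

definition oscillation :: "('a \<Rightarrow> real) \<Rightarrow> 'a set \<Rightarrow> 'a set \<Rightarrow> ennreal" where
  "oscillation u A B = (\<integral>\<^sup>+p. ennreal \<bar>u (fst p) - u (snd p)\<bar> * indicator (A \<times> B) p \<partial>(M \<Otimes>\<^sub>M M))"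

lemma oscillation_integrand_measurable:
  assumes "u \<in> borel_measurable M" "A \<in> sets M" "B \<in> sets M"
  shows "(\<lambda>p. ennreal \<bar>u (fst p) - u (snd p)\<bar> * indicator (A \<times> B) p) \<in> borel_measurable (M \<Otimes>\<^sub>M M)"
  using assms by measurable

lemma oscillation_eq:
  assumes "u \<in> borel_measurable M" "A \<in> sets M" "B \<in> sets M"
  shows "oscillation u A B = (\<integral>\<^sup>+x\<in>A. (\<integral>\<^sup>+y\<in>B. ennreal \<bar>u x - u y\<bar> \<partial>M) \<partial>M)"
proof -
  have "oscillation u A B = (\<integral>\<^sup>+x. \<integral>\<^sup>+y. ennreal \<bar>u x - u y\<bar> * indicator (A \<times> B) (x, y) \<partial>M \<partial>M)"
    unfolding oscillation_def
    by (subst nn_integral_fst[OF oscillation_integrand_measurable[OF assms], symmetric]) simp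
  also have "\<dots> = (\<integral>\<^sup>+x\<in>A. (\<integral>\<^sup>+y\<in>B. ennreal \<bar>u x - u y\<bar> \<partial>M) \<partial>M)"
    by (intro nn_integral_cong) (auto simp: indicator_def intro!: nn_integral_cong)
  finally show ?thesis .
qed

lemma oscillation_le:
  assumes u: "u \<in> borel_measurable M" and a: "a \<in> borel_measurable M" and B: "B \<in> sets M"
    and le: "\<And>x y. ennreal \<bar>u x - u y\<bar> \<le> a x + a y"
  shows "oscillation u B B \<le> 2 * emeasure M B * (\<integral>\<^sup>+x\<in>B. a x \<partial>M)"
proof -
  let ?I = "\<integral>\<^sup>+x\<in>B. a x \<partial>M"
  have m: "(\<lambda>x. a x * indicator B x) \<in> borel_measurable M" using a B by measurable
  have "oscillation u B B \<le> (\<integral>\<^sup>+x\<in>B. (\<integral>\<^sup>+y. a x * indicator B y + a y * indicator B y \<partial>M) \<partial>M)"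
    unfolding oscillation_eq[OF u B B]
    by (intro nn_integral_mono mult_right_mono) (auto simp: indicator_def le)
  also have "\<dots> = (\<integral>\<^sup>+x\<in>B. (a x * emeasure M B + ?I) \<partial>M)"
    using m B by (simp add: nn_integral_add nn_integral_cmult_indicator)
  also have "\<dots> = (\<integral>\<^sup>+x. emeasure M B * (a x * indicator B x) + ?I * indicator B x \<partial>M)"
    by (intro nn_integral_cong) (auto simp: indicator_def mult.commute)
  also have "\<dots> = emeasure M B * ?I + ?I * emeasure M B"
    using m B by (simp add: nn_integral_add nn_integral_cmult nn_integral_cmult_indicator)
  also have "\<dots> = 2 * emeasure M B * ?I"
    by (simp only: mult.commute[of ?I "emeasure M B"] mult_2 distrib_right)
  finally show ?thesis .
qed

text \<open>Convergence is given on some ball around each point only; compactness spreads it to all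
  balls.\<close>

lemma tendsto_L1_loc_ball:
  assumes "tendsto_L1_loc M v u" "\<And>j. v j \<in> borel_measurable M" "u \<in> borel_measurable M"
  shows "(\<lambda>j. \<integral>\<^sup>+y\<in>ball x R. ennreal \<bar>v j y - u y\<bar> \<partial>M) \<longlonglongrightarrow> 0"
proof -
  from assms(1) have "\<forall>x. \<exists>r. r > 0 \<and> (\<lambda>j. \<integral>\<^sup>+y\<in>ball x r. ennreal \<bar>v j y - u y\<bar> \<partial>M) \<longlonglongrightarrow> 0"
    unfolding tendsto_L1_loc_def .
  from choice[OF this] obtain r
    where r: "\<And>x. r x > 0" "\<And>x. (\<lambda>j. \<integral>\<^sup>+y\<in>ball x (r x). ennreal \<bar>v j y - u y\<bar> \<partial>M) \<longlonglongrightarrow> 0"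
    by blast
  have "z \<in> ball z (r z)" for z using r(1) by simp
  then have "cball x R \<subseteq> (\<Union>z\<in>UNIV. ball z (r z))" by blast
  then obtain F where F: "finite F" "cball x R \<subseteq> (\<Union>z\<in>F. ball z (r z))"
    using compactE_image[OF compact_cball, of UNIV "\<lambda>z. ball z (r z)" x R] by auto
  have "(\<lambda>j. \<Sum>z\<in>F. \<integral>\<^sup>+y\<in>ball z (r z). ennreal \<bar>v j y - u y\<bar> \<partial>M) \<longlonglongrightarrow> (\<Sum>z\<in>F. 0)"
    using r(2) by (intro tendsto_sum)
  then have lim: "(\<lambda>j. \<Sum>z\<in>F. \<integral>\<^sup>+y\<in>ball z (r z). ennreal \<bar>v j y - u y\<bar> \<partial>M) \<longlonglongrightarrow> 0" by simp
  have "(\<integral>\<^sup>+y\<in>ball x R. ennreal \<bar>v j y - u y\<bar> \<partial>M) \<le> (\<Sum>z\<in>F. \<integral>\<^sup>+y\<in>ball z (r z). ennreal \<bar>v j y - u y\<bar> \<partial>M)" for j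
  proof -
    have "(\<integral>\<^sup>+y\<in>ball x R. ennreal \<bar>v j y - u y\<bar> \<partial>M)
        \<le> (\<integral>\<^sup>+y. (\<Sum>z\<in>F. ennreal \<bar>v j y - u y\<bar> * indicator (ball z (r z)) y) \<partial>M)"
    proof (rule nn_integral_mono)
      fix y
      show "ennreal \<bar>v j y - u y\<bar> * indicator (ball x R) y \<le> (\<Sum>z\<in>F. ennreal \<bar>v j y - u y\<bar> * indicator (ball z (r z)) y)"
      proof (cases "y \<in> ball x R")
        case True
        then have "y \<in> (\<Union>z\<in>F. ball z (r z))" using F(2) ball_subset_cball by blast
        then obtain z where z: "z \<in> F" "y \<in> ball z (r z)" by blast
        then have "ennreal \<bar>v j y - u y\<bar> * indicator (ball x R) y = ennreal \<bar>v j y - u y\<bar> * indicator (ball z (r z)) y"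
          using True by simp
        also have "\<dots> \<le> (\<Sum>z\<in>F. ennreal \<bar>v j y - u y\<bar> * indicator (ball z (r z)) y)"
          using z F(1) by (intro member_le_sum) auto
        finally show ?thesis .
      qed simp
    qed
    also have "\<dots> = (\<Sum>z\<in>F. \<integral>\<^sup>+y\<in>ball z (r z). ennreal \<bar>v j y - u y\<bar> \<partial>M)"
    proof (rule nn_integral_sum)
      fix z
      have "(\<lambda>y. ennreal \<bar>v j y - u y\<bar>) \<in> borel_measurable M" using assms(2)[of j] assms(3) by measurable
      then show "(\<lambda>y. ennreal \<bar>v j y - u y\<bar> * indicator (ball z (r z)) y) \<in> borel_measurable M"
        by (intro borel_measurable_times_ennreal borel_measurable_indicator) auto
    qed
    finally show ?thesis .
  qed
  then show ?thesis
    by (intro tendsto_sandwich[OF _ _ tendsto_const lim] always_eventually allI) auto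
qed

text \<open>The difference of \<open>u\<close> at two points is split through \<open>v j\<close> and
  its mean on the ball: the terms in \<open>v j - u\<close> vanish in the limit, those in
  \<open>v j\<close> minus its mean are bounded by the Poincare inequality.\<close>

lemma oscillation_ball_le_liminf:
  assumes P: "poincare_with M cP \<Lambda>" and r: "0 < r" and u: "u \<in> borel_measurable M"
    and v: "\<And>j. locally_lipschitz (v j)" "tendsto_L1_loc M v u"
  shows "oscillation u (ball i r) (ball i r) \<le> ennreal (2 * measure M (ball i r) * (cP * r)) *
     liminf (\<lambda>j. \<integral>\<^sup>+y\<in>ball i (\<Lambda> * r). minimal_weak_upper_gradient_1 M (v j) y \<partial>M)"
proof -
  let ?B = "ball i r" and ?G = "\<lambda>j. \<integral>\<^sup>+y\<in>ball i (\<Lambda> * r). minimal_weak_upper_gradient_1 M (v j) y \<partial>M"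
  let ?\<mu> = "2 * emeasure M ?B"
  have vm: "v j \<in> borel_measurable M" for j
    by (rule continuous_measurable_M[OF locally_lipschitz_continuous[OF v(1)]])
  have cP: "0 \<le> cP * r" using P r by (simp add: poincare_with_def)
  have \<mu>fin: "?\<mu> < top" by (simp add: emeasure_ball ennreal_mult_less_top)
  have lim: "(\<lambda>j. ?\<mu> * (\<integral>\<^sup>+y\<in>?B. ennreal \<bar>v j y - u y\<bar> \<partial>M)) \<longlonglongrightarrow> ?\<mu> * 0"
    using tendsto_L1_loc_ball[OF v(2) vm u, of i r] \<mu>fin by (intro ennreal_tendsto_cmult)
  have "oscillation u ?B ?B \<le> liminf (\<lambda>j. ?\<mu> * (ennreal (cP * r) * ?G j))"
  proof (rule le_liminf_if_le_null_add)
    show "(\<lambda>j. ?\<mu> * (\<integral>\<^sup>+y\<in>?B. ennreal \<bar>v j y - u y\<bar> \<partial>M)) \<longlonglongrightarrow> 0" using lim by simp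
    fix j
    let ?m = "mean_value M ?B (v j)"
    define a where "a y = ennreal \<bar>v j y - u y\<bar> + ennreal \<bar>v j y - ?m\<bar>" for y
    have m1: "(\<lambda>y. ennreal \<bar>v j y - u y\<bar>) \<in> borel_measurable M" using vm[of j] u by measurable
    have m2: "(\<lambda>y. ennreal \<bar>v j y - ?m\<bar>) \<in> borel_measurable M" using vm[of j] by measurable
    have am: "a \<in> borel_measurable M" unfolding a_def[abs_def] using m1 m2 by measurable
    have "ennreal \<bar>u x - u y\<bar> \<le> a x + a y" for x y
    proof -
      have "ennreal \<bar>u x - u y\<bar> \<le> ennreal ((\<bar>v j x - u x\<bar> + \<bar>v j x - ?m\<bar>) + (\<bar>v j y - u y\<bar> + \<bar>v j y - ?m\<bar>))"
        by (intro ennreal_leI) linarith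
      also have "\<dots> = a x + a y" by (simp add: a_def)
      finally show ?thesis .
    qed
    then have "oscillation u ?B ?B \<le> ?\<mu> * (\<integral>\<^sup>+y\<in>?B. a y \<partial>M)"
      using u am by (intro oscillation_le) auto
    also have "(\<integral>\<^sup>+y\<in>?B. a y \<partial>M)
        = (\<integral>\<^sup>+y\<in>?B. ennreal \<bar>v j y - u y\<bar> \<partial>M) + (\<integral>\<^sup>+y\<in>?B. ennreal \<bar>v j y - ?m\<bar> \<partial>M)"
      unfolding a_def distrib_right
      by (rule nn_integral_add)
         (use m1 m2 in \<open>auto intro!: borel_measurable_times_ennreal borel_measurable_indicator\<close>)
    also have "?\<mu> * \<dots> \<le> ?\<mu> * ((\<integral>\<^sup>+y\<in>?B. ennreal \<bar>v j y - u y\<bar> \<partial>M) + ennreal (cP * r) * ?G j)"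
      by (intro mult_left_mono add_left_mono poincare_locally_lipschitz[OF P r v(1)]) auto
    finally show "oscillation u ?B ?B \<le> ?\<mu> * (\<integral>\<^sup>+y\<in>?B. ennreal \<bar>v j y - u y\<bar> \<partial>M) + ?\<mu> * (ennreal (cP * r) * ?G j)"
      by (simp add: distrib_left)
  qed
  also have "\<dots> = ?\<mu> * (ennreal (cP * r) * liminf ?G)"
    using \<mu>fin by (simp add: liminf_ennreal_cmult)
  also have "\<dots> = ennreal (2 * measure M ?B * (cP * r)) * liminf ?G"
  proof -
    have "?\<mu> = ennreal (2 * measure M ?B)" by (simp add: emeasure_ball ennreal_mult)
    then have "?\<mu> * ennreal (cP * r) = ennreal (2 * measure M ?B * (cP * r))"
      using cP by (simp add: ennreal_mult)
    then show ?thesis by (simp only: mult.assoc[symmetric])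
  qed
  finally show ?thesis .
qed

text \<open>Two ball measures bounded by multiples of one number \<open>m\<close> have a geometric
  mean bounded in the same way, so the symmetric weight can be traded for \<open>1 / m\<close>. The
  opposite estimate is \<open>weight_le\<close>.\<close>

lemma inverse_measure_le_weight:
  assumes "measure M (ball x \<epsilon>) \<le> C * m" "measure M (ball y \<epsilon>) \<le> C * m" "0 < m" "0 < C" "0 < \<epsilon>"
  shows "1 / m \<le> C / (sqrt (measure M (ball x \<epsilon>)) * sqrt (measure M (ball y \<epsilon>)))"
proof -
  have p: "0 < measure M (ball x \<epsilon>)" "0 < measure M (ball y \<epsilon>)" using assms by (auto intro: measure_ball_pos)
  have "sqrt (measure M (ball x \<epsilon>)) * sqrt (measure M (ball y \<epsilon>)) \<le> sqrt (C * m) * sqrt (C * m)"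
    using assms p by (intro mult_mono) auto
  also have "\<dots> = C * m" using assms by simp
  finally have "sqrt (measure M (ball x \<epsilon>)) * sqrt (measure M (ball y \<epsilon>)) \<le> C * m" .
  then show ?thesis using p assms by (simp add: field_simps)
qed

lemma weight_le:
  assumes "m \<le> C * measure M (ball x \<epsilon>)" "m \<le> C * measure M (ball y \<epsilon>)" "0 < m" "0 < C" "0 < \<epsilon>"
  shows "1 / (sqrt (measure M (ball x \<epsilon>)) * sqrt (measure M (ball y \<epsilon>))) \<le> C / m"
proof -
  have p: "0 < measure M (ball x \<epsilon>)" "0 < measure M (ball y \<epsilon>)" using assms by (auto intro: measure_ball_pos)
  have "m = sqrt m * sqrt m" using assms by simp
  also have "\<dots> \<le> sqrt (C * measure M (ball x \<epsilon>)) * sqrt (C * measure M (ball y \<epsilon>))"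
    using assms p by (intro mult_mono) auto
  also have "\<dots> = C * (sqrt (measure M (ball x \<epsilon>)) * sqrt (measure M (ball y \<epsilon>)))"
    using assms by (simp add: real_sqrt_mult)
  finally show ?thesis using p assms by (simp add: field_simps)
qed

text \<open>By symmetry of the distance, the balls containing \<open>y\<close> are those with centre
  in \<open>ball y R\<close>, at most \<open>N\<close> of them.\<close>

lemma nn_integral_net_balls_le:
  assumes N: "\<And>x. finite (D \<inter> ball x R) \<and> card (D \<inter> ball x R) \<le> N" and D: "countable D"
    and G: "G \<in> borel_measurable M"
  shows "(\<integral>\<^sup>+i. (\<integral>\<^sup>+y\<in>ball i R. G y \<partial>M) \<partial>count_space D) \<le> of_nat N * (\<integral>\<^sup>+y. G y \<partial>M)"
proof -
  have "(\<integral>\<^sup>+i. (\<integral>\<^sup>+y\<in>ball i R. G y \<partial>M) \<partial>count_space D)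
      = (\<integral>\<^sup>+y. (\<integral>\<^sup>+i. G y * indicator (ball i R) y \<partial>count_space D) \<partial>M)"
    using D G by (intro nn_integral_count_space_nn_integral[symmetric] borel_measurable_times_ennreal borel_measurable_indicator) auto
  also have "\<dots> \<le> (\<integral>\<^sup>+y. of_nat N * G y \<partial>M)"
  proof (rule nn_integral_mono)
    fix y
    have "(\<integral>\<^sup>+i. G y * indicator (ball i R) y \<partial>count_space D) = (\<Sum>i\<in>D \<inter> ball y R. G y * indicator (ball i R) y)"
      using N[of y] by (intro nn_integral_count_space') (auto simp: dist_commute indicator_def)
    also have "\<dots> \<le> (\<Sum>i\<in>D \<inter> ball y R. G y)" by (intro sum_mono) (auto simp: indicator_def)
    also have "\<dots> = of_nat (card (D \<inter> ball y R)) * G y" by simp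
    also have "\<dots> \<le> of_nat N * G y" using N[of y] by (intro mult_right_mono) auto
    finally show "(\<integral>\<^sup>+i. G y * indicator (ball i R) y \<partial>count_space D) \<le> of_nat N * G y" .
  qed
  also have "\<dots> = of_nat N * (\<integral>\<^sup>+y. G y \<partial>M)" using G by (rule nn_integral_cmult)
  finally show ?thesis .
qed

lemma energy_le_liminf:
  assumes P: "poincare_with M cP \<Lambda>"
  obtains K :: real where "0 \<le> K" "\<And>u v \<epsilon>. 0 < \<epsilon> \<Longrightarrow> u \<in> borel_measurable M \<Longrightarrow> (\<And>j. locally_lipschitz (v j)) \<Longrightarrow>
     tendsto_L1_loc M v u \<Longrightarrow>
     energy u \<epsilon> \<le> ennreal (K * \<epsilon>) * liminf (\<lambda>j. \<integral>\<^sup>+x. minimal_weak_upper_gradient_1 M (v j) x \<partial>M)"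
proof -
  have cP: "0 < cP" and \<Lambda>: "1 \<le> \<Lambda>" using P by (auto simp: poincare_with_def)
  then have "0 < \<Lambda> * 2" by simp
  then obtain N where N: "\<And>r D (x :: 'a). 0 < r \<Longrightarrow> separated r D \<Longrightarrow>
    finite (D \<inter> ball x (\<Lambda> * 2 * r)) \<and> card (D \<inter> ball x (\<Lambda> * 2 * r)) \<le> N"
    using separated_card_bound[of "\<Lambda> * 2"] by blast
  \<comment> \<open>One factor 2 comes from \<open>oscillation_le\<close>, another from the radius
    \<open>2 * \<epsilon>\<close>, the factor \<open>c\<^sup>2\<close> from comparing weights and
    \<open>N\<close> from the overlap.\<close>
  define K where "K = 4 * c\<^sup>2 * cP * real N"
  show ?thesis
  proof (rule that[of K])
    show "0 \<le> K" using cP by (simp add: K_def)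
    fix u :: "'a \<Rightarrow> real" and v :: "nat \<Rightarrow> 'a \<Rightarrow> real" and \<epsilon> :: real
    assume \<epsilon>: "0 < \<epsilon>" and u: "u \<in> borel_measurable M" and v: "\<And>j. locally_lipschitz (v j)" "tendsto_L1_loc M v u"
    obtain D :: "'a set" where D: "net \<epsilon> D" using net_exists[OF \<epsilon>] .
    have sep: "separated \<epsilon> D" using D by (simp add: net_def)
    have cD: "countable D" using separated_countable[OF \<epsilon> sep] .
    \<comment> \<open>If \<open>x\<close> is within \<open>\<epsilon>\<close> of a net point and
      \<open>y\<close> within \<open>\<epsilon>\<close> of \<open>x\<close>, both lie in this ball;
      it is contained in the balls of radius \<open>4 * \<epsilon>\<close> around \<open>x\<close>
      and \<open>y\<close>, two doublings above \<open>\<epsilon>\<close>.\<close>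
    let ?B = "\<lambda>i. ball i (2 * \<epsilon>)"
    let ?\<mu> = "\<lambda>i. measure M (?B i)"
    let ?g = "\<lambda>j. minimal_weak_upper_gradient_1 M (v j)"
    let ?f = "\<lambda>i p. ennreal (c\<^sup>2 / ?\<mu> i) * (ennreal \<bar>u (fst p) - u (snd p)\<bar> * indicator (?B i \<times> ?B i) p)"
    have gm: "?g j \<in> borel_measurable M" for j
    proof (rule borel_measurable_M)
      show "?g j \<in> borel_measurable borel"
        using minimal_weak_upper_gradient_locally_lipschitz[OF v(1)[of j]]
        by (simp add: is_minimal_weak_upper_gradient_1_def weak_upper_gradient_1_def)
    qed
    have \<mu>: "0 < ?\<mu> i" for i using \<epsilon> by (intro measure_ball_pos) auto
    have c0: "0 < c\<^sup>2" using c_ge_1 by simp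
    have "energy u \<epsilon> \<le> (\<integral>\<^sup>+p. (\<integral>\<^sup>+i. ?f i p \<partial>count_space D) \<partial>(M \<Otimes>\<^sub>M M))"
      unfolding energy_def
    proof (rule nn_integral_mono, clarify)
      fix x y
      show "ennreal (\<bar>u x - u y\<bar> / (sqrt (measure M (ball x \<epsilon>)) * sqrt (measure M (ball y \<epsilon>)))) *
          indicator {(x, y). dist x y < \<epsilon>} (x, y) \<le> (\<integral>\<^sup>+i. ?f i (x, y) \<partial>count_space D)"
      proof (cases "dist x y < \<epsilon>")
        case True
        obtain i where i: "i \<in> D" "dist i x < \<epsilon>" using D unfolding net_def by blast
        have iy: "dist i y < 2 * \<epsilon>" using i True dist_triangle[of i y x] by linarith
        have "?\<mu> i \<le> c\<^sup>2 * measure M (ball x \<epsilon>)"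
          by (rule measure_ball_le_pow) (use \<epsilon> i in \<open>auto simp: dist_commute\<close>)
        moreover have "?\<mu> i \<le> c\<^sup>2 * measure M (ball y \<epsilon>)"
          by (rule measure_ball_le_pow) (use \<epsilon> iy in \<open>auto simp: dist_commute\<close>)
        ultimately have "1 / (sqrt (measure M (ball x \<epsilon>)) * sqrt (measure M (ball y \<epsilon>))) \<le> c\<^sup>2 / ?\<mu> i"
          using \<mu> c0 \<epsilon> by (intro weight_le)
        then have "\<bar>u x - u y\<bar> * (1 / (sqrt (measure M (ball x \<epsilon>)) * sqrt (measure M (ball y \<epsilon>)))) \<le> \<bar>u x - u y\<bar> * (c\<^sup>2 / ?\<mu> i)"
          by (intro mult_left_mono) auto
        then have "ennreal (\<bar>u x - u y\<bar> / (sqrt (measure M (ball x \<epsilon>)) * sqrt (measure M (ball y \<epsilon>))))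
            \<le> ennreal (c\<^sup>2 / ?\<mu> i * \<bar>u x - u y\<bar>)" by (intro ennreal_leI) (simp add: mult.commute)
        also have "\<dots> = ?f i (x, y)"
          using i iy \<mu>[of i] \<epsilon> by (subst ennreal_mult) auto
        also have "\<dots> = (\<integral>\<^sup>+i. ?f i (x, y) \<partial>count_space {i})" by (simp add: nn_integral_count_space_finite)
        also have "\<dots> \<le> (\<integral>\<^sup>+i. ?f i (x, y) \<partial>count_space D)"
          using i(1) by (subst (1 2) nn_integral_count_space_indicator) (auto intro!: nn_integral_mono simp: indicator_def)
        finally show ?thesis using True by simp
      qed simp
    qed
    also have "\<dots> = (\<integral>\<^sup>+i. (\<integral>\<^sup>+p. ?f i p \<partial>(M \<Otimes>\<^sub>M M)) \<partial>count_space D)"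
    proof (rule nn_integral_count_space_nn_integral[OF cD])
      show "?f i \<in> borel_measurable (M \<Otimes>\<^sub>M M)" for i
        by (rule borel_measurable_times_ennreal[OF borel_measurable_const oscillation_integrand_measurable[OF u]]) simp_all
    qed
    also have "\<dots> = (\<integral>\<^sup>+i. ennreal (c\<^sup>2 / ?\<mu> i) * oscillation u (?B i) (?B i) \<partial>count_space D)"
      unfolding oscillation_def
      by (intro nn_integral_cong nn_integral_cmult oscillation_integrand_measurable[OF u]) auto
    also have "\<dots> \<le> (\<integral>\<^sup>+i. ennreal (4 * c\<^sup>2 * cP * \<epsilon>) * liminf (\<lambda>j. \<integral>\<^sup>+y\<in>ball i (\<Lambda> * 2 * \<epsilon>). ?g j y \<partial>M) \<partial>count_space D)"
    proof (rule nn_integral_mono)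
      fix i
      have "ennreal (c\<^sup>2 / ?\<mu> i) * oscillation u (?B i) (?B i)
          \<le> ennreal (c\<^sup>2 / ?\<mu> i) * (ennreal (2 * ?\<mu> i * (cP * (2 * \<epsilon>))) *
             liminf (\<lambda>j. \<integral>\<^sup>+y\<in>ball i (\<Lambda> * (2 * \<epsilon>)). ?g j y \<partial>M))"
        using \<epsilon> by (intro mult_left_mono oscillation_ball_le_liminf[OF P _ u v]) auto
      also have "\<dots> = ennreal (c\<^sup>2 / ?\<mu> i * (2 * ?\<mu> i * (cP * (2 * \<epsilon>)))) *
             liminf (\<lambda>j. \<integral>\<^sup>+y\<in>ball i (\<Lambda> * (2 * \<epsilon>)). ?g j y \<partial>M)"
        using \<mu>[of i] cP \<epsilon> by (subst ennreal_mult) (auto simp: mult.assoc)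
      also have "c\<^sup>2 / ?\<mu> i * (2 * ?\<mu> i * (cP * (2 * \<epsilon>))) = 4 * c\<^sup>2 * cP * \<epsilon>"
        using \<mu>[of i] by (simp add: field_simps)
      finally show "ennreal (c\<^sup>2 / ?\<mu> i) * oscillation u (?B i) (?B i)
          \<le> ennreal (4 * c\<^sup>2 * cP * \<epsilon>) * liminf (\<lambda>j. \<integral>\<^sup>+y\<in>ball i (\<Lambda> * 2 * \<epsilon>). ?g j y \<partial>M)"
        by (simp add: mult.assoc)
    qed
    also have "\<dots> = ennreal (4 * c\<^sup>2 * cP * \<epsilon>) * (\<integral>\<^sup>+i. liminf (\<lambda>j. \<integral>\<^sup>+y\<in>ball i (\<Lambda> * 2 * \<epsilon>). ?g j y \<partial>M) \<partial>count_space D)"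
      by (rule nn_integral_cmult) simp
    also have "\<dots> \<le> ennreal (4 * c\<^sup>2 * cP * \<epsilon>) * (of_nat N * liminf (\<lambda>j. \<integral>\<^sup>+y. ?g j y \<partial>M))"
    \<comment> \<open>Fatou's lemma for sums over the net: each ball has its own lower limit, but
      along the same sequence \<open>v\<close>, so the sum of these is at most the lower limit of
      the sums.\<close>
    proof (rule mult_left_mono)
      have "(\<integral>\<^sup>+i. liminf (\<lambda>j. \<integral>\<^sup>+y\<in>ball i (\<Lambda> * 2 * \<epsilon>). ?g j y \<partial>M) \<partial>count_space D)
          \<le> liminf (\<lambda>j. \<integral>\<^sup>+i. (\<integral>\<^sup>+y\<in>ball i (\<Lambda> * 2 * \<epsilon>). ?g j y \<partial>M) \<partial>count_space D)"
        by (rule nn_integral_liminf) simp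
      also have "\<dots> \<le> liminf (\<lambda>j. of_nat N * (\<integral>\<^sup>+y. ?g j y \<partial>M))"
        by (intro Liminf_mono always_eventually allI nn_integral_net_balls_le[OF N[OF \<epsilon> sep] cD gm])
      also have "\<dots> = of_nat N * liminf (\<lambda>j. \<integral>\<^sup>+y. ?g j y \<partial>M)"
        by (rule liminf_ennreal_cmult) (simp add: of_nat_less_top)
      finally show "(\<integral>\<^sup>+i. liminf (\<lambda>j. \<integral>\<^sup>+y\<in>ball i (\<Lambda> * 2 * \<epsilon>). ?g j y \<partial>M) \<partial>count_space D)
          \<le> of_nat N * liminf (\<lambda>j. \<integral>\<^sup>+y. ?g j y \<partial>M)" .
    qed simp
    also have "\<dots> = ennreal (K * \<epsilon>) * liminf (\<lambda>j. \<integral>\<^sup>+y. ?g j y \<partial>M)"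
    proof -
      have "K * \<epsilon> = 4 * c\<^sup>2 * cP * \<epsilon> * real N" by (simp add: K_def)
      then have "ennreal (K * \<epsilon>) = ennreal (4 * c\<^sup>2 * cP * \<epsilon>) * of_nat N"
        using cP \<epsilon> by (simp only: ennreal_mult'' ennreal_of_nat_eq_real_of_nat of_nat_0_le_iff)
      then show ?thesis by (simp add: mult.assoc)
    qed
    finally show "energy u \<epsilon> \<le> ennreal (K * \<epsilon>) * liminf (\<lambda>j. \<integral>\<^sup>+x. ?g j x \<partial>M)" .
  qed
qed

end

section \<open>Discrete convolutions\<close>

text \<open>The integrand of the energy is not known to be measurable for the product sigma-algebra, so
  the library's \<open>nn_integral_cmult\<close> does not apply to it.\<close>

lemma nn_integral_cmult_le:
  assumes "0 \<le> k"
  shows "(\<integral>\<^sup>+x. ennreal k * f x \<partial>N) \<le> ennreal k * (\<integral>\<^sup>+x. f x \<partial>N)"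
proof (cases "k = 0")
  case False
  with assms have k: "0 < k" by simp
  show ?thesis
    unfolding nn_integral_def[of N "\<lambda>x. ennreal k * f x"]
  proof (rule SUP_least, clarify)
    \<comment> \<open>The integral is a supremum over simple functions below the integrand, and
      dividing such a function by \<open>k\<close> gives one below \<open>f\<close>.\<close>
    fix g assume g: "simple_function N g" "g \<le> (\<lambda>x. ennreal k * f x)"
    have kk: "ennreal k * (ennreal (1 / k) * z) = z" for z
      using k by (simp add: mult.assoc[symmetric] ennreal_mult[symmetric])
    have "integral\<^sup>S N g = (\<integral>\<^sup>+x. g x \<partial>N)" by (rule nn_integral_eq_simple_integral[OF g(1), symmetric])
    also have "\<dots> = (\<integral>\<^sup>+x. ennreal k * (ennreal (1 / k) * g x) \<partial>N)" by (simp only: kk)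
    also have "\<dots> = ennreal k * (\<integral>\<^sup>+x. ennreal (1 / k) * g x \<partial>N)"
      using borel_measurable_simple_function[OF g(1)] by (intro nn_integral_cmult) measurable
    also have "\<dots> \<le> ennreal k * (\<integral>\<^sup>+x. f x \<partial>N)"
    proof (intro mult_left_mono nn_integral_mono)
      fix x
      have "ennreal (1 / k) * g x \<le> ennreal (1 / k) * (ennreal k * f x)"
        using g(2) by (intro mult_left_mono) (auto simp: le_fun_def)
      also have "\<dots> = f x" using k by (simp add: mult.assoc[symmetric] ennreal_mult[symmetric])
      finally show "ennreal (1 / k) * g x \<le> f x" .
    qed simp
    finally show "integral\<^sup>S N g \<le> ennreal k * (\<integral>\<^sup>+x. f x \<partial>N)" .
  qed
qed simp

section \<open>Averages over a net\<close>

context complete_doubling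
begin

text \<open>The Lipschitz partition of unity in quotient form, with tents as weights. Cutting the
  sums to \<open>ball x (2 * r)\<close> makes them finite over a net and removes only vanishing
  tents.\<close>

definition net_average :: "real \<Rightarrow> 'a set \<Rightarrow> ('a \<Rightarrow> real) \<Rightarrow> 'a \<Rightarrow> real" where
  "net_average r D m x = (\<Sum>i\<in>D \<inter> ball x (2 * r). m i * max 0 (2 * r - dist i x)) /
     (\<Sum>i\<in>D \<inter> ball x (2 * r). max 0 (2 * r - dist i x))"

text \<open>On one ball of the net the index set can be taken independent of \<open>x\<close>, so
  that values at two points are compared term by term. The tent of \<open>j\<close> alone exceeds
  \<open>r\<close> there, which keeps the denominator away from 0.\<close>

lemma net_average_on_ball:
  assumes D: "net r D" "0 < r" and j: "j \<in> D" "dist j x < r"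
  defines "F \<equiv> D \<inter> ball j (3 * r)" and "\<psi> \<equiv> \<lambda>i x. max 0 (2 * r - dist i x)"
  shows "net_average r D m x = (\<Sum>i\<in>F. m i * \<psi> i x) / (\<Sum>i\<in>F. \<psi> i x)" "r \<le> (\<Sum>i\<in>F. \<psi> i x)"
proof -
  have fin: "finite F" unfolding F_def using D by (intro separated_finite_ball[of r]) (auto simp: net_def)
  have sub: "D \<inter> ball x (2 * r) \<subseteq> F"
  proof
    fix i assume i: "i \<in> D \<inter> ball x (2 * r)"
    then have "dist j i < 3 * r" using j dist_triangle[of j i x] by auto
    then show "i \<in> F" using i by (simp add: F_def)
  qed
  have z: "\<psi> i x = 0" if "i \<in> F - D \<inter> ball x (2 * r)" for i
    using that by (auto simp: F_def \<psi>_def dist_commute)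
  have "(\<Sum>i\<in>D \<inter> ball x (2 * r). m i * \<psi> i x) = (\<Sum>i\<in>F. m i * \<psi> i x)"
    using z by (intro sum.mono_neutral_left[OF fin sub]) auto
  moreover have "(\<Sum>i\<in>D \<inter> ball x (2 * r). \<psi> i x) = (\<Sum>i\<in>F. \<psi> i x)"
    using z by (intro sum.mono_neutral_left[OF fin sub]) auto
  ultimately show "net_average r D m x = (\<Sum>i\<in>F. m i * \<psi> i x) / (\<Sum>i\<in>F. \<psi> i x)"
    by (simp add: net_average_def \<psi>_def)
  have "r \<le> \<psi> j x" using j by (simp add: \<psi>_def)
  also have "\<dots> \<le> (\<Sum>i\<in>F. \<psi> i x)"
    using fin j D(2) by (intro member_le_sum) (auto simp: F_def \<psi>_def)
  finally show "r \<le> (\<Sum>i\<in>F. \<psi> i x)" .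
qed

text \<open>The value is a weighted mean, and each normalised weight is at most 1.\<close>

lemma net_average_close:
  assumes D: "net r D" "0 < r" and j: "j \<in> D" "dist j x < r"
  shows "\<bar>net_average r D m x - a\<bar> \<le> (\<Sum>i\<in>D \<inter> ball j (3 * r). \<bar>m i - a\<bar>)"
proof -
  let ?F = "D \<inter> ball j (3 * r)" and ?\<psi> = "\<lambda>i. max 0 (2 * r - dist i x)"
  let ?S = "\<Sum>i\<in>?F. ?\<psi> i"
  have fin: "finite ?F" using D by (intro separated_finite_ball[of r]) (auto simp: net_def)
  have S: "0 < ?S" using net_average_on_ball(2)[OF D j] D(2) by linarith
  have \<psi>S: "?\<psi> i \<le> ?S" if "i \<in> ?F" for i using that fin by (intro member_le_sum) auto
  have eq: "net_average r D m x - a = (\<Sum>i\<in>?F. (m i - a) * ?\<psi> i) / ?S"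
    unfolding net_average_on_ball(1)[OF D j] using S
    by (simp add: left_diff_distrib sum_subtractf sum_distrib_left[symmetric] diff_divide_distrib)
  have "\<bar>net_average r D m x - a\<bar> = \<bar>\<Sum>i\<in>?F. (m i - a) * ?\<psi> i\<bar> / ?S"
    unfolding eq abs_divide using abs_of_pos[OF S] by simp
  also have "\<dots> \<le> (\<Sum>i\<in>?F. \<bar>(m i - a) * ?\<psi> i\<bar>) / ?S"
    by (rule divide_right_mono[OF sum_abs less_imp_le[OF S]])
  also have "\<dots> \<le> (\<Sum>i\<in>?F. \<bar>m i - a\<bar> * ?S) / ?S"
  proof (rule divide_right_mono[OF sum_mono less_imp_le[OF S]])
    fix i assume "i \<in> ?F"
    then show "\<bar>(m i - a) * ?\<psi> i\<bar> \<le> \<bar>m i - a\<bar> * ?S"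
      unfolding abs_mult using \<psi>S[of i] by (intro mult_left_mono) auto
  qed
  also have "\<dots> = (\<Sum>i\<in>?F. \<bar>m i - a\<bar>)" using S by (simp add: sum_distrib_right[symmetric])
  finally show ?thesis .
qed

text \<open>A quotient estimate with denominator at least \<open>r\<close>. Subtracting
  \<open>m j\<close> first leaves only differences of means, which are what the energy
  controls.\<close>

lemma net_average_lipschitz:
  assumes D: "net r D" "0 < r" and j: "j \<in> D" "dist j x < r" "dist j y < r"
    and N: "card (D \<inter> ball j (3 * r)) \<le> N"
  shows "\<bar>net_average r D m x - net_average r D m y\<bar>
    \<le> (1 + real N) / r * (\<Sum>i\<in>D \<inter> ball j (3 * r). \<bar>m i - m j\<bar>) * dist x y"
proof -
  let ?F = "D \<inter> ball j (3 * r)" and ?\<psi> = "\<lambda>i x. max 0 (2 * r - dist i x)"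
  let ?S = "\<lambda>x. \<Sum>i\<in>?F. ?\<psi> i x" and ?A = "\<Sum>i\<in>?F. \<bar>m i - m j\<bar>"
  let ?T = "\<lambda>x. \<Sum>i\<in>?F. (m i - m j) * ?\<psi> i x"
  let ?v = "\<lambda>x. net_average r D m x - m j"
  have S: "r \<le> ?S x" "r \<le> ?S y" using net_average_on_ball(2)[OF D] j by auto
  then have S0: "0 < ?S x" "0 < ?S y" using D(2) by linarith+
  have A: "0 \<le> ?A" by (intro sum_nonneg) auto
  have \<psi>lip: "\<bar>?\<psi> i x - ?\<psi> i y\<bar> \<le> dist x y" for i
    using dist_triangle[of i x y] dist_triangle[of i y x] by (auto simp: dist_commute)
  have v: "?v z * ?S z = ?T z" if "dist j z < r" for z
  proof -
    have "?S z \<noteq> 0" using net_average_on_ball(2)[OF D j(1) that] D(2) by linarith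
    then show ?thesis
      unfolding net_average_on_ball(1)[OF D j(1) that]
      by (simp add: left_diff_distrib sum_subtractf sum_distrib_left[symmetric])
  qed
  have Tlip: "\<bar>?T x - ?T y\<bar> \<le> ?A * dist x y"
  proof -
    have "\<bar>?T x - ?T y\<bar> = \<bar>\<Sum>i\<in>?F. (m i - m j) * (?\<psi> i x - ?\<psi> i y)\<bar>"
      by (simp add: right_diff_distrib sum_subtractf)
    also have "\<dots> \<le> (\<Sum>i\<in>?F. \<bar>(m i - m j) * (?\<psi> i x - ?\<psi> i y)\<bar>)" by (rule sum_abs)
    also have "\<dots> \<le> (\<Sum>i\<in>?F. \<bar>m i - m j\<bar> * dist x y)"
      unfolding abs_mult by (intro sum_mono mult_left_mono \<psi>lip) auto
    finally show ?thesis by (simp add: sum_distrib_right)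
  qed
  have Slip: "\<bar>?S x - ?S y\<bar> \<le> real N * dist x y"
  proof -
    have "\<bar>?S x - ?S y\<bar> = \<bar>\<Sum>i\<in>?F. ?\<psi> i x - ?\<psi> i y\<bar>" by (simp add: sum_subtractf)
    also have "\<dots> \<le> (\<Sum>i\<in>?F. \<bar>?\<psi> i x - ?\<psi> i y\<bar>)" by (rule sum_abs)
    also have "\<dots> \<le> (\<Sum>i\<in>?F. dist x y)" by (intro sum_mono \<psi>lip)
    also have "\<dots> = real (card ?F) * dist x y" by simp
    also have "\<dots> \<le> real N * dist x y" using N by (intro mult_right_mono) auto
    finally show ?thesis .
  qed
  have vy: "\<bar>?v y\<bar> \<le> ?A" by (rule net_average_close[OF D j(1,3)])
  \<comment> \<open>The quotient rule in difference form, from \<open>?v * ?S = ?T\<close> at both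
    points.\<close>
  have "(?v x - ?v y) * ?S x = (?T x - ?T y) - ?v y * (?S x - ?S y)"
    using v[OF j(2)] v[OF j(3)] by (simp add: algebra_simps)
  then have "\<bar>?v x - ?v y\<bar> * ?S x = \<bar>(?T x - ?T y) - ?v y * (?S x - ?S y)\<bar>"
    using abs_mult[of "?v x - ?v y" "?S x"] abs_of_pos[OF S0(1)] by simp
  also have "\<dots> \<le> \<bar>?T x - ?T y\<bar> + \<bar>?v y\<bar> * \<bar>?S x - ?S y\<bar>"
    using abs_triangle_ineq4[of "?T x - ?T y" "?v y * (?S x - ?S y)"] by (simp only: abs_mult)
  also have "\<dots> \<le> ?A * dist x y + ?A * (real N * dist x y)"
    using Tlip Slip vy A by (intro add_mono mult_mono) auto
  also have "\<dots> = (1 + real N) * ?A * dist x y" by (simp add: algebra_simps)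
  finally have "\<bar>?v x - ?v y\<bar> * ?S x \<le> (1 + real N) * ?A * dist x y" .
  moreover have "\<bar>?v x - ?v y\<bar> * r \<le> \<bar>?v x - ?v y\<bar> * ?S x" using S by (intro mult_left_mono) auto
  ultimately have "\<bar>?v x - ?v y\<bar> * r \<le> (1 + real N) * ?A * dist x y" by linarith
  then show ?thesis using D(2) by (simp add: field_simps)
qed

lemma mean_value_close:
  assumes u: "integrable M u" and "0 < r"
  shows "ennreal \<bar>mean_value M (ball i r) u - z\<bar>
    \<le> ennreal (1 / measure M (ball i r)) * (\<integral>\<^sup>+y\<in>ball i r. ennreal \<bar>u y - z\<bar> \<partial>M)"
proof -
  let ?B = "ball i r"
  let ?\<mu> = "measure M ?B"
  have \<mu>: "0 < ?\<mu>" using assms(2) by (rule measure_ball_pos)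
  have iu: "integrable M (\<lambda>y. indicator ?B y *\<^sub>R u y)" by (rule integrable_mult_indicator[OF _ u]) simp
  have iz: "integrable M (\<lambda>y. indicator ?B y *\<^sub>R z)"
    by (intro integrable_scaleR_left integrable_real_indicator) (auto simp: emeasure_ball)
  have "(LINT y|M. indicator ?B y *\<^sub>R z) = ?\<mu> * z" by (simp add: space_M)
  then have "mean_value M ?B u - z = (1 / ?\<mu>) * (LINT y|M. indicator ?B y *\<^sub>R u y - indicator ?B y *\<^sub>R z)"
    unfolding mean_value_def set_lebesgue_integral_def
    using \<mu> by (subst Bochner_Integration.integral_diff[OF iu iz]) (simp add: right_diff_distrib)
  then have "ennreal \<bar>mean_value M ?B u - z\<bar>
      = ennreal (1 / ?\<mu>) * ennreal (norm (LINT y|M. indicator ?B y *\<^sub>R u y - indicator ?B y *\<^sub>R z))"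
    using \<mu> by (simp add: abs_mult ennreal_mult[symmetric])
  also have "\<dots> \<le> ennreal (1 / ?\<mu>) * (\<integral>\<^sup>+y. ennreal (norm (indicator ?B y *\<^sub>R u y - indicator ?B y *\<^sub>R z)) \<partial>M)"
    by (intro mult_left_mono integral_norm_bound_ennreal Bochner_Integration.integrable_diff iu iz) auto
  also have "(\<integral>\<^sup>+y. ennreal (norm (indicator ?B y *\<^sub>R u y - indicator ?B y *\<^sub>R z)) \<partial>M) = (\<integral>\<^sup>+y\<in>?B. ennreal \<bar>u y - z\<bar> \<partial>M)"
    by (intro nn_integral_cong) (auto simp: indicator_def)
  finally show ?thesis .
qed

text \<open>One scale of the energy controls both the approximation error and the gradient; the
  gradient bound carries an extra \<open>1 / \<epsilon>\<close> because the partition of unity has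
  slopes of that order.\<close>

lemma discrete_convolution:
  obtains K :: real where "0 \<le> K" "\<And>u \<epsilon>. 0 < \<epsilon> \<Longrightarrow> integrable M u \<Longrightarrow>
    \<exists>v g. locally_lipschitz v \<and> weak_upper_gradient_1 M v g \<and> locally_L1 M g \<and>
      (\<integral>\<^sup>+x. ennreal \<bar>v x - u x\<bar> \<partial>M) \<le> ennreal K * energy u \<epsilon> \<and>
      (\<integral>\<^sup>+x. g x \<partial>M) \<le> ennreal (K / \<epsilon>) * energy u \<epsilon>"
proof -
  obtain N where N: "\<And>r D (x :: 'a). 0 < r \<Longrightarrow> separated r D \<Longrightarrow>
    finite (D \<inter> ball x (3 * r)) \<and> card (D \<inter> ball x (3 * r)) \<le> N"
    using separated_card_bound[of 3] by auto
  \<comment> \<open>With \<open>\<epsilon> = 10 * r\<close>, \<open>x \<in> ball j r\<close>,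
    \<open>y \<in> ball i r\<close> and \<open>dist j i < 3 * r\<close>, the balls of radius
    \<open>\<epsilon>\<close> at \<open>x\<close> and \<open>y\<close> lie in
    \<open>ball i (16 * r)\<close>: four doublings. The square of \<open>N\<close> counts the pairs
    of indices for given points.\<close>
  define K0 where "K0 = (real N)\<^sup>2 * c ^ 4"
  \<comment> \<open>The factor 10 is \<open>\<epsilon> / r\<close>, and \<open>1 + real N\<close>
    comes from \<open>net_average_lipschitz\<close>.\<close>
  define K where "K = K0 * (1 + (1 + real N) * 10)"
  have c0: "0 < c ^ 4" using c_ge_1 by simp
  have K0: "0 \<le> K0" using c0 by (simp add: K0_def)
  have K: "0 \<le> K" "K0 \<le> K" "(1 + real N) * 10 * K0 \<le> K"
  proof -
    have "0 \<le> K0 * ((1 + real N) * 10)" using K0 by (intro mult_nonneg_nonneg) auto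
    moreover have "K = K0 + K0 * ((1 + real N) * 10)" by (simp add: K_def algebra_simps)
    ultimately show "0 \<le> K" "K0 \<le> K" "(1 + real N) * 10 * K0 \<le> K" using K0 by (auto simp: mult.commute)
  qed
  show ?thesis
  proof (rule that[OF K(1)])
    fix u :: "'a \<Rightarrow> real" and \<epsilon> :: real
    assume \<epsilon>: "0 < \<epsilon>" and u: "integrable M u"
    have um: "u \<in> borel_measurable M" using u by simp
    define r where "r = \<epsilon> / 10"
    have r: "0 < r" "\<epsilon> = 10 * r" using \<epsilon> by (auto simp: r_def)
    obtain D :: "'a set" where D: "net r D" using net_exists[OF r(1)] .
    have sep: "separated r D" using D by (simp add: net_def)
    have cD: "countable D" using separated_countable[OF r(1) sep] .
    let ?\<mu> = "\<lambda>i. measure M (ball i r)"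
    have \<mu>: "0 < ?\<mu> i" for i using r by (intro measure_ball_pos)
    let ?F = "\<lambda>j. D \<inter> ball j (3 * r)"
    have F: "finite (?F x)" "card (?F x) \<le> N" for x using N[OF r(1) sep, of x] by auto
    define m where "m i = mean_value M (ball i r) u" for i
    define v where "v = net_average r D m"
    define a where "a j = (1 + real N) / r * (\<Sum>i\<in>?F j. \<bar>m i - m j\<bar>)" for j
    define g where "g = net_gradient r D a"
    let ?O = "\<lambda>j i. ennreal (1 / ?\<mu> i) * oscillation u (ball j r) (ball i r)"
    \<comment> \<open>The distance of \<open>v\<close> from \<open>u\<close>, and up to a factor
      also the integral of the gradient, are bounded by this sum of normalised oscillations over
      neighbouring balls.\<close>
    define Q where "Q = (\<integral>\<^sup>+j. (\<Sum>i\<in>?F j. ?O j i) \<partial>count_space D)"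
    have a0: "0 \<le> a j" for j unfolding a_def using r(1) by (intro mult_nonneg_nonneg sum_nonneg divide_nonneg_pos) auto
    have lip: "\<bar>v x - v y\<bar> \<le> a j * dist x y" if "j \<in> D" "x \<in> ball j r" "y \<in> ball j r" for j x y
      unfolding v_def a_def using net_average_lipschitz[OF D r(1) that(1) _ _ F(2)] that by simp
    have "locally_lipschitz v"
      unfolding locally_lipschitz_def
    proof
      fix x
      obtain j where j: "j \<in> D" "dist j x < r" using D unfolding net_def by blast
      have "(a j)-lipschitz_on (ball j r) v"
        using lip[OF j(1)] a0[of j] by (intro lipschitz_onI) (auto simp: dist_real_def)
      moreover have "ball x (r - dist j x) \<subseteq> ball j r"
      proof
        fix y assume "y \<in> ball x (r - dist j x)"
        then show "y \<in> ball j r" using dist_triangle[of j y x] by simp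
      qed
      ultimately have "(a j)-lipschitz_on (ball x (r - dist j x)) v" by (rule lipschitz_on_subset)
      then show "\<exists>r>0. \<exists>L. L-lipschitz_on (ball x r) v" using j(2) by (intro exI[of _ "r - dist j x"]) auto
    qed
    moreover have "weak_upper_gradient_1 M v g"
      unfolding g_def by (rule net_gradient_wug[OF r(1) D lip a0])
    moreover have "locally_L1 M g" unfolding g_def by (rule net_gradient_locally_L1[OF r(1) D])
    moreover have Q: "Q \<le> ennreal K0 * energy u \<epsilon>"
    proof -
      let ?W = "\<lambda>x y. \<bar>u x - u y\<bar> / (sqrt (measure M (ball x \<epsilon>)) * sqrt (measure M (ball y \<epsilon>)))"
      let ?h = "\<lambda>j i p. ennreal (1 / ?\<mu> i) * (ennreal \<bar>u (fst p) - u (snd p)\<bar> * indicator (ball j r \<times> ball i r) p)"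
      have hm: "?h j i \<in> borel_measurable (M \<Otimes>\<^sub>M M)" for j i
        by (rule borel_measurable_times_ennreal[OF borel_measurable_const oscillation_integrand_measurable[OF um]]) simp_all
      have hO: "(\<integral>\<^sup>+p. ?h j i p \<partial>(M \<Otimes>\<^sub>M M)) = ?O j i" for j i
        unfolding oscillation_def
        by (rule nn_integral_cmult[OF oscillation_integrand_measurable[OF um]]) simp_all
      have "Q = (\<integral>\<^sup>+j. (\<integral>\<^sup>+p. (\<Sum>i\<in>?F j. ?h j i p) \<partial>(M \<Otimes>\<^sub>M M)) \<partial>count_space D)"
        unfolding Q_def hO[symmetric] using hm by (intro nn_integral_cong nn_integral_sum[symmetric])
      also have "\<dots> = (\<integral>\<^sup>+p. (\<integral>\<^sup>+j. (\<Sum>i\<in>?F j. ?h j i p) \<partial>count_space D) \<partial>(M \<Otimes>\<^sub>M M))"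
        using hm by (intro nn_integral_count_space_nn_integral[OF cD, symmetric] borel_measurable_sum)
      also have "\<dots> \<le> (\<integral>\<^sup>+(x, y). ennreal K0 * (ennreal (?W x y) * indicator {(x, y). dist x y < \<epsilon>} (x, y)) \<partial>(M \<Otimes>\<^sub>M M))"
      proof (rule nn_integral_mono, clarify)
        fix x y
        let ?R = "ennreal (c ^ 4 * ?W x y) * indicator {(x, y). dist x y < \<epsilon>} (x, y)"
        have each: "?h j i (x, y) \<le> ?R" if i: "i \<in> ?F j" for i j
        proof (cases "x \<in> ball j r \<and> y \<in> ball i r")
          case True
          have d: "dist j x < r" "dist i y < r" "dist j i < 3 * r" using True i by auto
          have ix: "dist i x < 4 * r" using d dist_triangle[of i x j] by (simp add: dist_commute)
          have xy: "dist x y < \<epsilon>" using d ix dist_triangle[of x y i] r by (simp add: dist_commute)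
          have "measure M (ball x \<epsilon>) \<le> c ^ 4 * ?\<mu> i"
            by (rule measure_ball_le_pow) (use r ix in auto)
          moreover have "measure M (ball y \<epsilon>) \<le> c ^ 4 * ?\<mu> i"
            by (rule measure_ball_le_pow) (use r d in auto)
          ultimately have "1 / ?\<mu> i \<le> c ^ 4 / (sqrt (measure M (ball x \<epsilon>)) * sqrt (measure M (ball y \<epsilon>)))"
            using \<mu>[of i] c0 \<epsilon> by (rule inverse_measure_le_weight)
          then have "(1 / ?\<mu> i) * \<bar>u x - u y\<bar> \<le> c ^ 4 / (sqrt (measure M (ball x \<epsilon>)) * sqrt (measure M (ball y \<epsilon>))) * \<bar>u x - u y\<bar>"
            by (rule mult_right_mono) simp
          then have "(1 / ?\<mu> i) * \<bar>u x - u y\<bar> \<le> c ^ 4 * ?W x y" by simp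
          then have "ennreal ((1 / ?\<mu> i) * \<bar>u x - u y\<bar>) \<le> ennreal (c ^ 4 * ?W x y)" by (rule ennreal_leI)
          moreover have "ennreal ((1 / ?\<mu> i) * \<bar>u x - u y\<bar>) = ennreal (1 / ?\<mu> i) * ennreal \<bar>u x - u y\<bar>"
            using \<mu>[of i] by (intro ennreal_mult) auto
          ultimately have "ennreal (1 / ?\<mu> i) * ennreal \<bar>u x - u y\<bar> \<le> ennreal (c ^ 4 * ?W x y)"
            by (simp only:)
          then show ?thesis using True xy by simp
        qed auto
        have "(\<integral>\<^sup>+j. (\<Sum>i\<in>?F j. ?h j i (x, y)) \<partial>count_space D) = (\<Sum>j\<in>?F x. \<Sum>i\<in>?F j. ?h j i (x, y))"
        proof (rule nn_integral_count_space'[OF F(1)])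
          fix j assume j: "j \<in> D" "j \<notin> ?F x"
          then have "x \<notin> ball j r" using r(1) by (auto simp: dist_commute)
          then show "(\<Sum>i\<in>?F j. ?h j i (x, y)) = 0" by (intro sum.neutral) auto
        qed auto
        also have "\<dots> \<le> (\<Sum>j\<in>?F x. \<Sum>i\<in>?F j. ?R)" by (intro sum_mono each)
        also have "\<dots> \<le> (\<Sum>j\<in>?F x. of_nat N * ?R)"
        proof (rule sum_mono)
          fix j
          have "(\<Sum>i\<in>?F j. ?R) = of_nat (card (?F j)) * ?R" by simp
          also have "\<dots> \<le> of_nat N * ?R" using F(2)[of j] by (intro mult_right_mono) auto
          finally show "(\<Sum>i\<in>?F j. ?R) \<le> of_nat N * ?R" .
        qed
        also have "\<dots> = of_nat (card (?F x)) * (of_nat N * ?R)" by simp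
        also have "\<dots> \<le> of_nat N * (of_nat N * ?R)" using F(2)[of x] by (intro mult_right_mono) auto
        also have "\<dots> = ennreal K0 * (ennreal (?W x y) * indicator {(x, y). dist x y < \<epsilon>} (x, y))"
        proof -
          have "ennreal K0 = of_nat N * of_nat N * ennreal (c ^ 4)"
            using c0 by (simp add: K0_def ennreal_mult power2_eq_square ennreal_of_nat_eq_real_of_nat)
          moreover have "ennreal (c ^ 4 * ?W x y) = ennreal (c ^ 4) * ennreal (?W x y)"
            using c0 by (intro ennreal_mult) auto
          ultimately show ?thesis by (simp only: mult.assoc)
        qed
        finally show "(\<integral>\<^sup>+j. (\<Sum>i\<in>?F j. ?h j i (x, y)) \<partial>count_space D)
            \<le> ennreal K0 * (ennreal (?W x y) * indicator {(x, y). dist x y < \<epsilon>} (x, y))" .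
      qed
      also have "\<dots> \<le> ennreal K0 * energy u \<epsilon>"
        unfolding energy_def case_prod_beta' prod.collapse by (rule nn_integral_cmult_le[OF K0])
      finally show ?thesis .
    qed
    moreover have "(\<integral>\<^sup>+x. ennreal \<bar>v x - u x\<bar> \<partial>M) \<le> ennreal K * energy u \<epsilon>"
    proof -
      have "(\<integral>\<^sup>+x. ennreal \<bar>v x - u x\<bar> \<partial>M)
          \<le> (\<integral>\<^sup>+x. (\<integral>\<^sup>+j. ennreal \<bar>v x - u x\<bar> * indicator (ball j r) x \<partial>count_space D) \<partial>M)"
      proof (rule nn_integral_mono)
        fix x
        obtain j where j: "j \<in> D" "dist j x < r" using D unfolding net_def by blast
        have "ennreal \<bar>v x - u x\<bar> = (\<integral>\<^sup>+j. ennreal \<bar>v x - u x\<bar> * indicator (ball j r) x \<partial>count_space {j})"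
          using j by (simp add: nn_integral_count_space_finite)
        also have "\<dots> \<le> (\<integral>\<^sup>+j. ennreal \<bar>v x - u x\<bar> * indicator (ball j r) x \<partial>count_space D)"
          using j(1) by (subst (1 2) nn_integral_count_space_indicator) (auto intro!: nn_integral_mono simp: indicator_def)
        finally show "ennreal \<bar>v x - u x\<bar> \<le> (\<integral>\<^sup>+j. ennreal \<bar>v x - u x\<bar> * indicator (ball j r) x \<partial>count_space D)" .
      qed
      also have "\<dots> = (\<integral>\<^sup>+j. (\<integral>\<^sup>+x. ennreal \<bar>v x - u x\<bar> * indicator (ball j r) x \<partial>M) \<partial>count_space D)"
      proof (rule nn_integral_count_space_nn_integral[OF cD])
        have "v \<in> borel_measurable M"
          by (rule continuous_measurable_M[OF locally_lipschitz_continuous[OF \<open>locally_lipschitz v\<close>]])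
        then have "(\<lambda>x. ennreal \<bar>v x - u x\<bar>) \<in> borel_measurable M" using um by measurable
        then show "(\<lambda>x. ennreal \<bar>v x - u x\<bar> * indicator (ball j r) x) \<in> borel_measurable M" for j
          by (intro borel_measurable_times_ennreal borel_measurable_indicator) auto
      qed
      also have "\<dots> \<le> Q"
        unfolding Q_def
      proof (rule nn_integral_mono)
        \<comment> \<open>Integrating \<open>net_average_close\<close> with \<open>a = u x\<close>
          and expanding each mean by \<open>mean_value_close\<close> produces exactly the terms of
          \<open>Q\<close>.\<close>
        fix j assume "j \<in> space (count_space D)"
        then have j: "j \<in> D" by simp
        let ?k = "\<lambda>i x. (\<integral>\<^sup>+y\<in>ball i r. ennreal \<bar>u y - u x\<bar> \<partial>M) * indicator (ball j r) x"
        have km: "?k i \<in> borel_measurable M" for i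
        proof -
          have "(\<lambda>p. ennreal \<bar>u (snd p) - u (fst p)\<bar>) \<in> borel_measurable (M \<Otimes>\<^sub>M M)" using um by measurable
          then have "(\<lambda>(x, y). ennreal \<bar>u y - u x\<bar> * indicator (ball i r) y) \<in> borel_measurable (M \<Otimes>\<^sub>M M)"
            by (simp add: case_prod_beta' borel_measurable_times_ennreal measurable_compose[OF measurable_snd borel_measurable_indicator])
          then have "(\<lambda>x. \<integral>\<^sup>+y\<in>ball i r. ennreal \<bar>u y - u x\<bar> \<partial>M) \<in> borel_measurable M"
            by (rule borel_measurable_nn_integral)
          then show ?thesis by (intro borel_measurable_times_ennreal borel_measurable_indicator) auto
        qed
        have "(\<integral>\<^sup>+x. ennreal \<bar>v x - u x\<bar> * indicator (ball j r) x \<partial>M)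
            \<le> (\<integral>\<^sup>+x. (\<Sum>i\<in>?F j. ennreal (1 / ?\<mu> i) * ?k i x) \<partial>M)"
        proof (rule nn_integral_mono)
          fix x
          show "ennreal \<bar>v x - u x\<bar> * indicator (ball j r) x \<le> (\<Sum>i\<in>?F j. ennreal (1 / ?\<mu> i) * ?k i x)"
          proof (cases "x \<in> ball j r")
            case True
            then have "ennreal \<bar>v x - u x\<bar> \<le> ennreal (\<Sum>i\<in>?F j. \<bar>m i - u x\<bar>)"
              unfolding v_def using net_average_close[OF D r(1) j] by (intro ennreal_leI) auto
            also have "\<dots> = (\<Sum>i\<in>?F j. ennreal \<bar>m i - u x\<bar>)" by (rule sum_ennreal[symmetric]) auto
            also have "\<dots> \<le> (\<Sum>i\<in>?F j. ennreal (1 / ?\<mu> i) * ?k i x)"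
              unfolding m_def using True mean_value_close[OF u r(1)] by (intro sum_mono) simp
            finally show ?thesis using True by simp
          qed simp
        qed
        also have "\<dots> = (\<Sum>i\<in>?F j. ennreal (1 / ?\<mu> i) * (\<integral>\<^sup>+x. ?k i x \<partial>M))"
          using km by (simp add: nn_integral_sum nn_integral_cmult)
        also have "\<dots> = (\<Sum>i\<in>?F j. ?O j i)"
          by (intro sum.cong refl) (simp add: oscillation_eq[OF um] abs_minus_commute)
        finally show "(\<integral>\<^sup>+x. ennreal \<bar>v x - u x\<bar> * indicator (ball j r) x \<partial>M) \<le> (\<Sum>i\<in>?F j. ?O j i)" .
      qed
      also have "\<dots> \<le> ennreal K0 * energy u \<epsilon>" by (rule Q)
      also have "\<dots> \<le> ennreal K * energy u \<epsilon>" using K by (intro mult_right_mono ennreal_leI) auto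
      finally show ?thesis .
    qed
    moreover have "(\<integral>\<^sup>+x. g x \<partial>M) \<le> ennreal (K / \<epsilon>) * energy u \<epsilon>"
    proof -
      let ?b = "(1 + real N) / r"
      have b: "0 \<le> ?b" using r(1) by simp
      \<comment> \<open>\<open>mean_value_close\<close> is used twice: over \<open>ball j r\<close>
        to expand \<open>m j\<close>, then under the integral to expand \<open>m i\<close>. The
        normalisation from the first use cancels \<open>?\<mu> j\<close>.\<close>
      have mm: "ennreal \<bar>m i - m j\<bar> * ennreal (?\<mu> j) \<le> ?O j i" for i j
      proof -
        have "ennreal \<bar>m i - m j\<bar> \<le> ennreal (1 / ?\<mu> j) * (\<integral>\<^sup>+x\<in>ball j r. ennreal \<bar>u x - m i\<bar> \<partial>M)"
          using mean_value_close[OF u r(1), of j "m i"] by (simp add: m_def abs_minus_commute)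
        then have "ennreal \<bar>m i - m j\<bar> * ennreal (?\<mu> j)
            \<le> ennreal (1 / ?\<mu> j) * (\<integral>\<^sup>+x\<in>ball j r. ennreal \<bar>u x - m i\<bar> \<partial>M) * ennreal (?\<mu> j)"
          by (rule mult_right_mono) simp
        also have "\<dots> = ennreal (1 / ?\<mu> j) * ennreal (?\<mu> j) * (\<integral>\<^sup>+x\<in>ball j r. ennreal \<bar>u x - m i\<bar> \<partial>M)"
          by (simp only: mult.assoc mult.commute)
        also have "ennreal (1 / ?\<mu> j) * ennreal (?\<mu> j) = 1"
          using \<mu>[of j] by (simp add: ennreal_mult[symmetric])
        also have "1 * (\<integral>\<^sup>+x\<in>ball j r. ennreal \<bar>u x - m i\<bar> \<partial>M)
            \<le> (\<integral>\<^sup>+x. ennreal (1 / ?\<mu> i) * ((\<integral>\<^sup>+y\<in>ball i r. ennreal \<bar>u x - u y\<bar> \<partial>M) * indicator (ball j r) x) \<partial>M)"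
          unfolding mult_1
        proof (rule nn_integral_mono)
          fix x
          show "ennreal \<bar>u x - m i\<bar> * indicator (ball j r) x
              \<le> ennreal (1 / ?\<mu> i) * ((\<integral>\<^sup>+y\<in>ball i r. ennreal \<bar>u x - u y\<bar> \<partial>M) * indicator (ball j r) x)"
            using mean_value_close[OF u r(1), of i "u x"]
            by (auto simp: m_def abs_minus_commute indicator_def)
        qed
        also have "\<dots> = ?O j i"
        proof -
          have "(\<lambda>p. ennreal \<bar>u (fst p) - u (snd p)\<bar>) \<in> borel_measurable (M \<Otimes>\<^sub>M M)" using um by measurable
          then have "(\<lambda>(x, y). ennreal \<bar>u x - u y\<bar> * indicator (ball i r) y) \<in> borel_measurable (M \<Otimes>\<^sub>M M)"
            by (simp add: case_prod_beta' borel_measurable_times_ennreal measurable_compose[OF measurable_snd borel_measurable_indicator])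
          then have "(\<lambda>x. \<integral>\<^sup>+y\<in>ball i r. ennreal \<bar>u x - u y\<bar> \<partial>M) \<in> borel_measurable M"
            by (rule borel_measurable_nn_integral)
          then have "(\<lambda>x. (\<integral>\<^sup>+y\<in>ball i r. ennreal \<bar>u x - u y\<bar> \<partial>M) * indicator (ball j r) x) \<in> borel_measurable M"
            by (intro borel_measurable_times_ennreal borel_measurable_indicator) auto
          then show ?thesis by (simp add: nn_integral_cmult oscillation_eq[OF um])
        qed
        finally show ?thesis .
      qed
      have "(\<integral>\<^sup>+x. g x \<partial>M) = (\<integral>\<^sup>+j. ennreal (a j) * ennreal (?\<mu> j) \<partial>count_space D)"
        unfolding g_def nn_integral_net_gradient[OF r(1) D] emeasure_ball ..
      also have "\<dots> \<le> (\<integral>\<^sup>+j. ennreal ?b * (\<Sum>i\<in>?F j. ?O j i) \<partial>count_space D)"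
      proof (rule nn_integral_mono)
        fix j
        have "ennreal (a j) = ennreal ?b * (\<Sum>i\<in>?F j. ennreal \<bar>m i - m j\<bar>)"
          unfolding a_def using b by (subst ennreal_mult) (auto simp: sum_nonneg sum_ennreal)
        then have "ennreal (a j) * ennreal (?\<mu> j) = ennreal ?b * (\<Sum>i\<in>?F j. ennreal \<bar>m i - m j\<bar> * ennreal (?\<mu> j))"
          by (simp only: sum_distrib_right mult.assoc)
        also have "\<dots> \<le> ennreal ?b * (\<Sum>i\<in>?F j. ?O j i)"
          by (intro mult_left_mono sum_mono mm) simp
        finally show "ennreal (a j) * ennreal (?\<mu> j) \<le> ennreal ?b * (\<Sum>i\<in>?F j. ?O j i)" .
      qed
      also have "\<dots> = ennreal ?b * Q" unfolding Q_def by (rule nn_integral_cmult) simp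
      also have "\<dots> \<le> ennreal ?b * (ennreal K0 * energy u \<epsilon>)" using Q by (rule mult_left_mono) simp
      also have "\<dots> = ennreal (?b * K0) * energy u \<epsilon>" by (simp only: ennreal_mult[OF b K0] mult.assoc)
      also have "\<dots> \<le> ennreal (K / \<epsilon>) * energy u \<epsilon>"
      proof (intro mult_right_mono ennreal_leI)
        have "?b * K0 = (1 + real N) * 10 * K0 / \<epsilon>" using r by (simp add: field_simps)
        also have "\<dots> \<le> K / \<epsilon>" using K(3) \<epsilon> by (intro divide_right_mono) auto
        finally show "?b * K0 \<le> K / \<epsilon>" .
      qed simp
      finally show ?thesis .
    qed
    ultimately show "\<exists>v g. locally_lipschitz v \<and> weak_upper_gradient_1 M v g \<and> locally_L1 M g \<and>
      (\<integral>\<^sup>+x. ennreal \<bar>v x - u x\<bar> \<partial>M) \<le> ennreal K * energy u \<epsilon> \<and>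
      (\<integral>\<^sup>+x. g x \<partial>M) \<le> ennreal (K / \<epsilon>) * energy u \<epsilon>" by blast
  qed
qed


section \<open>The two implications\<close>

lemma BV_imp_finite_energy:
  assumes P: "poincare_with M cP \<Lambda>" and u: "u \<in> BV M"
  shows "Liminf (at_right 0) (\<lambda>\<epsilon>::real. ennreal (1 / \<epsilon>) * energy u \<epsilon>) < \<infinity>"
proof -
  obtain K :: real where K: "0 \<le> K" "\<And>u v \<epsilon>. 0 < \<epsilon> \<Longrightarrow> u \<in> borel_measurable M \<Longrightarrow> (\<And>j. locally_lipschitz (v j)) \<Longrightarrow>
     tendsto_L1_loc M v u \<Longrightarrow>
     energy u \<epsilon> \<le> ennreal (K * \<epsilon>) * liminf (\<lambda>j. \<integral>\<^sup>+x. minimal_weak_upper_gradient_1 M (v j) x \<partial>M)"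
    using energy_le_liminf[OF P] by blast
  have um: "u \<in> borel_measurable M" and "total_variation M u < \<infinity>" using u by (auto simp: BV_def)
  then obtain v where v: "\<And>j. locally_lipschitz (v j)" "tendsto_L1_loc M v u"
    and fin: "liminf (\<lambda>j. \<integral>\<^sup>+x. minimal_weak_upper_gradient_1 M (v j) x \<partial>M) < \<infinity>" (is "?V < _")
    unfolding total_variation_def INF_less_iff by blast
  \<comment> \<open>The factor \<open>\<epsilon>\<close> in the energy estimate cancels
    \<open>1 / \<epsilon>\<close>, so the bound is uniform in the scale.\<close>
  have bound: "ennreal (1 / \<epsilon>) * energy u \<epsilon> \<le> ennreal K * ?V" if \<epsilon>: "0 < \<epsilon>" for \<epsilon>
  proof -
    have "ennreal (1 / \<epsilon>) * energy u \<epsilon> \<le> ennreal (1 / \<epsilon>) * (ennreal (K * \<epsilon>) * ?V)"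
      using K(2)[OF \<epsilon> um v] by (rule mult_left_mono) simp
    also have "\<dots> = ennreal (1 / \<epsilon>) * ennreal (K * \<epsilon>) * ?V" by (simp only: mult.assoc)
    also have "ennreal (1 / \<epsilon>) * ennreal (K * \<epsilon>) = ennreal K"
      using \<epsilon> K(1) by (simp add: ennreal_mult[symmetric])
    finally show ?thesis .
  qed
  have "Liminf (at_right 0) (\<lambda>\<epsilon>::real. ennreal (1 / \<epsilon>) * energy u \<epsilon>) \<le> Liminf (at_right (0::real)) (\<lambda>\<epsilon>. ennreal K * ?V)"
    using bound by (intro Liminf_mono eventually_at_right_less[THEN eventually_mono])
  also have "\<dots> = ennreal K * ?V" by (rule Liminf_const) simp
  also have "\<dots> < \<infinity>" using fin by (simp add: ennreal_mult_less_top)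
  finally show ?thesis .
qed

text \<open>A finite lower limit yields scales \<open>e k\<close> tending to 0 with energy at most
  \<open>C * e k\<close>. Along them the convolutions converge to \<open>u\<close> with an error of
  order \<open>e k\<close>, while their gradients have integral at most
  \<open>K * C\<close>.\<close>

lemma finite_energy_imp_BV:
  assumes u: "integrable M u"
    and fin: "Liminf (at_right 0) (\<lambda>\<epsilon>::real. ennreal (1 / \<epsilon>) * energy u \<epsilon>) < \<infinity>"
  shows "u \<in> BV M"
proof -
  obtain K :: real where K: "0 \<le> K" "\<And>u \<epsilon>. 0 < \<epsilon> \<Longrightarrow> integrable M u \<Longrightarrow>
    \<exists>v g. locally_lipschitz v \<and> weak_upper_gradient_1 M v g \<and> locally_L1 M g \<and>
      (\<integral>\<^sup>+x. ennreal \<bar>v x - u x\<bar> \<partial>M) \<le> ennreal K * energy u \<epsilon> \<and>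
      (\<integral>\<^sup>+x. g x \<partial>M) \<le> ennreal (K / \<epsilon>) * energy u \<epsilon>"
    using discrete_convolution by blast
  let ?X = "\<lambda>\<epsilon>::real. ennreal (1 / \<epsilon>) * energy u \<epsilon>"
  obtain C where C: "0 \<le> C" "Liminf (at_right 0) ?X < ennreal C"
  proof -
    obtain n :: nat where "Liminf (at_right 0) ?X < of_nat n"
      using fin ennreal_Ex_less_of_nat[of "Liminf (at_right 0) ?X"] by auto
    then show ?thesis using that[of "real n"] by (simp add: ennreal_of_nat_eq_real_of_nat)
  qed
  have "\<exists>\<epsilon>. 0 < \<epsilon> \<and> \<epsilon> < 1 / real (Suc k) \<and> ?X \<epsilon> < ennreal C" for k
  proof (rule ccontr)
    assume neg: "\<not> ?thesis"
    have "eventually (\<lambda>\<epsilon>. ennreal C \<le> ?X \<epsilon>) (at_right 0)"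
      unfolding eventually_at_right_field
    proof (intro exI[of _ "1 / real (Suc k)"] conjI allI impI)
      fix \<epsilon> :: real assume "0 < \<epsilon>" "\<epsilon> < 1 / real (Suc k)"
      with neg have "\<not> ?X \<epsilon> < ennreal C" by blast
      then show "ennreal C \<le> ?X \<epsilon>" by (simp only: not_less)
    qed simp
    then have "ennreal C \<le> Liminf (at_right 0) ?X" by (rule Liminf_bounded)
    then show False using C(2) by simp
  qed
  then obtain e where e: "\<And>k. 0 < e k" "\<And>k. e k < 1 / real (Suc k)" "\<And>k. ?X (e k) < ennreal C" by metis
  have E: "energy u (e k) \<le> ennreal (C * e k)" for k
  proof -
    have "energy u (e k) = ennreal (e k) * ?X (e k)"
      using e(1)[of k] by (simp add: mult.assoc[symmetric] ennreal_mult[symmetric])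
    also have "\<dots> \<le> ennreal (e k) * ennreal C" using e(3)[of k] by (intro mult_left_mono) auto
    also have "\<dots> = ennreal (C * e k)" using e(1)[of k] C(1) by (simp add: ennreal_mult[symmetric] mult.commute)
    finally show ?thesis .
  qed
  have "\<forall>k. \<exists>v. \<exists>g. locally_lipschitz v \<and> weak_upper_gradient_1 M v g \<and> locally_L1 M g \<and>
      (\<integral>\<^sup>+x. ennreal \<bar>v x - u x\<bar> \<partial>M) \<le> ennreal K * energy u (e k) \<and>
      (\<integral>\<^sup>+x. g x \<partial>M) \<le> ennreal (K / e k) * energy u (e k)"
    using K(2)[OF e(1) u] by blast
  from choice[OF this] obtain v where v: "\<forall>k. \<exists>g. locally_lipschitz (v k) \<and> weak_upper_gradient_1 M (v k) g \<and> locally_L1 M g \<and>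
      (\<integral>\<^sup>+x. ennreal \<bar>v k x - u x\<bar> \<partial>M) \<le> ennreal K * energy u (e k) \<and>
      (\<integral>\<^sup>+x. g x \<partial>M) \<le> ennreal (K / e k) * energy u (e k)" ..
  have lip: "locally_lipschitz (v k)" for k using v by blast
  have grad: "(\<integral>\<^sup>+x. minimal_weak_upper_gradient_1 M (v k) x \<partial>M) \<le> ennreal (K * C)" for k
  proof -
    obtain g where g: "weak_upper_gradient_1 M (v k) g" "locally_L1 M g"
      "(\<integral>\<^sup>+x. g x \<partial>M) \<le> ennreal (K / e k) * energy u (e k)" using v by blast
    \<comment> \<open>Minimality turns the bound for the explicit gradient \<open>g\<close> into one
      for the chosen minimal gradient.\<close>
    have "AE x in M. minimal_weak_upper_gradient_1 M (v k) x \<le> g x"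
      using minimal_weak_upper_gradient_locally_lipschitz[OF lip[of k]] g(1,2)
      unfolding is_minimal_weak_upper_gradient_1_def by blast
    then have "(\<integral>\<^sup>+x. minimal_weak_upper_gradient_1 M (v k) x \<partial>M) \<le> (\<integral>\<^sup>+x. g x \<partial>M)"
      by (rule nn_integral_mono_AE)
    also have "\<dots> \<le> ennreal (K / e k) * energy u (e k)" by (rule g(3))
    also have "\<dots> \<le> ennreal (K / e k) * ennreal (C * e k)" using E by (rule mult_left_mono) simp
    also have "\<dots> = ennreal (K * C)" using e(1)[of k] K(1) C(1) by (simp add: ennreal_mult[symmetric])
    finally show ?thesis .
  qed
  have "(\<lambda>k. ennreal (K * C * (1 / real (Suc k)))) \<longlonglongrightarrow> ennreal (K * C * 0)"
    using LIMSEQ_inverse_real_of_nat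
    by (intro tendsto_ennrealI tendsto_mult tendsto_const) (simp add: inverse_eq_divide)
  then have lim: "(\<lambda>k. ennreal (K * C * (1 / real (Suc k)))) \<longlonglongrightarrow> 0" by simp
  have dist: "(\<integral>\<^sup>+y\<in>A. ennreal \<bar>v k y - u y\<bar> \<partial>M) \<le> ennreal (K * C * (1 / real (Suc k)))" for k A
  proof -
    have "(\<integral>\<^sup>+y\<in>A. ennreal \<bar>v k y - u y\<bar> \<partial>M) \<le> (\<integral>\<^sup>+y. ennreal \<bar>v k y - u y\<bar> \<partial>M)"
      by (intro nn_integral_mono) (auto simp: indicator_def)
    also have "\<dots> \<le> ennreal K * energy u (e k)" using v by blast
    also have "\<dots> \<le> ennreal K * ennreal (C * e k)" using E by (rule mult_left_mono) simp
    also have "\<dots> = ennreal (K * C * e k)" using K(1) C(1) e(1)[of k] by (simp add: ennreal_mult[symmetric] mult.assoc)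
    also have "\<dots> \<le> ennreal (K * C * (1 / real (Suc k)))"
      using K(1) C(1) e(2)[of k] by (intro ennreal_leI mult_left_mono) auto
    finally show ?thesis .
  qed
  have "tendsto_L1_loc M v u"
    unfolding tendsto_L1_loc_def
  proof (intro allI exI[of _ 1] conjI)
    show "(\<lambda>j. \<integral>\<^sup>+y\<in>ball x 1. ennreal \<bar>v j y - u y\<bar> \<partial>M) \<longlonglongrightarrow> 0" for x
      using dist by (intro tendsto_sandwich[OF _ _ tendsto_const lim] always_eventually allI) auto
  qed simp
  then have "total_variation M u \<le> liminf (\<lambda>k. \<integral>\<^sup>+x. minimal_weak_upper_gradient_1 M (v k) x \<partial>M)"
    unfolding total_variation_def using lip by (intro INF_lower) auto
  also have "\<dots> \<le> liminf (\<lambda>k::nat. ennreal (K * C))"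
    using grad by (intro Liminf_mono always_eventually allI)
  also have "\<dots> = ennreal (K * C)" by (rule Liminf_const) simp
  also have "\<dots> < \<infinity>" by simp
  finally show ?thesis using u by (simp add: BV_def)
qed

end

theorem theorem3p1:
  fixes M :: "'a::complete_space measure" and u :: "'a \<Rightarrow> real"
  assumes "borel_regular_measure M"
    and "doubling_measure M"
    and "supports_poincare_1 M"
    and "integrable M u"
  shows "u \<in> BV M \<longleftrightarrow>
    Liminf (at_right 0) (\<lambda>\<epsilon>::real. ennreal (1 / \<epsilon>) *
      (\<integral>\<^sup>+(x, y)\<in>{(x, y). dist x y < \<epsilon>}.
         ennreal (\<bar>u x - u y\<bar> / (sqrt (measure M (ball x \<epsilon>)) * sqrt (measure M (ball y \<epsilon>))))
       \<partial>(M \<Otimes>\<^sub>M M))) < \<infinity>"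
proof -
  obtain c where "metric_doubling M c" using doubling_measure_imp_locale[OF assms(1,2)] .
  then interpret complete_doubling M c by (simp add: complete_doubling_def)
  obtain cP \<Lambda> where P: "poincare_with M cP \<Lambda>"
    using assms(3) unfolding supports_poincare_1_def poincare_with_def by blast
  show ?thesis
    using BV_imp_finite_energy[OF P, of u] finite_energy_imp_BV[OF assms(4)]
    unfolding energy_def by blast
qed

end
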